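(* Let $\mathfrak T$ be a measurable action of an inductively compact group $G$ on a standard Borel space $(X,\mathcal B)$. Let $f:X\to\mathbb R_{>0}$ be measurable, positive and fibrewise continuous. Then: (1) The sets $\mathfrak M^\infty_{f,1,\mathrm{inv}}(\mathfrak T)$ and $\mathfrak M^\infty_{f,1,\mathrm{erg}}(\mathfrak T)$ are Borel subsets of $\mathfrak M^\infty(X)$. (2) Every measure $\eta\in\mathfrak M^\infty_{f,1,\mathrm{erg}}(\mathfrak T)$ is indecomposable in $\mathfrak M^\infty_{f,1,\mathrm{inv}}(\mathfrak T)$. (3) For any $\nu\in\mathfrak M^\infty_{f,1,\mathrm{inv}}(\mathfrak T)$ there exists a unique Borel probability measure $\overline\nu$ on $\mathfrak M^\infty_{f,1,\mathrm{erg}}(\mathfrak T)$ such that $$\nu=\int_{\mathfrak M^\infty_{f,1,\mathrm{erg}}(\mathfrak T)}\eta\,d\overline\nu(\eta).$$ The bijective correspondence $\nu\to\overline\nu$ is a Borel isomorphism of the Borel spaces $\mathfrak M^\infty_{f,1,\mathrm{inv}}(\mathfrak T)$ and $\mathfrak M\big(\mathfrak M^\infty_{f,1,\mathrm{erg}}(\mathfrak T)\big)$.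
   Context: A standard Borel space is a pair $(X,\mathcal B)$, $\mathcal B$ a sigma-algebra on $X$, admitting a bijection of $X$ onto the unit interval carrying $\mathcal B$ to the Borel sigma-algebra. An inductively compact group is $G=\bigcup_{n\ge1}K(n)$, where $K(1)\subset K(2)\subset\cdots$ is an ascending chain of metrizable compact groups; $G$ carries the inductive limit topology (a function on $G$ is continuous iff its restriction to every $K(n)$ is continuous) and the Borel sigma-algebra spanned by those of the $K(n)$. A measurable action $\mathfrak T$ of $G$ on $X$ is an action $g\mapsto T_g$ with $(g,x)\mapsto T_gx$ Borel-measurable on $G\times X$. A Borel function $f:X\to\mathbb R$ is fibrewise continuous if for every $x\in X$ the function $g\mapsto f(T_gx)$ is continuous on $G$. $\mathfrak M^\infty(X)$ is the space of $\sigma$-finite (possibly finite) Borel measures on $X$, with the sigma-algebra generated by the sets $\{\nu:\alpha<\nu(A)<\beta\}$, $\alpha,\beta$ real, $A\subset X$ Borel. $\mathfrak M^\infty_{f,1,\mathrm{inv}}(\mathfrak T)$ is the set of $G$-invariant $\nu\in\mathfrak M^\infty(X)$ with $f\in L_1(X,\nu)$ and $\int f\,d\nu=1$; $\mathfrak M^\infty_{f,1,\mathrm{erg}}(\mathfrak T)$ is the subset of those which are ergodic (every $G$-invariant Borel set is $\nu$-null or has $\nu$-null complement). A measure $\eta$ is indecomposable in $\mathfrak M^\infty_{f,1,\mathrm{inv}}(\mathfrak T)$ if $\eta=\alpha\eta_1+(1-\alpha)\eta_2$ with $\alpha\in(0,1)$ and $\eta_1,\eta_2$ in that set implies $\eta=\eta_1=\eta_2$.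 For a space $Y$ with a Borel structure, $\mathfrak M(Y)$ is the space of Borel probability measures on $Y$, with the sigma-algebra generated by the sets $\{m:m(B)>\alpha\}$, $B\subset Y$ Borel, $\alpha\in\mathbb R$. The equality $\nu=\int\eta\,d\overline\nu(\eta)$ means that for every Borel $A\subset X$ with $\nu(A)<+\infty$ the function $\eta\mapsto\eta(A)$ is $\overline\nu$-integrable and $\nu(A)=\int\eta(A)\,d\overline\nu(\eta)$. *)

theory Defs
  imports "HOL-Probability.Probability" "HOL-Algebra.Group_Action"
begin

text \<open>A Borel space is given by a value \<open>X :: 'a measure\<close> of which only \<open>space X\<close> and
  \<open>sets X\<close> matter; the measure it carries is ignored.\<close>

definition borel_isomorphism :: "'a measure \<Rightarrow> 'b measure \<Rightarrow> ('a \<Rightarrow> 'b) \<Rightarrow> bool" where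
  "borel_isomorphism M N \<phi> \<longleftrightarrow>
     bij_betw \<phi> (space M) (space N) \<and>
     \<phi> \<in> measurable M N \<and> inv_into (space M) \<phi> \<in> measurable N M"

definition standard_borel_space :: "'a measure \<Rightarrow> bool" where
  "standard_borel_space X \<longleftrightarrow>
     (\<exists>\<phi>. borel_isomorphism X (restrict_space borel {0..1::real}) \<phi>)"

text \<open>The topological groups \<open>K n\<close> are recorded by their topologies, with underlying sets
  \<open>topspace (K n)\<close>; the chain starts at index \<open>0\<close>.  Each member is a topological subgroup of
  the next one, i.e. it carries the subspace topology.\<close>

locale inductively_compact_group = group G
  for G :: "('g, 'm) monoid_scheme" (structure) +
  fixes K :: "nat \<Rightarrow> 'g topology"
  assumes carrier_eq_Union: "carrier G = (\<Union>n. topspace (K n))"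
    and subgroup_topspace: "subgroup (topspace (K n)) G"
    and continuous_map_mult:
      "continuous_map (prod_topology (K n) (K n)) (K n) (\<lambda>(g, h). g \<otimes> h)"
    and continuous_map_inv: "continuous_map (K n) (K n) (\<lambda>g. inv g)"
    and compact_space: "compact_space (K n)"
    and metrizable_space: "metrizable_space (K n)"
    and topspace_Suc: "topspace (K n) \<subseteq> topspace (K (Suc n))"
    and subtopology_Suc: "K n = subtopology (K (Suc n)) (topspace (K n))"

definition inductive_limit_topology :: "(nat \<Rightarrow> 'g topology) \<Rightarrow> 'g topology" where
  "inductive_limit_topology K =
     topology (\<lambda>U. U \<subseteq> (\<Union>n. topspace (K n)) \<and> (\<forall>n. openin (K n) (U \<inter> topspace (K n))))"

lemma openin_inductive_limit_topology:
  "openin (inductive_limit_topology K) U \<longleftrightarrow>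
     U \<subseteq> (\<Union>n. topspace (K n)) \<and> (\<forall>n. openin (K n) (U \<inter> topspace (K n)))"
proof -
  have "istopology (\<lambda>U. U \<subseteq> (\<Union>n. topspace (K n)) \<and> (\<forall>n. openin (K n) (U \<inter> topspace (K n))))"
    unfolding istopology_def
  proof (intro conjI allI impI)
    fix S T n
    assume "S \<subseteq> (\<Union>n. topspace (K n)) \<and> (\<forall>n. openin (K n) (S \<inter> topspace (K n)))"
      and "T \<subseteq> (\<Union>n. topspace (K n)) \<and> (\<forall>n. openin (K n) (T \<inter> topspace (K n)))"
    then have "openin (K n) ((S \<inter> topspace (K n)) \<inter> (T \<inter> topspace (K n)))"
      by (meson openin_Int)
    then show "openin (K n) (S \<inter> T \<inter> topspace (K n))"
      by (simp add: Int_ac)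
  next
    fix \<K> n
    assume *: "\<forall>S\<in>\<K>. S \<subseteq> (\<Union>n. topspace (K n)) \<and> (\<forall>n. openin (K n) (S \<inter> topspace (K n)))"
    have "openin (K n) (\<Union>((\<lambda>S. S \<inter> topspace (K n)) ` \<K>))"
      using * by (intro openin_Union) auto
    then show "openin (K n) (\<Union>\<K> \<inter> topspace (K n))"
      by (simp add: Int_commute Int_Union)
  qed auto
  then show ?thesis
    unfolding inductive_limit_topology_def by (simp add: topology_inverse')
qed

lemma topspace_inductive_limit_topology:
  "topspace (inductive_limit_topology K) = (\<Union>n. topspace (K n))"
proof -
  have "(\<Union>n. topspace (K n)) \<inter> topspace (K m) = topspace (K m)" for m
    by auto
  then have "openin (inductive_limit_topology K) (\<Union>n. topspace (K n))"
    by (simp add: openin_inductive_limit_topology)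
  moreover have "topspace (inductive_limit_topology K) \<subseteq> (\<Union>n. topspace (K n))"
    using openin_topspace[of "inductive_limit_topology K"]
    unfolding openin_inductive_limit_topology by blast
  ultimately show ?thesis
    by (simp add: openin_subset subset_antisym)
qed

lemma continuous_map_inductive_limit_topology:
  "continuous_map (inductive_limit_topology K) Y \<phi> \<longleftrightarrow> (\<forall>n. continuous_map (K n) Y \<phi>)"
proof -
  have eq: "{x \<in> \<Union>n. topspace (K n). \<phi> x \<in> U} \<inter> topspace (K m) = {x \<in> topspace (K m). \<phi> x \<in> U}"
    for U m by auto
  show ?thesis
    unfolding continuous_map_def topspace_inductive_limit_topology
      openin_inductive_limit_topology eq by blast
qed

definition borel_of_topology :: "'g topology \<Rightarrow> 'g measure" where
  "borel_of_topology \<tau> = sigma (topspace \<tau>) {U. openin \<tau> U}"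

definition inductive_limit_borel :: "(nat \<Rightarrow> 'g topology) \<Rightarrow> 'g measure" where
  "inductive_limit_borel K =
     sigma (\<Union>n. topspace (K n)) (\<Union>n. sets (borel_of_topology (K n)))"

text \<open>\<open>group_action\<close> makes each \<open>T g\<close> a bijection of \<open>space X\<close> that is
  \<open>undefined\<close> outside \<open>space X\<close> (an element of \<open>BijGroup (space X)\<close>); this only fixes
  junk values.\<close>

definition measurable_action ::
  "('g, 'm) monoid_scheme \<Rightarrow> (nat \<Rightarrow> 'g topology) \<Rightarrow> 'a measure \<Rightarrow> ('g \<Rightarrow> 'a \<Rightarrow> 'a) \<Rightarrow> bool" where
  "measurable_action G K X T \<longleftrightarrow>
     group_action G (space X) T \<and>
     (\<lambda>(g, x). T g x) \<in> measurable (inductive_limit_borel K \<Otimes>\<^sub>M X) X"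

definition fibrewise_continuous ::
  "(nat \<Rightarrow> 'g topology) \<Rightarrow> 'a measure \<Rightarrow> ('g \<Rightarrow> 'a \<Rightarrow> 'a) \<Rightarrow> ('a \<Rightarrow> real) \<Rightarrow> bool" where
  "fibrewise_continuous K X T f \<longleftrightarrow>
     f \<in> borel_measurable X \<and>
     (\<forall>x\<in>space X. continuous_map (inductive_limit_topology K) euclideanreal (\<lambda>g. f (T g x)))"

definition sigma_finite_measures :: "'a measure \<Rightarrow> 'a measure set" where
  "sigma_finite_measures X = {\<nu>. sets \<nu> = sets X \<and> sigma_finite_measure \<nu>}"

text \<open>The bounds are compared in the extended reals because \<open>\<alpha>\<close> may be negative and
  \<open>emeasure \<nu> A\<close> infinite.\<close>

definition sigma_finite_algebra :: "'a measure \<Rightarrow> 'a measure measure" where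
  "sigma_finite_algebra X =
     sigma (sigma_finite_measures X)
       {{\<nu> \<in> sigma_finite_measures X.
           ereal \<alpha> < enn2ereal (emeasure \<nu> A) \<and> enn2ereal (emeasure \<nu> A) < ereal \<beta>} |
        \<alpha> \<beta> A. A \<in> sets X}"

definition invariant_measures ::
  "('g, 'm) monoid_scheme \<Rightarrow> 'a measure \<Rightarrow> ('g \<Rightarrow> 'a \<Rightarrow> 'a) \<Rightarrow> ('a \<Rightarrow> real) \<Rightarrow> 'a measure set" where
  "invariant_measures G X T f =
     {\<nu> \<in> sigma_finite_measures X.
        (\<forall>g\<in>carrier G. distr \<nu> X (T g) = \<nu>) \<and> integrable \<nu> f \<and> (\<integral>x. f x \<partial>\<nu>) = 1}"

definition ergodic ::
  "('g, 'm) monoid_scheme \<Rightarrow> 'a measure \<Rightarrow> ('g \<Rightarrow> 'a \<Rightarrow> 'a) \<Rightarrow> 'a measure \<Rightarrow> bool" where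
  "ergodic G X T \<nu> \<longleftrightarrow>
     (\<forall>A\<in>sets X. (\<forall>g\<in>carrier G. T g ` A = A) \<longrightarrow>
        emeasure \<nu> A = 0 \<or> emeasure \<nu> (space X - A) = 0)"

definition ergodic_measures ::
  "('g, 'm) monoid_scheme \<Rightarrow> 'a measure \<Rightarrow> ('g \<Rightarrow> 'a \<Rightarrow> 'a) \<Rightarrow> ('a \<Rightarrow> real) \<Rightarrow> 'a measure set" where
  "ergodic_measures G X T f = {\<nu> \<in> invariant_measures G X T f. ergodic G X T \<nu>}"

definition indecomposable_in :: "'a measure set \<Rightarrow> 'a measure \<Rightarrow> bool" where
  "indecomposable_in S \<eta> \<longleftrightarrow>
     \<eta> \<in> S \<and>
     (\<forall>\<eta>\<^sub>1\<in>S. \<forall>\<eta>\<^sub>2\<in>S. \<forall>\<alpha>\<in>{0<..<1::real}.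
        (\<forall>A\<in>sets \<eta>. emeasure \<eta> A =
           ennreal \<alpha> * emeasure \<eta>\<^sub>1 A + ennreal (1 - \<alpha>) * emeasure \<eta>\<^sub>2 A) \<longrightarrow>
        \<eta> = \<eta>\<^sub>1 \<and> \<eta> = \<eta>\<^sub>2)"

text \<open>Integrability of \<open>\<eta> \<mapsto> \<eta>(A)\<close> is spelled out for the \<open>[0, \<infinity>]\<close>-valued function
  \<open>\<lambda>\<eta>. emeasure \<eta> A\<close>: the Bochner notion would have to be applied to
  \<open>\<lambda>\<eta>. measure \<eta> A\<close>, which takes the value \<open>0\<close> where \<open>\<eta>(A) = \<infinity>\<close>.\<close>

definition is_decomposition :: "'a measure \<Rightarrow> 'a measure measure \<Rightarrow> bool" where
  "is_decomposition \<nu> m \<longleftrightarrow>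
     (\<forall>A\<in>sets \<nu>. emeasure \<nu> A < \<infinity> \<longrightarrow>
        (\<lambda>\<eta>. emeasure \<eta> A) \<in> borel_measurable m \<and>
        (\<integral>\<^sup>+\<eta>. emeasure \<eta> A \<partial>m) < \<infinity> \<and>
        emeasure \<nu> A = (\<integral>\<^sup>+\<eta>. emeasure \<eta> A \<partial>m))"

definition ergodic_borel_space ::
  "('g, 'm) monoid_scheme \<Rightarrow> 'a measure \<Rightarrow> ('g \<Rightarrow> 'a \<Rightarrow> 'a) \<Rightarrow> ('a \<Rightarrow> real) \<Rightarrow> 'a measure measure" where
  "ergodic_borel_space G X T f = restrict_space (sigma_finite_algebra X) (ergodic_measures G X T f)"

text \<open>The sigma-algebra of \<open>prob_algebra Y\<close> is the one generated by the sets
  \<open>{m. m(B) > \<alpha>}\<close>.\<close>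

lemma sets_prob_algebra_eq_sigma_sets:
  "sets (prob_algebra Y) =
     sigma_sets (space (prob_algebra Y))
       {{m \<in> space (prob_algebra Y). \<alpha> < measure m B} | \<alpha> B. B \<in> sets Y}"
  (is "_ = sigma_sets ?P ?S")
proof
  have S: "?S \<subseteq> Pow ?P" by auto
  let ?N = "sigma ?P ?S"
  have sets_N: "sets ?N = sigma_sets ?P ?S" and space_N: "space ?N = ?P"
    using S by (simp_all add: sets_measure_of space_measure_of)
  have "(\<lambda>m. m) \<in> measurable ?N (prob_algebra Y)"
  proof (intro measurable_prob_algebraI measurable_subprob_algebra)
    fix m assume "m \<in> space ?N"
    then show "prob_space m" "subprob_space m" "sets m = sets Y"
      unfolding space_N by (auto simp: space_prob_algebra prob_space_imp_subprob_space)
  next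
    fix B assume B: "B \<in> sets Y"
    have "(\<lambda>m. measure m B) \<in> borel_measurable ?N"
    proof (rule borel_measurableI_greater)
      fix \<alpha>
      show "{m \<in> space ?N. \<alpha> < measure m B} \<in> sets ?N"
        unfolding space_N sets_N using B by (intro sigma_sets.Basic) auto
    qed
    then have "(\<lambda>m. ennreal (measure m B)) \<in> borel_measurable ?N" by measurable
    moreover have "emeasure m B = ennreal (measure m B)" if "m \<in> space ?N" for m
    proof -
      interpret prob_space m using that unfolding space_N by (simp add: space_prob_algebra)
      show ?thesis by (rule emeasure_eq_measure)
    qed
    ultimately show "(\<lambda>m. emeasure m B) \<in> borel_measurable ?N"
      by (simp cong: measurable_cong)
  qed
  then show "sets (prob_algebra Y) \<subseteq> sigma_sets ?P ?S"
    unfolding sets_N[symmetric]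
  proof (intro subsetI)
    fix A assume m: "(\<lambda>m. m) \<in> measurable ?N (prob_algebra Y)" and A: "A \<in> sets (prob_algebra Y)"
    have "(\<lambda>m. m) -` A \<inter> space ?N = A"
      using sets.sets_into_space[OF A] by (auto simp: space_N)
    then show "A \<in> sets ?N" using measurable_sets[OF m A] by simp
  qed
  show "sigma_sets ?P ?S \<subseteq> sets (prob_algebra Y)"
  proof (rule sets.sigma_sets_subset, safe)
    fix \<alpha> :: real and B assume [measurable]: "B \<in> sets Y"
    show "{m \<in> ?P. \<alpha> < measure m B} \<in> sets (prob_algebra Y)" by measurable
  qed
qed

end

theory Submission
  imports Defs
begin

text \<open>The map taking \<open>\<nu>\<close> to \<open>f\<close> times \<open>\<nu>\<close> turns the normalised invariant measures into probability measures.
  Averaging over \<open>K n\<close> with weight \<open>f\<close> against Haar measure gives Markov kernels \<open>average n\<close>, finite because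
  \<open>f\<close> is bounded on the compact orbits of \<open>K n\<close>, and a law \<open>P\<close> comes from an invariant measure iff
  \<open>P \<bind> average n = P\<close> for all \<open>n\<close>. For such \<open>P\<close>, \<open>average n\<close> is a conditional distribution given the
  \<open>K n\<close>-invariant sets. These algebras decrease, so by reverse martingale convergence the kernels converge
  almost surely to a limit kernel that does not depend on \<open>P\<close> and is the conditional distribution given the
  invariant sets. Its values are almost surely ergodic, it is almost surely constant under an ergodic
  law, and the law of its value under \<open>P\<close> is the only decomposition of \<open>P\<close>.

  Haar measure is obtained from covering numbers by sets that are small simultaneously under all two-sided
  translations and inversions: a cluster point of the normalised covering numbers is a finitely
  subadditive content, additive on separated sets, and it extends to an invariant Borel measure.\<close>

section \<open>Invariant measures on compact metric spaces\<close>

text \<open>The measures may be infinite and \<open>G\<close> need not be compact, so neither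
  normalisation nor averaging over \<open>G\<close> is directly available; the weight
  \<open>f\<close> repairs the first, compactness of each \<open>K n\<close> the second. The
  averages are constant on \<open>K n\<close>-orbits and give full mass to every
  \<open>K n\<close>-invariant Borel set containing the point, at every point and not just almost
  everywhere. Hence the kernels involve no null sets that depend on a measure, the algebras consist
  of strictly invariant sets, as in the definition of ergodicity, and one limit kernel can serve
  uncountably many laws.

  Uniqueness rests on one event: that the limit kernel, turned back into a measure, lies in a Borel
  set \<open>C\<close> of ergodic measures. Under an ergodic component it has mass 1 or 0 according
  to whether the component is in \<open>C\<close>, so every decomposing measure gives
  \<open>C\<close> the mass of this event.

  Covering numbers by simultaneously small sets do not grow under any of the maps, hence are exactly
  invariant under the invertible ones. Two-sided and inversion invariance thus come at once, without
  uniqueness of Haar measure; inversion makes the averages symmetric.\<close>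

definition inner_content :: "'a topology \<Rightarrow> ('a set \<Rightarrow> ennreal) \<Rightarrow> 'a set \<Rightarrow> ennreal" where
  "inner_content \<tau> lam U = (SUP C\<in>{C. closedin \<tau> C \<and> C \<subseteq> U}. lam C)"

definition outer_content :: "'a topology \<Rightarrow> ('a set \<Rightarrow> ennreal) \<Rightarrow> 'a set \<Rightarrow> ennreal" where
  "outer_content \<tau> lam A = (INF U\<in>{U. openin \<tau> U \<and> A \<subseteq> U}. inner_content \<tau> lam U)"

lemma inner_content_upper: "closedin \<tau> C \<Longrightarrow> C \<subseteq> U \<Longrightarrow> lam C \<le> inner_content \<tau> lam U"
  unfolding inner_content_def by (intro SUP_upper) auto

lemma inner_content_mono: "U \<subseteq> V \<Longrightarrow> inner_content \<tau> lam U \<le> inner_content \<tau> lam V"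
  unfolding inner_content_def by (intro SUP_subset_mono) auto

lemma outer_content_lower: "openin \<tau> U \<Longrightarrow> A \<subseteq> U \<Longrightarrow> outer_content \<tau> lam A \<le> inner_content \<tau> lam U"
  unfolding outer_content_def by (intro INF_lower) auto

lemma outer_content_mono: "A \<subseteq> B \<Longrightarrow> outer_content \<tau> lam A \<le> outer_content \<tau> lam B"
  unfolding outer_content_def by (intro INF_superset_mono) auto

lemma outer_content_openin: "openin \<tau> U \<Longrightarrow> outer_content \<tau> lam U = inner_content \<tau> lam U"
  by (intro antisym outer_content_lower)
     (auto simp: outer_content_def intro!: INF_greatest inner_content_mono)

text \<open>A closed subset of the image of \<open>U\<close> is the image of a closed subset of
  \<open>U\<close>, so the contents of open sets do not grow. The converse inequality comes later
  from the inverse homeomorphism.\<close>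

lemma outer_content_homeomorphic_le:
  assumes \<phi>: "homeomorphic_map \<tau> \<tau> \<phi>"
    and lam: "\<And>A. A \<subseteq> topspace \<tau> \<Longrightarrow> lam (\<phi> ` A) = lam A"
    and A: "A \<subseteq> topspace \<tau>"
  shows "outer_content \<tau> lam (\<phi> ` A) \<le> outer_content \<tau> lam A"
  unfolding outer_content_def[of \<tau> lam A]
proof (rule INF_greatest, safe)
  fix U assume U: "openin \<tau> U" "A \<subseteq> U"
  have "openin \<tau> (\<phi> ` U)"
    using homeomorphic_map_openness_eq[OF \<phi>] U(1) by blast
  then have "outer_content \<tau> lam (\<phi> ` A) \<le> inner_content \<tau> lam (\<phi> ` U)"
    using U by (intro outer_content_lower) auto
  also have "\<dots> \<le> inner_content \<tau> lam U"
    unfolding inner_content_def[of \<tau> lam "\<phi> ` U"]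
  proof (rule SUP_least, safe)
    fix C assume C: "closedin \<tau> C" "C \<subseteq> \<phi> ` U"
    define C' where "C' = {x\<in>topspace \<tau>. \<phi> x \<in> C}"
    have inj: "inj_on \<phi> (topspace \<tau>)" and onto: "\<phi> ` topspace \<tau> = topspace \<tau>"
      using \<phi> by (auto simp: homeomorphic_eq_everything_map)
    have sub: "C' \<subseteq> topspace \<tau>" "U \<subseteq> topspace \<tau>"
      using U(1) openin_subset by (auto simp: C'_def)
    have "C' \<subseteq> U"
      using C(2) inj sub unfolding C'_def inj_on_def by blast
    moreover have "\<phi> ` C' = C"
      using C(2) sub by (auto simp: C'_def)
    moreover have "closedin \<tau> C'"
      using \<phi> C(1) unfolding C'_def
      by (intro closedin_continuous_map_preimage homeomorphic_imp_continuous_map)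
    ultimately show "lam C \<le> inner_content \<tau> lam U"
      using lam[OF sub(1)] inner_content_upper[of \<tau> C' U lam] by simp
  qed
  finally show "outer_content \<tau> lam (\<phi> ` A) \<le> inner_content \<tau> lam U" .
qed

text \<open>Additivity is demanded only at positive distance, because this is all that covering
  numbers give: a set of small enough diameter cannot meet both parts. Compactness turns disjoint
  closed sets into such a pair.\<close>

locale metric_content = Metric_space M d for M :: "'a set" and d +
  fixes lam :: "'a set \<Rightarrow> ennreal"
  assumes compact_space: "compact_space mtopology"
    and content_empty: "lam {} = 0"
    and content_finite: "lam M < \<infinity>"
    and content_mono: "A \<subseteq> B \<Longrightarrow> B \<subseteq> M \<Longrightarrow> lam A \<le> lam B"
    and content_subadd: "A \<subseteq> M \<Longrightarrow> B \<subseteq> M \<Longrightarrow> lam (A \<union> B) \<le> lam A + lam B"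
    and content_separated: "A \<subseteq> M \<Longrightarrow> B \<subseteq> M \<Longrightarrow> 0 < e \<Longrightarrow> (\<And>x y. x \<in> A \<Longrightarrow> y \<in> B \<Longrightarrow> e \<le> d x y) \<Longrightarrow>
        lam A + lam B \<le> lam (A \<union> B)"
begin

abbreviation "inn \<equiv> inner_content mtopology lam"
abbreviation "out \<equiv> outer_content mtopology lam"

lemma inner_M: "inn M = lam M"
  using closedin_topspace[of mtopology] inner_content_upper[of mtopology M M lam]
  by (intro antisym) (auto simp: inner_content_def intro!: SUP_least content_mono)

lemma inner_empty: "inn {} = 0"
  by (simp add: inner_content_def content_empty)

lemma outer_empty: "out {} = 0"
  using outer_content_openin[of mtopology "{}" lam] by (simp add: inner_empty)

lemma outer_finite: assumes "A \<subseteq> M" shows "out A < \<infinity>"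
proof -
  have "out A \<le> inn M" using assms openin_topspace[of mtopology] by (intro outer_content_lower) auto
  then show ?thesis using inner_M content_finite by simp
qed

text \<open>A closed subset of \<open>U \<union> V\<close> is split into closed subsets of \<open>U\<close> and \<open>V\<close> by a Lebesgue number.\<close>

lemma inner_Un_le:
  assumes U: "openin mtopology U" and V: "openin mtopology V"
  shows "inn (U \<union> V) \<le> inn U + inn V"
  unfolding inner_content_def[of _ _ "U \<union> V"]
proof (rule SUP_least, safe)
  fix C assume C: "closedin mtopology C" "C \<subseteq> U \<union> V"
  then have "compactin mtopology C"
    using compact_space closedin_compact_space by blast
  then obtain e where e: "e > 0" "\<forall>x\<in>C. \<exists>W\<in>{U, V}. mball x e \<subseteq> W"
    using lebesgue_number[of C "{U, V}"] C(2) U V by auto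
  define S where "S W = mtopology closure_of {x\<in>C. mball x e \<subseteq> W}" for W
  have CM: "C \<subseteq> M" using closedin_subset[OF C(1)] by simp
  have S: "closedin mtopology (S W)" "S W \<subseteq> W" "S W \<subseteq> M" for W
  proof -
    show "closedin mtopology (S W)" by (simp add: S_def)
    then show "S W \<subseteq> M" using closedin_subset by force
    show "S W \<subseteq> W"
    proof
      fix y assume "y \<in> S W"
      then obtain x where "x \<in> C" "mball x e \<subseteq> W" "x \<in> mball y e"
        using e(1) unfolding S_def metric_closure_of by blast
      then show "y \<in> W" by (auto simp: commute)
    qed
  qed
  have "C \<subseteq> S U \<union> S V"
    using e(2) CM closure_of_subset[of "{x\<in>C. mball x e \<subseteq> U}" mtopology]
      closure_of_subset[of "{x\<in>C. mball x e \<subseteq> V}" mtopology]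
    unfolding S_def by fastforce
  then have "lam C \<le> lam (S U \<union> S V)"
    using S(3) by (intro content_mono) auto
  also have "\<dots> \<le> lam (S U) + lam (S V)"
    using S(3) by (intro content_subadd)
  also have "\<dots> \<le> inn U + inn V"
    using S by (intro add_mono inner_content_upper)
  finally show "lam C \<le> inn U + inn V" .
qed

text \<open>Each closed set competing in the supremum is compact, so finitely many of the
  \<open>U i\<close> cover it and binary subadditivity can be iterated.\<close>

lemma inner_UN_le:
  assumes U: "\<And>i. openin mtopology (U i)"
  shows "inn (\<Union>i. U i) \<le> (\<Sum>i::nat. inn (U i))"
  unfolding inner_content_def[of _ _ "\<Union>i. U i"]
proof (rule SUP_least, safe)
  have fin: "inn (\<Union>i<n. U i) \<le> (\<Sum>i<n. inn (U i))" for n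
  proof (induction n)
    case (Suc n)
    have "inn (\<Union>i<Suc n. U i) = inn (U n \<union> (\<Union>i<n. U i))"
      by (simp add: lessThan_Suc)
    also have "\<dots> \<le> inn (U n) + inn (\<Union>i<n. U i)"
      using U by (intro inner_Un_le) auto
    finally show ?case using Suc by (simp add: add.commute) (meson add_left_mono order_trans)
  qed (simp add: inner_empty)
  fix C assume C: "closedin mtopology C" "C \<subseteq> (\<Union>i. U i)"
  then have "compactin mtopology C"
    using compact_space closedin_compact_space by blast
  then obtain \<F> where \<F>: "finite \<F>" "\<F> \<subseteq> range U" "C \<subseteq> \<Union>\<F>"
    using compactinD[of mtopology C "range U"] C(2) U by auto
  then obtain I where I: "finite I" "\<F> = U ` I"
    by (meson finite_subset_image)
  then obtain n where "I \<subseteq> {..<n}"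
    using finite_nat_iff_bounded by blast
  then have "C \<subseteq> (\<Union>i<n. U i)"
    using \<F>(3) I(2) by blast
  then have "lam C \<le> inn (\<Union>i<n. U i)"
    using C by (intro inner_content_upper)
  also have "\<dots> \<le> (\<Sum>i. inn (U i))"
    using fin[of n] by (rule order_trans) (intro sum_le_suminf, auto)
  finally show "lam C \<le> (\<Sum>i. inn (U i))" .
qed

lemma outer_UN_le:
  assumes A: "\<And>i. A i \<subseteq> M"
  shows "out (\<Union>i. A i) \<le> (\<Sum>i::nat. out (A i))"
proof (rule ennreal_le_epsilon)
  fix b and e :: real assume "0 < e" "(\<Sum>n. out (A n)) < Orderings.top"
  \<comment> \<open>Finiteness of \<open>out (A n)\<close> makes the padded value strictly larger
    than the infimum, so some open set lies below it; the paddings sum to \<open>e\<close>.\<close>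
  have *: "\<exists>U. openin mtopology U \<and> A n \<subseteq> U \<and> inn U \<le> out (A n) + e * (1/2)^Suc n" for n
  proof -
    have "0 < ennreal (e * (1/2)^Suc n)"
      using \<open>0 < e\<close> by simp
    then have "out (A n) < out (A n) + e * (1/2)^Suc n"
      using outer_finite[OF A, of n] by (simp add: ennreal_add_left_cancel_less[of _ 0, simplified])
    then show ?thesis
      unfolding outer_content_def INF_less_iff by (auto intro: less_imp_le)
  qed
  then obtain U where U: "\<And>n. openin mtopology (U n)" "\<And>n. A n \<subseteq> U n"
    "\<And>n. inn (U n) \<le> out (A n) + e * (1/2)^Suc n" by metis
  have "out (\<Union>i. A i) \<le> inn (\<Union>i. U i)"
  proof (rule outer_content_lower)
    show "openin mtopology (\<Union>i. U i)" using U(1) by blast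
    show "(\<Union>i. A i) \<subseteq> (\<Union>i. U i)" using U(2) by blast
  qed
  also have "\<dots> \<le> (\<Sum>i. inn (U i))"
    using U by (intro inner_UN_le)
  also have "\<dots> \<le> (\<Sum>n. out (A n) + e * (1/2) ^ Suc n)"
    using U by (intro suminf_le) auto
  also have "... = (\<Sum>n. out (A n)) + (\<Sum>n. ennreal e * ennreal ((1/2) ^ Suc n))"
  proof -
    have "ennreal (e * (1/2) ^ Suc n) = ennreal e * ennreal ((1/2) ^ Suc n)" for n
      using \<open>0 < e\<close> by (intro ennreal_mult) auto
    then show ?thesis
      by (simp only:) (rule suminf_add[symmetric]; rule summableI)
  qed
  also have "\<dots> = (\<Sum>n. out (A n)) + e"
    unfolding ennreal_suminf_cmult
    by (subst suminf_ennreal_eq[OF zero_le_power power_half_series]) auto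
  finally show "out (\<Union>i. A i) \<le> (\<Sum>n. out (A n)) + e" .
qed

lemma outer_measure_space: "outer_measure_space (Pow M) out"
  unfolding outer_measure_space_def countably_subadditive_def increasing_def positive_def
proof (intro conjI ballI allI impI)
  fix A :: "nat \<Rightarrow> 'a set" assume "range A \<subseteq> Pow M"
  then have "A i \<subseteq> M" for i by blast
  then show "out (\<Union>i. A i) \<le> (\<Sum>i. out (A i))" by (rule outer_UN_le)
qed (simp_all add: outer_empty outer_content_mono)

lemma outer_Un_le: "A \<subseteq> M \<Longrightarrow> B \<subseteq> M \<Longrightarrow> out (A \<union> B) \<le> out A + out B"
proof -
  assume AB: "A \<subseteq> M" "B \<subseteq> M"
  have "out (\<Union>i. binaryset A B i) \<le> (\<Sum>i. out (binaryset A B i))"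
    using AB by (intro outer_UN_le) (auto simp: binaryset_def)
  then show ?thesis
    by (simp add: UN_binaryset_eq suminf_binaryset_eq[of out, OF outer_empty])
qed

text \<open>This is Caratheodory's condition for an open test set. \<open>V - U\<close> need not be
  open, so \<open>V \<inter> U\<close> is exhausted by closed sets \<open>C\<close> and
  \<open>V - U\<close> is enlarged to the open set \<open>V - C\<close>. A closed subset of
  \<open>V - C\<close> is compact, hence at positive distance from \<open>C\<close>, where the
  content is superadditive.\<close>

lemma openin_split_le:
  assumes U: "openin mtopology U" and V: "openin mtopology V"
  shows "out (V \<inter> U) + out (V - U) \<le> inn V"
proof -
  have *: "lam C + out (V - U) \<le> inn V" if C: "closedin mtopology C" "C \<subseteq> V \<inter> U" for C
  proof -
    have o: "openin mtopology (V - C)"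
      using V C(1) by blast
    have ne: "{D. closedin mtopology D \<and> D \<subseteq> V - C} \<noteq> {}"
      using closedin_empty by blast
    have "lam C + inn (V - C) \<le> inn V"
      unfolding inner_content_def[of _ _ "V - C"] ennreal_SUP_add_right[OF ne]
    proof (rule SUP_least, safe)
        fix D assume D: "closedin mtopology D" "D \<subseteq> V - C"
        have M: "C \<subseteq> M" "D \<subseteq> M"
          using closedin_subset[OF C(1)] closedin_subset[OF D(1)] by auto
        have "compactin mtopology D"
          using D compact_space closedin_compact_space by blast
        moreover have oc: "openin mtopology (M - C)"
          using openin_diff[OF openin_topspace C(1)] by simp
        \<comment> \<open>The Lebesgue number of the one-element cover by \<open>M - C\<close> is a
          lower bound for the distance from \<open>D\<close> to \<open>C\<close>.\<close>
        ultimately obtain e where e: "e > 0" "\<forall>x\<in>D. mball x e \<subseteq> M - C"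
          using lebesgue_number[of D "{M - C}"] D M by auto
        have "e \<le> d x y" if "x \<in> C" "y \<in> D" for x y
          using that e M by (force simp: commute not_less[symmetric])
        then have "lam C + lam D \<le> lam (C \<union> D)"
          using M e(1) by (intro content_separated) auto
        also have "\<dots> \<le> inn V"
          using C D by (intro inner_content_upper) auto
        finally show "lam C + lam D \<le> inn V" .
    qed
    moreover have "out (V - U) \<le> inn (V - C)"
      using o C by (intro outer_content_lower) auto
    ultimately show ?thesis
      by (meson add_left_mono order_trans)
  qed
  have "out (V \<inter> U) = inn (V \<inter> U)"
    using U V by (intro outer_content_openin) auto
  moreover have ne: "{C. closedin mtopology C \<and> C \<subseteq> V \<inter> U} \<noteq> {}"
    using closedin_empty by blast
  ultimately have "out (V \<inter> U) + out (V - U) = (SUP C\<in>{C. closedin mtopology C \<and> C \<subseteq> V \<inter> U}. lam C + out (V - U))"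
    unfolding inner_content_def ennreal_SUP_add_left[OF ne] by simp
  also have "\<dots> \<le> inn V"
    using * by (intro SUP_least) auto
  finally show ?thesis .
qed

lemma openin_lambda_system:
  assumes U: "openin mtopology U"
  shows "U \<in> lambda_system M (Pow M) out"
proof -
  have UM: "U \<subseteq> M" using openin_subset[OF U] by simp
  have "out (U \<inter> A) + out ((M - U) \<inter> A) = out A" if A: "A \<subseteq> M" for A
  proof (rule antisym)
    have eq: "(U \<inter> A) \<union> ((M - U) \<inter> A) = A" using A by auto
    show "out A \<le> out (U \<inter> A) + out ((M - U) \<inter> A)"
      using outer_Un_le[of "U \<inter> A" "(M - U) \<inter> A"] A unfolding eq by auto
    show "out (U \<inter> A) + out ((M - U) \<inter> A) \<le> out A"
      unfolding outer_content_def[of _ _ A]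
    proof (rule INF_greatest, safe)
      fix V assume V: "openin mtopology V" "A \<subseteq> V"
      have "out (U \<inter> A) + out ((M - U) \<inter> A) \<le> out (V \<inter> U) + out (V - U)"
        using V by (intro add_mono outer_content_mono) auto
      also have "\<dots> \<le> inn V" by (rule openin_split_le[OF U V(1)])
      finally show "out (U \<inter> A) + out ((M - U) \<inter> A) \<le> inn V" .
    qed
  qed
  then show ?thesis
    using UM by (auto simp: lambda_system_def)
qed

definition content_measure :: "'a measure" where
  "content_measure = measure_of M {U. openin mtopology U} out"

lemma openin_subset_Pow: "{U. openin mtopology U} \<subseteq> Pow M"
  using openin_subset by force

lemma sets_content_measure [measurable_cong]: "sets content_measure = sets (borel_of_topology mtopology)"
  using openin_subset_Pow by (simp add: content_measure_def borel_of_topology_def sets_measure_of)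

lemma space_content_measure: "space content_measure = M"
  using openin_subset_Pow by (simp add: content_measure_def space_measure_of)

lemma emeasure_content_measure:
  assumes A: "A \<in> sets content_measure"
  shows "emeasure content_measure A = out A"
proof (rule emeasure_measure_of[OF content_measure_def])
  interpret sa: sigma_algebra M "Pow M" by (rule sigma_algebra_Pow)
  note sub = openin_subset_Pow
  have "measure_space M (lambda_system M (Pow M) out) out"
    by (rule sa.caratheodory_lemma[OF outer_measure_space])
  moreover have "sigma_sets M {U. openin mtopology U} \<subseteq> lambda_system M (Pow M) out"
    using calculation openin_lambda_system
    by (intro sigma_algebra.sigma_sets_subset) (auto simp: measure_space_def)
  ultimately have "measure_space M (sigma_sets M {U. openin mtopology U}) out"
    by (rule measure_down[OF _ sigma_algebra_sigma_sets[OF sub]])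
  then show "positive (sets content_measure) out" "countably_additive (sets content_measure) out"
    using sub by (auto simp: measure_space_def content_measure_def sets_measure_of)
  show "{U. openin mtopology U} \<subseteq> Pow M" by (rule sub)
qed (rule A)

lemma emeasure_content_measure_space: "emeasure content_measure M = lam M"
proof -
  have "M \<in> sets content_measure"
    using sets.top[of content_measure] by (simp add: space_content_measure)
  moreover have "out M = inn M"
    using openin_topspace[of mtopology] by (intro outer_content_openin) simp
  ultimately show ?thesis by (simp add: emeasure_content_measure inner_M)
qed

lemma distr_content_measure:
  assumes \<phi>: "homeomorphic_map mtopology mtopology \<phi>"
    and inv: "\<And>A. A \<subseteq> M \<Longrightarrow> lam (\<phi> ` A) = lam A"
  shows "distr content_measure content_measure \<phi> = content_measure"
proof (rule measure_eqI)
  have cont: "continuous_map mtopology mtopology \<phi>"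
    using \<phi> by (rule homeomorphic_imp_continuous_map)
  have [measurable]: "\<phi> \<in> measurable content_measure content_measure"
    unfolding content_measure_def
    using cont openin_subset[of mtopology] openin_continuous_map_preimage[OF cont]
    by (intro measurable_measure_of)
       (auto simp: space_measure_of_conv sets_measure_of_conv continuous_map_def vimage_def Int_def conj_commute)
  fix A assume "A \<in> sets (distr content_measure content_measure \<phi>)"
  then have A: "A \<in> sets content_measure" by simp
  let ?B = "\<phi> -` A \<inter> M"
  have AM: "A \<subseteq> M" using sets.sets_into_space[OF A] by (simp add: space_content_measure)
  have B: "?B \<in> sets content_measure"
    using measurable_sets[of \<phi> content_measure content_measure A] A by (simp add: space_content_measure)
  have inj: "inj_on \<phi> M" and onto: "\<phi> ` M = M"
    using \<phi> by (auto simp: homeomorphic_eq_everything_map)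
  have img: "\<phi> ` ?B = A"
  proof (intro equalityI subsetI)
    fix y assume "y \<in> A"
    then have "y \<in> \<phi> ` M" using AM unfolding onto by (rule rev_subsetD)
    then show "y \<in> \<phi> ` ?B" using \<open>y \<in> A\<close> by (elim imageE) simp
  qed (elim imageE, simp)
  obtain \<psi> where \<psi>: "homeomorphic_maps mtopology mtopology \<phi> \<psi>"
    using \<phi> homeomorphic_map_maps by blast
  have h\<psi>: "homeomorphic_map mtopology mtopology \<psi>"
    using \<psi> homeomorphic_maps_map by blast
  have \<psi>\<phi>: "\<And>x. x \<in> M \<Longrightarrow> \<psi> (\<phi> x) = x" "\<And>x. x \<in> M \<Longrightarrow> \<phi> (\<psi> x) = x"
    using \<psi> unfolding homeomorphic_maps_def by simp_all
  have \<psi>M: "\<psi> ` M = M"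
    using homeomorphic_imp_surjective_map[OF h\<psi>] by simp
  have inv\<psi>: "lam (\<psi> ` C) = lam C" if "C \<subseteq> M" for C
  proof -
    have "\<phi> ` \<psi> ` C = C"
      unfolding image_image using \<psi>\<phi>(2) that by (simp add: subset_iff cong: image_cong)
    moreover have "\<psi> ` C \<subseteq> M" using image_mono[OF that, of \<psi>] by (simp only: \<psi>M)
    ultimately show ?thesis using inv[of "\<psi> ` C"] by simp
  qed
  have "\<psi> ` \<phi> ` ?B = ?B"
  proof -
    have "(\<lambda>x. \<psi> (\<phi> x)) ` ?B = (\<lambda>x. x) ` ?B"
      by (rule image_cong) (simp_all add: \<psi>\<phi>(1))
    then show ?thesis by (simp add: image_image)
  qed
  then have "\<psi> ` A = ?B" by (simp only: img)
  \<comment> \<open>The one-sided estimate is used for \<open>\<psi>\<close> on \<open>A\<close> and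
    for \<open>\<phi>\<close> on the preimage.\<close>
  then have "out ?B \<le> out A"
    using outer_content_homeomorphic_le[OF h\<psi>, of lam A] inv\<psi> AM by simp
  moreover have "out A \<le> out ?B"
    using outer_content_homeomorphic_le[OF \<phi>, of lam ?B] inv img by simp
  ultimately have "out ?B = out A" by simp
  then show "emeasure (distr content_measure content_measure \<phi>) A = emeasure content_measure A"
    using A B by (simp add: emeasure_distr emeasure_content_measure space_content_measure)
qed simp

end

section \<open>Invariant measures from covering numbers\<close>

lemma bounded_cluster_function:
  fixes v :: "nat \<Rightarrow> 'i \<Rightarrow> real"
  assumes v: "\<And>n i. v n i \<in> {0..1}"
  obtains F :: "('i \<Rightarrow> real) filter" and l where "F \<noteq> bot" "\<And>i. ((\<lambda>u. u i) \<longlongrightarrow> l i) F"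
    "\<And>P. (\<forall>\<^sub>F n in sequentially. P (v n)) \<Longrightarrow> \<forall>\<^sub>F u in F. P u"
proof -
  \<comment> \<open>By Tychonoff's theorem the sequence has a cluster point in the cube. The index
    type will be all subsets of a space, so the cube need not be sequentially compact; a filter
    takes the place of a convergent subsequence.\<close>
  have "compactin (product_topology (\<lambda>_::'i. euclideanreal) UNIV) (PiE UNIV (\<lambda>_. {0..1::real}))"
    by (simp add: compactin_PiE)
  then have "compact (PiE UNIV (\<lambda>_::'i. {0..1::real}))"
    unfolding euclidean_product_topology by simp
  moreover have "filtermap v sequentially \<noteq> bot"
    by (simp add: filtermap_bot_iff)
  moreover have "\<forall>\<^sub>F u in filtermap v sequentially. u \<in> PiE UNIV (\<lambda>_::'i. {0..1::real})"
    using v by (simp add: eventually_filtermap PiE_UNIV_domain)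
  ultimately obtain l where l: "inf (nhds l) (filtermap v sequentially) \<noteq> bot"
    unfolding compact_filter by blast
  let ?F = "inf (nhds l) (filtermap v sequentially)"
  have "((\<lambda>u. u i) \<longlongrightarrow> l i) ?F" for i
  proof -
    have "((\<lambda>u. u i) \<longlongrightarrow> l i) (nhds l)"
    proof (rule topological_tendstoI)
      fix S :: "real set" assume S: "open S" "l i \<in> S"
      have "open ((\<lambda>u::'i \<Rightarrow> real. u i) -` S)"
        by (rule open_vimage[OF S(1) continuous_on_product_coordinates])
      then show "\<forall>\<^sub>F u in nhds l. u i \<in> S"
        using S(2) by (intro eventually_nhds[THEN iffD2] exI[of _ "(\<lambda>u. u i) -` S"]) auto
    qed
    then show ?thesis by (rule tendsto_mono[rotated]) simp
  qed
  moreover have "\<forall>\<^sub>F u in ?F. P u" if "\<forall>\<^sub>F n in sequentially. P (v n)" for P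
    using that by (intro filter_leD[of ?F "filtermap v sequentially"]) (auto simp: eventually_filtermap)
  ultimately show ?thesis using l that by blast
qed

text \<open>Equicontinuity provides finite covers by sets small under all maps at once; closure
  under composition makes the image of such a set small again; the identity makes small sets small
  in the metric.\<close>

locale equicontinuous_monoid = Metric_space M d for M :: "'a set" and d +
  fixes \<Gamma> :: "('a \<Rightarrow> 'a) set"
  assumes compact: "compact_space mtopology"
    and nonempty: "M \<noteq> {}"
    and maps: "\<gamma> \<in> \<Gamma> \<Longrightarrow> x \<in> M \<Longrightarrow> \<gamma> x \<in> M"
    and id: "\<exists>\<gamma>\<in>\<Gamma>. \<forall>x\<in>M. \<gamma> x = x"
    and comp: "\<gamma> \<in> \<Gamma> \<Longrightarrow> \<delta> \<in> \<Gamma> \<Longrightarrow> \<exists>\<epsilon>\<in>\<Gamma>. \<forall>x\<in>M. \<gamma> (\<delta> x) = \<epsilon> x"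
    and equi: "0 < e \<Longrightarrow> \<exists>r>0. \<forall>\<gamma>\<in>\<Gamma>. \<forall>x\<in>M. \<forall>y\<in>M. d x y < r \<longrightarrow> d (\<gamma> x) (\<gamma> y) < e"
begin

text \<open>Testing the diameter after every map of the monoid, and not only of the set itself,
  makes covering numbers monotone under the maps without any invariance of the metric.\<close>

definition small :: "real \<Rightarrow> 'a set \<Rightarrow> bool" where
  "small e S \<longleftrightarrow> S \<subseteq> M \<and> (\<forall>\<gamma>\<in>\<Gamma>. \<forall>x\<in>S. \<forall>y\<in>S. d (\<gamma> x) (\<gamma> y) < e)"

definition small_cover :: "real \<Rightarrow> 'a set \<Rightarrow> 'a set set \<Rightarrow> bool" where
  "small_cover e A \<C> \<longleftrightarrow> finite \<C> \<and> (\<forall>S\<in>\<C>. small e S) \<and> A \<subseteq> \<Union>\<C>"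

definition cover_number :: "real \<Rightarrow> 'a set \<Rightarrow> nat" where
  "cover_number e A = (LEAST n. \<exists>\<C>. small_cover e A \<C> \<and> card \<C> = n)"

lemma small_cover_exists:
  assumes e: "0 < e" shows "\<exists>\<C>. small_cover e M \<C>"
proof -
  obtain r where r: "r > 0" "\<And>\<gamma> x y. \<gamma> \<in> \<Gamma> \<Longrightarrow> x \<in> M \<Longrightarrow> y \<in> M \<Longrightarrow> d x y < r \<Longrightarrow> d (\<gamma> x) (\<gamma> y) < e"
    using equi[OF e] by blast
  have "mtotally_bounded M"
    using compact compactin_imp_mtotally_bounded by (simp add: compact_space_def)
  then obtain K where K: "finite K" "K \<subseteq> M" "M \<subseteq> (\<Union>x\<in>K. mball x (r/2))"
    unfolding mtotally_bounded_def using r(1) by (meson half_gt_zero)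
  have "d y z < r" if "y \<in> mball x (r/2)" "z \<in> mball x (r/2)" for x y z
  proof -
    have "d y z \<le> d y x + d x z"
      by (rule triangle) (use that in auto)
    moreover have "d y x < r/2" "d x z < r/2"
      using that by (auto simp: commute[of y x])
    ultimately show ?thesis by simp
  qed
  then have "small e (mball x (r/2))" for x
    using r(2) by (auto simp: small_def)
  then show ?thesis
    using K by (intro exI[of _ "(\<lambda>x. mball x (r/2)) ` K"]) (auto simp: small_cover_def)
qed

lemma cover_number_le: "small_cover e A \<C> \<Longrightarrow> cover_number e A \<le> card \<C>"
  unfolding cover_number_def by (rule Least_le) blast

lemma cover_number_attained:
  assumes "0 < e" "A \<subseteq> M"
  obtains \<C> where "small_cover e A \<C>" "card \<C> = cover_number e A"
proof -
  obtain \<D> where "small_cover e M \<D>" using small_cover_exists assms(1) by blast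
  then have "small_cover e A \<D>" using assms(2) by (auto simp: small_cover_def)
  then have "\<exists>n \<C>. small_cover e A \<C> \<and> card \<C> = n" by blast
  then have "\<exists>\<C>. small_cover e A \<C> \<and> card \<C> = cover_number e A"
    unfolding cover_number_def by (rule LeastI_ex)
  then show ?thesis using that by blast
qed

lemma cover_number_empty: "cover_number e {} = 0"
  using cover_number_le[of e "{}" "{}"] by (simp add: small_cover_def)

lemma cover_number_mono:
  assumes "0 < e" "A \<subseteq> B" "B \<subseteq> M" shows "cover_number e A \<le> cover_number e B"
proof -
  obtain \<C> where C: "small_cover e B \<C>" "card \<C> = cover_number e B"
    using cover_number_attained assms by blast
  then have "small_cover e A \<C>" using assms(2) by (auto simp: small_cover_def)
  then show ?thesis using C(2) cover_number_le by fastforce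
qed

lemma cover_number_pos:
  assumes "0 < e" shows "0 < cover_number e M"
proof (rule ccontr)
  assume "\<not> 0 < cover_number e M"
  then obtain \<C> where C: "small_cover e M \<C>" "card \<C> = 0"
    using cover_number_attained[OF assms order_refl] by (metis gr0I)
  then have "\<C> = {}" by (simp add: small_cover_def)
  then show False using C(1) nonempty by (simp add: small_cover_def)
qed

lemma cover_number_Un_le:
  assumes "0 < e" "A \<subseteq> M" "B \<subseteq> M"
  shows "cover_number e (A \<union> B) \<le> cover_number e A + cover_number e B"
proof -
  obtain \<C> where C: "small_cover e A \<C>" "card \<C> = cover_number e A"
    using cover_number_attained assms by blast
  obtain \<D> where D: "small_cover e B \<D>" "card \<D> = cover_number e B"
    using cover_number_attained assms by blast
  have "small_cover e (A \<union> B) (\<C> \<union> \<D>)"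
    using C(1) D(1) by (auto simp: small_cover_def)
  then have "cover_number e (A \<union> B) \<le> card (\<C> \<union> \<D>)" by (rule cover_number_le)
  also have "\<dots> \<le> card \<C> + card \<D>" by (rule card_Un_le)
  finally show ?thesis using C(2) D(2) by simp
qed

text \<open>As the identity is in the monoid, a small set has all mutual distances below
  \<open>e\<close> and cannot meet both \<open>A\<close> and \<open>B\<close>. An optimal cover of
  the union therefore contains disjoint covers of the two sets.\<close>

lemma cover_number_separated:
  assumes e: "0 < e" and AB: "A \<subseteq> M" "B \<subseteq> M" and sep: "\<And>x y. x \<in> A \<Longrightarrow> y \<in> B \<Longrightarrow> e \<le> d x y"
  shows "cover_number e A + cover_number e B \<le> cover_number e (A \<union> B)"
proof -
  obtain \<C> where C: "small_cover e (A \<union> B) \<C>" "card \<C> = cover_number e (A \<union> B)"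
    using cover_number_attained[OF e, of "A \<union> B"] AB by blast
  obtain \<iota> where \<iota>: "\<iota> \<in> \<Gamma>" "\<And>x. x \<in> M \<Longrightarrow> \<iota> x = x" using id by blast
  let ?C = "\<lambda>A. {S\<in>\<C>. S \<inter> A \<noteq> {}}"
  have fin: "finite \<C>" using C(1) by (simp add: small_cover_def)
  have "\<not> (S \<inter> A \<noteq> {} \<and> S \<inter> B \<noteq> {})" if S: "S \<in> \<C>" for S
  proof
    assume "S \<inter> A \<noteq> {} \<and> S \<inter> B \<noteq> {}"
    then obtain x y where xy: "x \<in> S" "x \<in> A" "y \<in> S" "y \<in> B" by blast
    have "small e S" using C(1) S by (simp add: small_cover_def)
    then have "d (\<iota> x) (\<iota> y) < e" using \<iota>(1) xy by (simp add: small_def)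
    moreover have "\<iota> x = x" "\<iota> y = y" using xy AB \<iota>(2) by auto
    ultimately show False using sep[OF xy(2,4)] by simp
  qed
  then have disj: "?C A \<inter> ?C B = {}" by blast
  have "D \<subseteq> \<Union>(?C D)" if "D \<subseteq> \<Union>\<C>" for D
    using that by blast
  then have "small_cover e A (?C A)" "small_cover e B (?C B)"
    using C(1) unfolding small_cover_def by simp_all
  then have "cover_number e A + cover_number e B \<le> card (?C A) + card (?C B)"
    by (intro add_mono cover_number_le)
  also have "\<dots> = card (?C A \<union> ?C B)"
    using disj fin by (intro card_Un_disjoint[symmetric]) auto
  also have "\<dots> \<le> card \<C>"
    using fin by (intro card_mono) auto
  finally show ?thesis using C(2) by simp
qed

text \<open>A map applied after \<open>\<gamma>\<close> is again a map of the monoid on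
  \<open>M\<close>, so \<open>\<gamma>\<close> carries small sets to small sets and covers to
  covers.\<close>

lemma cover_number_image_le:
  assumes e: "0 < e" and A: "A \<subseteq> M" and \<gamma>: "\<gamma> \<in> \<Gamma>"
  shows "cover_number e (\<gamma> ` A) \<le> cover_number e A"
proof -
  obtain \<C> where C: "small_cover e A \<C>" "card \<C> = cover_number e A"
    using cover_number_attained assms by blast
  have "small e (\<gamma> ` S)" if "small e S" for S
    unfolding small_def
  proof (intro conjI ballI)
    have S: "S \<subseteq> M" using that by (simp add: small_def)
    show "\<gamma> ` S \<subseteq> M" using S maps[OF \<gamma>] by auto
    fix \<delta> x y assume \<delta>: "\<delta> \<in> \<Gamma>" and "x \<in> \<gamma> ` S" "y \<in> \<gamma> ` S"
    then obtain x' y' where xy: "x' \<in> S" "x = \<gamma> x'" "y' \<in> S" "y = \<gamma> y'" by blast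
    obtain \<epsilon> where "\<epsilon> \<in> \<Gamma>" "\<And>x. x \<in> M \<Longrightarrow> \<delta> (\<gamma> x) = \<epsilon> x" using comp[OF \<delta> \<gamma>] by blast
    moreover have "x' \<in> M" "y' \<in> M" using S xy by auto
    ultimately show "d (\<delta> x) (\<delta> y) < e"
      using that xy by (simp add: small_def)
  qed
  then have "small_cover e (\<gamma> ` A) ((`) \<gamma> ` \<C>)"
    using C(1) unfolding small_cover_def by blast
  then have "cover_number e (\<gamma> ` A) \<le> card ((`) \<gamma> ` \<C>)" by (rule cover_number_le)
  also have "\<dots> \<le> card \<C>" using C(1) by (intro card_image_le) (simp add: small_cover_def)
  finally show ?thesis using C(2) by simp
qed

text \<open>Covering numbers are normalised by that of the whole space, and a cluster point of the
  ratios as the scale shrinks is a content. Invariance is claimed for maps whose inverse also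
  belongs to the monoid: each of the two gives one inequality.\<close>

theorem invariant_measure_exists:
  obtains \<mu> where "sets \<mu> = sets (borel_of_topology mtopology)" "space \<mu> = M" "prob_space \<mu>"
    "\<And>\<gamma> \<delta>. \<gamma> \<in> \<Gamma> \<Longrightarrow> \<delta> \<in> \<Gamma> \<Longrightarrow> homeomorphic_maps mtopology mtopology \<gamma> \<delta> \<Longrightarrow> distr \<mu> \<mu> \<gamma> = \<mu>"
proof -
  \<comment> \<open>The scale is positive for every \<open>n\<close> and tends to zero. Intersection
    with \<open>M\<close> makes the number meaningful for every set of the type, as the cluster
    function needs.\<close>
  define c where "c n A = cover_number (1 / real (Suc n)) (A \<inter> M)" for n A
  define v where "v n A = real (c n A) / real (c n M)" for n A
  have pos: "0 < c n M" for n using cover_number_pos[of "1 / real (Suc n)"] by (simp add: c_def)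
  have mono: "c n A \<le> c n B" if "A \<subseteq> B" for n A B
    unfolding c_def using that by (intro cover_number_mono) auto
  have "v n A \<in> {0..1}" for n A
    using mono[of "A \<inter> M" M n] pos[of n] by (auto simp: v_def c_def)
  then obtain F and l :: "'a set \<Rightarrow> real" where F: "F \<noteq> bot" and l: "\<And>A. ((\<lambda>u. u A) \<longlongrightarrow> l A) F"
    and ev: "\<And>P. (\<forall>\<^sub>F n in sequentially. P (v n)) \<Longrightarrow> \<forall>\<^sub>F u in F. P u"
    using bounded_cluster_function[of v] by metis
  have eq: "l A = a" if "\<And>n. v n A = a" for A a
  proof (rule tendsto_unique[OF F l])
    have "\<forall>\<^sub>F u in F. u A = a" using that by (intro ev) simp
    then show "((\<lambda>u. u A) \<longlongrightarrow> a) F" by (rule tendsto_eventually)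
  qed
  have le: "l A \<le> l B" if "\<And>n. v n A \<le> v n B" for A B
    by (rule tendsto_le[OF F l l]) (intro ev, simp add: that)
  have l0: "0 \<le> l A" for A
    by (rule tendsto_lowerbound[OF l _ F]) (intro ev, simp add: v_def)
  have l_empty: "l {} = 0" by (rule eq) (simp add: v_def c_def cover_number_empty)
  have l_M: "l M = 1"
    using pos by (intro eq) (simp add: v_def)
  interpret metric_content M d "\<lambda>A. ennreal (l A)"
  proof
    fix A B :: "'a set"
    show "ennreal (l A) \<le> ennreal (l B)" if "A \<subseteq> B" "B \<subseteq> M"
      using mono[OF that(1)] by (intro ennreal_leI le) (simp add: v_def divide_right_mono)
    assume AB: "A \<subseteq> M" "B \<subseteq> M"
    then have int: "A \<inter> M = A" "B \<inter> M = B" "(A \<union> B) \<inter> M = A \<union> B" by auto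
    have "l (A \<union> B) \<le> l A + l B"
    proof (rule tendsto_le[OF F tendsto_add[OF l l] l], rule ev, intro always_eventually allI)
      fix n
      have "c n (A \<union> B) \<le> c n A + c n B"
        unfolding c_def int using AB by (intro cover_number_Un_le) auto
      then have "real (c n (A \<union> B)) \<le> real (c n A) + real (c n B)" by linarith
      then show "v n (A \<union> B) \<le> v n A + v n B"
        by (simp add: v_def divide_right_mono flip: add_divide_distrib)
    qed
    then show "ennreal (l (A \<union> B)) \<le> ennreal (l A) + ennreal (l B)"
      using l0 by (simp flip: ennreal_plus)
    fix e :: real assume e: "0 < e" and sep: "\<And>x y. x \<in> A \<Longrightarrow> y \<in> B \<Longrightarrow> e \<le> d x y"
    \<comment> \<open>Superadditivity holds only at scales below the distance \<open>e\<close>,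
      hence eventually, and the filter preserves eventual properties of the sequence.\<close>
    have "l A + l B \<le> l (A \<union> B)"
    proof (rule tendsto_le[OF F l tendsto_add[OF l l]], rule ev)
      have "\<forall>\<^sub>F n in sequentially. 1 / real (Suc n) < e"
        using order_tendstoD(2)[OF LIMSEQ_inverse_real_of_nat e] by (simp add: inverse_eq_divide)
      then show "\<forall>\<^sub>F n in sequentially. v n A + v n B \<le> v n (A \<union> B)"
      proof eventually_elim
        case (elim n)
        have "c n A + c n B \<le> c n (A \<union> B)"
          unfolding c_def int
        proof (rule cover_number_separated)
          show "1 / real (Suc n) \<le> d x y" if "x \<in> A" "y \<in> B" for x y
            using sep[OF that] elim by simp
        qed (use AB in simp_all)
        then have "real (c n A) + real (c n B) \<le> real (c n (A \<union> B))" by linarith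
        then show ?case
          by (simp add: v_def divide_right_mono flip: add_divide_distrib)
      qed
    qed
    then show "ennreal (l A) + ennreal (l B) \<le> ennreal (l (A \<union> B))"
      using l0 by (simp add: ennreal_leI flip: ennreal_plus)
  qed (simp_all add: compact l_empty)
  have inv_le: "l (\<gamma> ` A) \<le> l A" if "\<gamma> \<in> \<Gamma>" "A \<subseteq> M" for \<gamma> A
  proof (rule le)
    fix n
    have "\<gamma> ` A \<inter> M = \<gamma> ` A" "A \<inter> M = A" using that maps by auto
    then have "c n (\<gamma> ` A) \<le> c n A"
      unfolding c_def using that cover_number_image_le[of "1 / real (Suc n)" A \<gamma>] by simp
    then show "v n (\<gamma> ` A) \<le> v n A" by (simp add: v_def divide_right_mono)
  qed
  have "distr content_measure content_measure \<gamma> = content_measure"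
    if \<gamma>: "\<gamma> \<in> \<Gamma>" and \<delta>: "\<delta> \<in> \<Gamma>" and h: "homeomorphic_maps mtopology mtopology \<gamma> \<delta>" for \<gamma> \<delta>
  proof (rule distr_content_measure)
    show "homeomorphic_map mtopology mtopology \<gamma>" using h homeomorphic_maps_map by blast
    fix A assume A: "A \<subseteq> M"
    have "(\<lambda>x. \<delta> (\<gamma> x)) ` A = (\<lambda>x. x) ` A"
      using h A by (intro image_cong) (auto simp: homeomorphic_maps_def)
    then have "\<delta> ` \<gamma> ` A = A" by (simp add: image_image)
    moreover have "\<gamma> ` A \<subseteq> M" using maps[OF \<gamma>] A by auto
    ultimately have "l (\<gamma> ` A) = l A"
      using inv_le[OF \<gamma> A] inv_le[OF \<delta>, of "\<gamma> ` A"] by simp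
    then show "ennreal (l (\<gamma> ` A)) = ennreal (l A)" by simp
  qed
  moreover have "prob_space content_measure"
    by (rule prob_spaceI) (simp add: space_content_measure emeasure_content_measure_space l_M)
  ultimately show ?thesis
    using that[of content_measure] sets_content_measure space_content_measure by blast
qed

end
section \<open>Haar measure on compact metrizable groups\<close>

text \<open>A continuous map on the compact product is uniformly continuous; comparing points that
  differ only in the last coordinate gives a modulus common to all parameters, i.e.
  equicontinuity.\<close>

lemma (in Metric_space) uniformly_continuous_ternary:
  assumes compact: "compact_space mtopology"
    and cont: "continuous_map (prod_topology (prod_topology mtopology mtopology) mtopology) mtopology
      (\<lambda>((g, h), x). \<phi> g h x)"
    and e: "0 < e"
  shows "\<exists>r>0. \<forall>g\<in>M. \<forall>h\<in>M. \<forall>x\<in>M. \<forall>y\<in>M. d x y < r \<longrightarrow> d (\<phi> g h x) (\<phi> g h y) < e"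
proof -
  let ?m = "metric (M, d)"
  let ?P = "prod_metric (prod_metric ?m ?m) ?m"
  have m: "mtopology_of ?m = mtopology" "mspace ?m = M" "mdist ?m = d"
    by simp_all
  have "uniformly_continuous_map ?P ?m (\<lambda>((g, h), x). \<phi> g h x)"
    using cont compact by (intro continuous_imp_uniformly_continuous_map)
      (simp add: m compact_space_prod_topology)
  then obtain r where r: "r > 0" "\<And>p q. p \<in> mspace ?P \<Longrightarrow> q \<in> mspace ?P \<Longrightarrow> mdist ?P q p < r \<Longrightarrow>
      mdist ?m ((\<lambda>((g, h), x). \<phi> g h x) q) ((\<lambda>((g, h), x). \<phi> g h x) p) < e"
    unfolding uniformly_continuous_map_def using e by meson
  have "d (\<phi> g h x) (\<phi> g h y) < e" if "g \<in> M" "h \<in> M" "x \<in> M" "y \<in> M" "d x y < r" for g h x y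
    using r(2)[of "((g, h), y)" "((g, h), x)"] that by (simp add: prod_dist_def)
  then show ?thesis using r(1) by blast
qed

text \<open>The maps sending \<open>x\<close> to \<open>g \<otimes> x \<otimes> h\<close> or to
  \<open>g \<otimes> inv x \<otimes> h\<close> form a monoid that contains the inverse of each
  member used below. One measure is thereby invariant under both translations and inversion.\<close>

lemma (in group) haar_measure_exists:
  fixes K :: "'a topology"
  assumes sub: "subgroup (topspace K) G"
    and cmult: "continuous_map (prod_topology K K) K (\<lambda>(g, h). g \<otimes> h)"
    and cinv: "continuous_map K K (\<lambda>g. inv g)"
    and compact: "compact_space K" and metrizable: "metrizable_space K"
  obtains \<mu> where "sets \<mu> = sets (borel_of_topology K)" "space \<mu> = topspace K" "prob_space \<mu>"
    "\<And>g. g \<in> topspace K \<Longrightarrow> distr \<mu> \<mu> (\<lambda>x. g \<otimes> x) = \<mu>"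
    "\<And>g. g \<in> topspace K \<Longrightarrow> distr \<mu> \<mu> (\<lambda>x. x \<otimes> g) = \<mu>"
    "distr \<mu> \<mu> (\<lambda>x. inv x) = \<mu>"
proof -
  obtain M d where "Metric_space M d" and K: "K = Metric_space.mtopology M d"
    using metrizable unfolding metrizable_space_def by blast
  then interpret Metric_space M d by simp
  have M: "topspace K = M" by (simp add: K)
  have MG: "x \<in> M \<Longrightarrow> x \<in> carrier G" for x
    using subgroup.subset[OF sub] by (auto simp: M)
  have cl: "x \<in> M \<Longrightarrow> y \<in> M \<Longrightarrow> x \<otimes> y \<in> M" "x \<in> M \<Longrightarrow> inv x \<in> M" and one: "\<one> \<in> M" for x y
    using subgroup.m_closed[OF sub] subgroup.m_inv_closed[OF sub] subgroup.one_closed[OF sub]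
    by (auto simp: M)
  have cm: "continuous_map X K (\<lambda>x. p x \<otimes> q x)" if "continuous_map X K p" "continuous_map X K q"
    for X :: "'x topology" and p q
    using continuous_map_compose[OF continuous_map_pairedI[OF that] cmult] by (simp add: o_def)
  have ci: "continuous_map X K (\<lambda>x. inv (p x))" if "continuous_map X K p" for X :: "'x topology" and p
    using continuous_map_compose[OF that cinv] by (simp add: o_def)
  define A where "A g h = (\<lambda>x. g \<otimes> x \<otimes> h)" for g h
  define B where "B g h = (\<lambda>x. g \<otimes> inv x \<otimes> h)" for g h
  define \<Gamma> where "\<Gamma> = {A g h | g h. g \<in> M \<and> h \<in> M} \<union> {B g h | g h. g \<in> M \<and> h \<in> M}"
  have \<Gamma>I: "A g h \<in> \<Gamma>" "B g h \<in> \<Gamma>" if "g \<in> M" "h \<in> M" for g h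
    using that by (auto simp: \<Gamma>_def)
  have \<Gamma>E: "\<exists>g h. g \<in> M \<and> h \<in> M \<and> (\<gamma> = A g h \<or> \<gamma> = B g h)" if "\<gamma> \<in> \<Gamma>" for \<gamma>
    using that by (auto simp: \<Gamma>_def)
  interpret equicontinuous_monoid M d \<Gamma>
  proof
    show "compact_space mtopology" using compact by (simp add: K)
    show "M \<noteq> {}" using one by blast
    show "\<gamma> x \<in> M" if "\<gamma> \<in> \<Gamma>" "x \<in> M" for \<gamma> x
      using \<Gamma>E[OF that(1)] that(2) cl by (auto simp: A_def B_def)
    show "\<exists>\<gamma>\<in>\<Gamma>. \<forall>x\<in>M. \<gamma> x = x"
      using one MG by (intro bexI[of _ "A \<one> \<one>"] \<Gamma>I) (auto simp: A_def)
    show "\<exists>\<epsilon>\<in>\<Gamma>. \<forall>x\<in>M. \<gamma> (\<delta> x) = \<epsilon> x" if \<gamma>: "\<gamma> \<in> \<Gamma>" and \<delta>: "\<delta> \<in> \<Gamma>" for \<gamma> \<delta>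
    proof -
      obtain g h g' h' where gh: "g \<in> M" "h \<in> M" "\<gamma> = A g h \<or> \<gamma> = B g h"
        and gh': "g' \<in> M" "h' \<in> M" "\<delta> = A g' h' \<or> \<delta> = B g' h'"
        using \<Gamma>E[OF \<gamma>] \<Gamma>E[OF \<delta>] by metis
      \<comment> \<open>Inversion reverses products, so after a map \<open>B\<close> the inner
        parameters change sides: \<open>h'\<close> joins \<open>g\<close> and \<open>g'\<close>
        joins \<open>h\<close>, both inverted.\<close>
      have "A g h (A g' h' x) = A (g \<otimes> g') (h' \<otimes> h) x" "A g h (B g' h' x) = B (g \<otimes> g') (h' \<otimes> h) x"
        "B g h (A g' h' x) = B (g \<otimes> inv h') (inv g' \<otimes> h) x"
        "B g h (B g' h' x) = A (g \<otimes> inv h') (inv g' \<otimes> h) x" if "x \<in> M" for x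
        using MG[OF gh(1)] MG[OF gh(2)] MG[OF gh'(1)] MG[OF gh'(2)] MG[OF that]
        by (simp_all add: A_def B_def m_assoc inv_mult_group)
      moreover have "A (g \<otimes> g') (h' \<otimes> h) \<in> \<Gamma>" "B (g \<otimes> g') (h' \<otimes> h) \<in> \<Gamma>"
        "B (g \<otimes> inv h') (inv g' \<otimes> h) \<in> \<Gamma>" "A (g \<otimes> inv h') (inv g' \<otimes> h) \<in> \<Gamma>"
        using gh gh' cl by (auto intro!: \<Gamma>I)
      ultimately show ?thesis using gh(3) gh'(3) by metis
    qed
    have proj: "continuous_map (prod_topology (prod_topology K K) K) K (\<lambda>p. fst (fst p))"
      "continuous_map (prod_topology (prod_topology K K) K) K (\<lambda>p. snd (fst p))"
      "continuous_map (prod_topology (prod_topology K K) K) K snd"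
      using continuous_map_compose[OF continuous_map_fst continuous_map_fst, of K K K]
        continuous_map_compose[OF continuous_map_fst continuous_map_snd, of K K K]
      by (simp_all add: o_def continuous_map_snd)
    fix e :: real assume e: "0 < e"
    have "continuous_map (prod_topology (prod_topology K K) K) K (\<lambda>((g, h), x). A g h x)"
      unfolding A_def split_beta
      by (intro cm proj)
    then obtain r where r: "r > 0" "\<And>g h x y. g \<in> M \<Longrightarrow> h \<in> M \<Longrightarrow> x \<in> M \<Longrightarrow> y \<in> M \<Longrightarrow> d x y < r \<Longrightarrow>
        d (A g h x) (A g h y) < e"
      using uniformly_continuous_ternary[of A e] compact e unfolding K by metis
    have "continuous_map (prod_topology (prod_topology K K) K) K (\<lambda>((g, h), x). B g h x)"
      unfolding B_def split_beta
      by (intro cm ci proj)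
    then obtain s where s: "s > 0" "\<And>g h x y. g \<in> M \<Longrightarrow> h \<in> M \<Longrightarrow> x \<in> M \<Longrightarrow> y \<in> M \<Longrightarrow> d x y < s \<Longrightarrow>
        d (B g h x) (B g h y) < e"
      using uniformly_continuous_ternary[of B e] compact e unfolding K by metis
    show "\<exists>r>0. \<forall>\<gamma>\<in>\<Gamma>. \<forall>x\<in>M. \<forall>y\<in>M. d x y < r \<longrightarrow> d (\<gamma> x) (\<gamma> y) < e"
    proof (intro exI[of _ "min r s"] conjI ballI impI)
      fix \<gamma> x y assume "\<gamma> \<in> \<Gamma>" and xy: "x \<in> M" "y \<in> M" "d x y < min r s"
      then obtain g h where "g \<in> M" "h \<in> M" "\<gamma> = A g h \<or> \<gamma> = B g h" using \<Gamma>E by blast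
      then show "d (\<gamma> x) (\<gamma> y) < e" using r(2)[of g h x y] s(2)[of g h x y] xy by auto
    qed (use r s in simp)
  qed
  have cA: "continuous_map K K (A g h)" and cB: "continuous_map K K (B g h)" if "g \<in> M" "h \<in> M" for g h
    unfolding A_def B_def using that by (intro cm ci continuous_map_const[THEN iffD2]; simp add: M)+
  obtain \<mu> where \<mu>: "sets \<mu> = sets (borel_of_topology mtopology)" "space \<mu> = M" "prob_space \<mu>"
    and inv: "\<And>\<gamma> \<delta>. \<gamma> \<in> \<Gamma> \<Longrightarrow> \<delta> \<in> \<Gamma> \<Longrightarrow> homeomorphic_maps mtopology mtopology \<gamma> \<delta> \<Longrightarrow> distr \<mu> \<mu> \<gamma> = \<mu>"
    using invariant_measure_exists by metis
  have A: "distr \<mu> \<mu> (A g h) = \<mu>" if "g \<in> M" "h \<in> M" for g h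
  proof (rule inv[OF \<Gamma>I(1) \<Gamma>I(1)])
    show "homeomorphic_maps mtopology mtopology (A g h) (A (inv g) (inv h))"
      unfolding homeomorphic_maps_def using cA that cl
      by (auto simp: K[symmetric] M A_def MG m_assoc[symmetric]) (simp_all add: m_assoc MG)
  qed (use that cl in auto)
  have B: "distr \<mu> \<mu> (B \<one> \<one>) = \<mu>"
  proof (rule inv[OF \<Gamma>I(2) \<Gamma>I(2)])
    show "homeomorphic_maps mtopology mtopology (B \<one> \<one>) (B \<one> \<one>)"
      unfolding homeomorphic_maps_def using cB one cl
      by (auto simp: K[symmetric] M B_def MG)
  qed (use one in auto)
  have "distr \<mu> \<mu> (\<lambda>x. g \<otimes> x) = distr \<mu> \<mu> (A g \<one>)" "distr \<mu> \<mu> (\<lambda>x. x \<otimes> g) = distr \<mu> \<mu> (A \<one> g)"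
    if "g \<in> M" for g
    using that MG by (intro distr_cong; simp add: \<mu>(2) A_def)+
  moreover have "distr \<mu> \<mu> (\<lambda>x. inv x) = distr \<mu> \<mu> (B \<one> \<one>)"
    using MG by (intro distr_cong) (simp_all add: \<mu>(2) B_def)
  ultimately show ?thesis
    using that[of \<mu>] \<mu> A B one by (simp add: K M)
qed
section \<open>Reverse martingales\<close>

text \<open>The last assumption says in integrated form that \<open>Y n\<close> is the conditional
  expectation of \<open>Y m\<close> given the smaller algebra \<open>F n\<close>. The bound is 1
  because \<open>Y\<close> will be a sequence of conditional probabilities.\<close>

locale bounded_reverse_martingale = prob_space M for M :: "'a measure" +
  fixes F :: "nat \<Rightarrow> 'a measure" and Y :: "nat \<Rightarrow> 'a \<Rightarrow> real"
  assumes subalgebra: "subalgebra M (F n)"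
    and decreasing: "m \<le> n \<Longrightarrow> sets (F n) \<subseteq> sets (F m)"
    and adapted: "Y n \<in> borel_measurable (F n)"
    and bounded: "x \<in> space M \<Longrightarrow> \<bar>Y n x\<bar> \<le> 1"
    and set_integral_eq: "m \<le> n \<Longrightarrow> B \<in> sets (F n) \<Longrightarrow>
      (\<integral>x. indicator B x * Y m x \<partial>M) = (\<integral>x. indicator B x * Y n x \<partial>M)"
begin

lemma measurable_Y [measurable]: "Y n \<in> borel_measurable M"
  using measurable_from_subalg[OF subalgebra adapted] .

lemma integrable_bounded:
  assumes "f \<in> borel_measurable M" "\<And>x. x \<in> space M \<Longrightarrow> \<bar>f x\<bar> \<le> (c::real)"
  shows "integrable M f"
  using assms by (intro integrable_const_bound[of f c] AE_I2) auto

lemma measurable_F_le: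
  assumes "m \<le> n" "f \<in> borel_measurable (F n)" shows "f \<in> borel_measurable (F m)"
  using assms decreasing[OF assms(1)] subalgebra[of m] subalgebra[of n]
  by (intro measurable_from_subalg[of "F m" "F n"]) (auto simp: subalgebra_def)

text \<open>The set integrals identify \<open>Y n\<close> as a version of the conditional
  expectation of \<open>Y m\<close> given \<open>F n\<close>, and a bounded
  \<open>F n\<close>-measurable factor passes through conditional expectation.\<close>

lemma integral_mult_eq:
  assumes mn: "m \<le> n" and Z: "Z \<in> borel_measurable (F n)" "\<And>x. x \<in> space M \<Longrightarrow> \<bar>Z x\<bar> \<le> c"
  shows "(\<integral>x. Z x * Y m x \<partial>M) = (\<integral>x. Z x * Y n x \<partial>M)"
proof -
  interpret finite_measure_subalgebra M "F n"
    by standard (rule subalgebra)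
  have [measurable]: "Z \<in> borel_measurable M"
    using measurable_from_subalg[OF subalgebra Z(1)] .
  have intY: "integrable M (Y k)" for k
    using bounded by (intro integrable_bounded[of _ 1]) auto
  have "AE x in M. real_cond_exp M (F n) (Y m) x = Y n x"
  proof (rule real_cond_exp_charact)
    fix A assume "A \<in> sets (F n)"
    then show "(\<integral>x\<in>A. Y m x \<partial>M) = (\<integral>x\<in>A. Y n x \<partial>M)"
      using set_integral_eq[OF mn] by (simp add: set_lebesgue_integral_def)
  qed (auto intro: intY adapted)
  then have "(\<integral>x. Z x * real_cond_exp M (F n) (Y m) x \<partial>M) = (\<integral>x. Z x * Y n x \<partial>M)"
    by (intro integral_cong_AE) auto
  moreover have "(\<integral>x. Z x * real_cond_exp M (F n) (Y m) x \<partial>M) = (\<integral>x. Z x * Y m x \<partial>M)"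
  proof (rule real_cond_exp_intg(2))
    show "integrable M (\<lambda>x. Z x * Y m x)"
    proof (rule integrable_bounded)
      show "\<bar>Z x * Y m x\<bar> \<le> c" if "x \<in> space M" for x
        using mult_mono[OF Z(2)[OF that] bounded[OF that, of m]] that Z(2)[OF that]
        by (simp add: abs_mult)
    qed simp
  qed (use Z(1) in auto)
  ultimately show ?thesis by simp
qed

text \<open>The squared norm in L2. It decreases in \<open>n\<close>, and its drop between two
  indices is the squared distance of the variables, so its convergence controls oscillation.\<close>

definition energy :: "nat \<Rightarrow> real" where "energy n = (\<integral>x. (Y n x)\<^sup>2 \<partial>M)"

lemma abs_diff_le: "x \<in> space M \<Longrightarrow> \<bar>Y m x - Y n x\<bar> \<le> 2"
  using bounded[of x m] bounded[of x n] by linarith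

lemma integrable_diff_square: "integrable M (\<lambda>x. (Y m x - Y n x)\<^sup>2)"
proof (rule integrable_bounded)
  show "\<bar>(Y m x - Y n x)\<^sup>2\<bar> \<le> 2\<^sup>2" if "x \<in> space M" for x
    using power_mono[OF abs_diff_le[OF that, of m n], of 2] by simp
qed simp

lemma integrable_Y_mult: "integrable M (\<lambda>x. Y m x * Y n x)"
proof (rule integrable_bounded)
  show "\<bar>Y m x * Y n x\<bar> \<le> 1" if "x \<in> space M" for x
    using mult_mono[OF bounded[OF that, of m] bounded[OF that, of n]] by (simp add: abs_mult)
qed simp

text \<open>Pythagoras: \<open>Y m - Y n\<close> is orthogonal to the \<open>F n\<close>-measurable
  function \<open>Y n\<close>.\<close>

lemma integral_diff_square:
  assumes "m \<le> n" shows "(\<integral>x. (Y m x - Y n x)\<^sup>2 \<partial>M) = energy m - energy n"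
proof -
  have "(\<integral>x. (Y m x - Y n x)\<^sup>2 \<partial>M) = (\<integral>x. Y m x * Y m x + Y n x * Y n x - 2 * (Y n x * Y m x) \<partial>M)"
    by (intro Bochner_Integration.integral_cong) (auto simp: power2_eq_square algebra_simps)
  also have "\<dots> = energy m + energy n - 2 * (\<integral>x. Y n x * Y m x \<partial>M)"
    by (simp add: integrable_Y_mult energy_def power2_eq_square)
  also have "(\<integral>x. Y n x * Y m x \<partial>M) = (\<integral>x. Y n x * Y n x \<partial>M)"
    using bounded by (intro integral_mult_eq[of _ _ _ 1] adapted assms)
  finally show ?thesis by (simp add: energy_def power2_eq_square)
qed

lemma energy_mono: "m \<le> n \<Longrightarrow> energy n \<le> energy m"
  using integral_diff_square[of m n] integral_nonneg_AE[of "\<lambda>x. (Y m x - Y n x)\<^sup>2" M] by simp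

lemma energy_limit: obtains L where "energy \<longlonglongrightarrow> L" "\<And>n. L \<le> energy n"
proof -
  have "decseq energy" using energy_mono by (auto simp: decseq_def)
  moreover have "\<forall>n. 0 \<le> energy n" by (simp add: energy_def)
  ultimately show ?thesis using that by (metis decseq_convergent)
qed

text \<open>Doob's maximal inequality; \<open>A k\<close> is the event that \<open>k\<close> is the last index at which \<open>Y\<close> deviates
  from \<open>Y n\<close>, i.e. the first one met by the martingale run backwards.\<close>

lemma maximal_inequality:
  assumes mn: "m \<le> n" and e: "0 < e"
  shows "e\<^sup>2 * prob {x\<in>space M. \<exists>k\<in>{m..n}. e \<le> \<bar>Y k x - Y n x\<bar>} \<le> energy m - energy n"
proof -
  define A where "A k = {x\<in>space M. e \<le> \<bar>Y k x - Y n x\<bar> \<and> (\<forall>j\<in>{k<..n}. \<bar>Y j x - Y n x\<bar> < e)}" for k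
  \<comment> \<open>Only indices from \<open>k\<close> to \<open>n\<close> occur in
    \<open>A k\<close>; since the algebras decrease, all these variables are measurable for
    \<open>F k\<close>.\<close>
  have AF: "A k \<in> sets (F k)" if "k \<le> n" for k
  proof -
    have sp: "space (F k) = space M" using subalgebra[of k] by (simp add: subalgebra_def)
    have [measurable]: "Y j \<in> borel_measurable (F k)" if "k \<le> j" for j
      using measurable_F_le[OF that adapted] .
    have [measurable]: "Y k \<in> borel_measurable (F k)" "Y n \<in> borel_measurable (F k)"
      using \<open>k \<le> n\<close> by measurable
    have "{x\<in>space (F k). \<forall>j\<in>{k<..n}. \<bar>Y j x - Y n x\<bar> < e} \<in> sets (F k)"
      by (rule sets.sets_Collect_finite_All) (simp_all add: borel_measurable_less borel_measurable_abs borel_measurable_diff)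
    then have "{x\<in>space (F k). e \<le> \<bar>Y k x - Y n x\<bar>} \<inter> {x\<in>space (F k). \<forall>j\<in>{k<..n}. \<bar>Y j x - Y n x\<bar> < e} \<in> sets (F k)"
      by (intro sets.Int) measurable
    moreover have "A k = {x\<in>space (F k). e \<le> \<bar>Y k x - Y n x\<bar>} \<inter> {x\<in>space (F k). \<forall>j\<in>{k<..n}. \<bar>Y j x - Y n x\<bar> < e}"
      by (auto simp: A_def sp)
    ultimately show ?thesis by simp
  qed
  have A: "A k \<in> events" if "k \<le> n" for k
    using AF[OF that] subalgebra[of k] by (auto simp: subalgebra_def)
  have disj: "disjoint_family_on A {m..n}"
    unfolding disjoint_family_on_def
  proof (intro ballI impI)
    fix i j assume ij: "i \<in> {m..n}" "j \<in> {m..n}" "i \<noteq> j"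
    have "False" if "x \<in> A i" "x \<in> A j" for x
    proof (cases "i < j")
      case True
      then have "\<bar>Y j x - Y n x\<bar> < e" using that(1) ij by (auto simp: A_def)
      then show ?thesis using that(2) by (auto simp: A_def)
    next
      case False
      then have "\<bar>Y i x - Y n x\<bar> < e" using that(2) ij by (auto simp: A_def)
      then show ?thesis using that(1) by (auto simp: A_def)
    qed
    then show "A i \<inter> A j = {}" by blast
  qed
  have Un: "{x\<in>space M. \<exists>k\<in>{m..n}. e \<le> \<bar>Y k x - Y n x\<bar>} = (\<Union>k\<in>{m..n}. A k)"
  proof (intro equalityI subsetI)
    fix x assume x: "x \<in> {x\<in>space M. \<exists>k\<in>{m..n}. e \<le> \<bar>Y k x - Y n x\<bar>}"
    let ?S = "{k\<in>{m..n}. e \<le> \<bar>Y k x - Y n x\<bar>}"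
    have S: "finite ?S" "?S \<noteq> {}" using x by auto
    have "Max ?S \<in> ?S" using S by (rule Max_in)
    moreover have "\<bar>Y j x - Y n x\<bar> < e" if j: "j \<in> {Max ?S<..n}" for j
    proof (rule ccontr)
      assume "\<not> \<bar>Y j x - Y n x\<bar> < e"
      then have "j \<in> ?S" using j calculation by auto
      then have "j \<le> Max ?S" using S by simp
      then show False using j by simp
    qed
    ultimately show "x \<in> (\<Union>k\<in>{m..n}. A k)" using x by (auto simp: A_def)
  qed (auto simp: A_def)
  have step: "e\<^sup>2 * prob (A k) \<le> (\<integral>x. indicator (A k) x * (Y m x - Y n x)\<^sup>2 \<partial>M)" if k: "k \<in> {m..n}" for k
  proof -
    have [measurable]: "A k \<in> events" using A k by simp
    \<comment> \<open>Half the coefficient of the cross term in the expansion of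
      \<open>(Y m - Y n)\<close> squared around \<open>Y k\<close>, cut off to \<open>A k\<close>.
      It is \<open>F k\<close>-measurable, so its product with \<open>Y m - Y k\<close> integrates
      to zero; dropping the square of \<open>Y m - Y k\<close> leaves the desired bound.\<close>
    define Z where "Z x = indicator (A k) x * (Y k x - Y n x)" for x
    have Zb: "\<bar>Z x\<bar> \<le> 2" if "x \<in> space M" for x
      using abs_diff_le[OF that, of k n] by (auto simp: Z_def indicator_def)
    have ZF: "Z \<in> borel_measurable (F k)"
      unfolding Z_def using k AF[of k] measurable_F_le[OF _ adapted, of k n]
      by (intro borel_measurable_times borel_measurable_diff borel_measurable_indicator adapted) auto
    have [measurable]: "Z \<in> borel_measurable M" unfolding Z_def by measurable
    have Zint: "integrable M (\<lambda>x. Z x * Y j x)" for j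
    proof (rule integrable_bounded)
      show "\<bar>Z x * Y j x\<bar> \<le> 2 * 1" if "x \<in> space M" for x
        using mult_mono[OF Zb[OF that] bounded[OF that, of j]] by (simp add: abs_mult)
    qed simp
    have Zint': "integrable M (\<lambda>x. 2 * (Z x * Y m x) - 2 * (Z x * Y k x))"
      using Zint by simp
    have "e\<^sup>2 * prob (A k) = (\<integral>x. e\<^sup>2 * indicator (A k) x \<partial>M)"
      by simp
    also have "\<dots> = (\<integral>x. e\<^sup>2 * indicator (A k) x + (2 * (Z x * Y m x) - 2 * (Z x * Y k x)) \<partial>M)"
    proof -
      have "(\<integral>x. Z x * Y m x \<partial>M) = (\<integral>x. Z x * Y k x \<partial>M)"
        using k by (intro integral_mult_eq[OF _ ZF Zb]) auto
      then show ?thesis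
        using Zint by (subst Bochner_Integration.integral_add[OF _ Zint']) (auto simp: emeasure_eq_measure)
    qed
    also have "\<dots> \<le> (\<integral>x. indicator (A k) x * (Y m x - Y n x)\<^sup>2 \<partial>M)"
    proof (rule integral_mono)
      show "integrable M (\<lambda>x. e\<^sup>2 * indicator (A k) x + (2 * (Z x * Y m x) - 2 * (Z x * Y k x)))"
        using Zint' by (intro Bochner_Integration.integrable_add) (auto simp: emeasure_eq_measure)
      show "integrable M (\<lambda>x. indicator (A k) x * (Y m x - Y n x)\<^sup>2)"
        using integrable_real_mult_indicator[OF _ integrable_diff_square, of "A k" m n] by (simp add: mult.commute)
      fix x assume x: "x \<in> space M"
      show "e\<^sup>2 * indicator (A k) x + (2 * (Z x * Y m x) - 2 * (Z x * Y k x)) \<le> indicator (A k) x * (Y m x - Y n x)\<^sup>2"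
      proof (cases "x \<in> A k")
        case True
        then have "e \<le> \<bar>Y k x - Y n x\<bar>" by (simp add: A_def)
        then have "e\<^sup>2 \<le> (Y k x - Y n x)\<^sup>2" using e power_mono[of e "\<bar>Y k x - Y n x\<bar>" 2] by simp
        moreover have "(Y m x - Y n x)\<^sup>2 = (Y m x - Y k x)\<^sup>2 + 2 * ((Y k x - Y n x) * Y m x) - 2 * ((Y k x - Y n x) * Y k x) + (Y k x - Y n x)\<^sup>2"
          by (simp add: power2_eq_square algebra_simps)
        moreover have "0 \<le> (Y m x - Y k x)\<^sup>2" by simp
        ultimately have "e\<^sup>2 + (2 * ((Y k x - Y n x) * Y m x) - 2 * ((Y k x - Y n x) * Y k x)) \<le> (Y m x - Y n x)\<^sup>2"
          by linarith
        then show ?thesis using True by (simp add: Z_def)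
      qed (simp add: Z_def)
    qed
    finally show ?thesis .
  qed
  have "prob (\<Union>k\<in>{m..n}. A k) \<le> (\<Sum>k\<in>{m..n}. prob (A k))"
    using A by (intro finite_measure_subadditive_finite) auto
  then have "e\<^sup>2 * prob (\<Union>k\<in>{m..n}. A k) \<le> (\<Sum>k\<in>{m..n}. e\<^sup>2 * prob (A k))"
    by (simp add: mult_left_mono flip: sum_distrib_left)
  also have "\<dots> \<le> (\<Sum>k\<in>{m..n}. (\<integral>x. indicator (A k) x * (Y m x - Y n x)\<^sup>2 \<partial>M))"
    by (intro sum_mono step)
  also have "\<dots> = (\<integral>x. (\<Sum>k\<in>{m..n}. indicator (A k) x * (Y m x - Y n x)\<^sup>2) \<partial>M)"
    using integrable_real_mult_indicator[OF A integrable_diff_square]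
    by (intro Bochner_Integration.integral_sum[symmetric]) (simp add: mult.commute)
  also have "\<dots> = (\<integral>x. indicator (\<Union>k\<in>{m..n}. A k) x * (Y m x - Y n x)\<^sup>2 \<partial>M)"
    by (simp add: indicator_UN_disjoint[OF _ disj] sum_distrib_right)
  also have "\<dots> \<le> (\<integral>x. (Y m x - Y n x)\<^sup>2 \<partial>M)"
  proof (rule integral_mono[OF _ integrable_diff_square])
    have "(\<Union>k\<in>{m..n}. A k) \<in> events" using A by auto
    then show "integrable M (\<lambda>x. indicator (\<Union>k\<in>{m..n}. A k) x * (Y m x - Y n x)\<^sup>2)"
      using integrable_real_mult_indicator[OF _ integrable_diff_square, of "\<Union>k\<in>{m..n}. A k" m n]
      by (simp add: mult.commute)
  qed (auto simp: indicator_def)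
  finally show ?thesis using integral_diff_square[OF mn] Un by simp
qed

text \<open>The maximal inequality bounds the probability of a large oscillation after index
  \<open>m\<close> by a multiple of \<open>energy m - L\<close>, uniformly in the final index. This
  tends to zero with growing \<open>m\<close>, so paths are almost surely Cauchy.\<close>

theorem AE_convergent: "AE x in M. convergent (\<lambda>n. Y n x)"
proof -
  obtain L where L: "energy \<longlonglongrightarrow> L" "\<And>n. L \<le> energy n" by (rule energy_limit) blast
  \<comment> \<open>The factor 2 pays for comparing both indices with the last one: if they differ
    by \<open>2 * e\<close>, one of them is at least \<open>e\<close> away from
    \<open>Y N\<close>.\<close>
  define C where "C e m N = {x\<in>space M. \<exists>k\<in>{m..N}. \<exists>l\<in>{m..N}. 2 * e \<le> \<bar>Y k x - Y l x\<bar>}" for e m N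
  have C [measurable]: "C e m N \<in> events" for e m N
    unfolding C_def by measurable
  have C_le: "prob (C e m N) \<le> (energy m - L) / e\<^sup>2" if e: "0 < e" for e m N
  proof (cases "m \<le> N")
    case True
    have "C e m N \<subseteq> {x\<in>space M. \<exists>k\<in>{m..N}. e \<le> \<bar>Y k x - Y N x\<bar>}"
    proof
      fix x assume "x \<in> C e m N"
      then obtain k l where kl: "x \<in> space M" "k \<in> {m..N}" "l \<in> {m..N}" "2 * e \<le> \<bar>Y k x - Y l x\<bar>"
        by (auto simp: C_def)
      have "e \<le> \<bar>Y k x - Y N x\<bar> \<or> e \<le> \<bar>Y l x - Y N x\<bar>"
        using kl(4) by linarith
      then show "x \<in> {x\<in>space M. \<exists>k\<in>{m..N}. e \<le> \<bar>Y k x - Y N x\<bar>}"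
        using kl by blast
    qed
    then have "prob (C e m N) \<le> prob {x\<in>space M. \<exists>k\<in>{m..N}. e \<le> \<bar>Y k x - Y N x\<bar>}"
      by (intro finite_measure_mono) measurable
    also have "\<dots> \<le> (energy m - energy N) / e\<^sup>2"
      using maximal_inequality[OF True e] e by (simp add: field_simps)
    also have "\<dots> \<le> (energy m - L) / e\<^sup>2"
      using L(2)[of N] by (intro divide_right_mono) auto
    finally show ?thesis .
  next
    case False
    then have "C e m N = {}" by (auto simp: C_def)
    then show ?thesis using L(2)[of m] by simp
  qed
  have null: "AE x in M. \<exists>m. \<forall>N. x \<notin> C e m N" if e: "0 < e" for e
  proof -
    let ?B = "\<Inter>m. \<Union>N. C e m N"
    have B: "?B \<in> events" by measurable
    have "prob ?B \<le> (energy m - L) / e\<^sup>2" for m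
    proof -
      have "incseq (C e m)" unfolding incseq_def C_def by fastforce
      then have "(\<lambda>N. prob (C e m N)) \<longlonglongrightarrow> prob (\<Union>N. C e m N)"
        by (intro finite_Lim_measure_incseq) auto
      then have "prob (\<Union>N. C e m N) \<le> (energy m - L) / e\<^sup>2"
        using C_le[OF e] by (intro LIMSEQ_le_const2) auto
      moreover have "prob ?B \<le> prob (\<Union>N. C e m N)"
        by (intro finite_measure_mono) auto
      ultimately show ?thesis by simp
    qed
    moreover have "(\<lambda>m. (energy m - L) / e\<^sup>2) \<longlonglongrightarrow> (L - L) / e\<^sup>2"
      by (intro tendsto_intros L) (use e in simp)
    ultimately have "prob ?B \<le> 0"
      by (intro LIMSEQ_le_const) auto
    then have "prob ?B = 0" using measure_nonneg[of M ?B] by linarith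
    then have "?B \<in> null_sets M" using B by (auto simp: emeasure_eq_measure)
    then have "AE x in M. x \<notin> ?B" by (rule AE_not_in)
    then show ?thesis by eventually_elim auto
  qed
  have "AE x in M. \<forall>j. \<exists>m. \<forall>N. x \<notin> C (1 / real (Suc j)) m N"
    using null by (simp add: AE_all_countable)
  then show ?thesis
  proof (rule AE_mp, intro AE_I2 impI)
    fix x assume x: "x \<in> space M" and *: "\<forall>j. \<exists>m. \<forall>N. x \<notin> C (1 / real (Suc j)) m N"
    have "Cauchy (\<lambda>n. Y n x)"
    proof (rule metric_CauchyI)
      fix e :: real assume "0 < e"
      then obtain j where j: "2 / real (Suc j) < e"
        using reals_Archimedean[of "e / 2"] by (auto simp: field_simps)
      obtain m where m: "\<And>N. x \<notin> C (1 / real (Suc j)) m N" using * by blast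
      have "dist (Y k x) (Y l x) < e" if "k \<ge> m" "l \<ge> m" for k l
      proof -
        have "\<bar>Y k x - Y l x\<bar> < 2 * (1 / real (Suc j))"
          using m[of "max k l"] x that unfolding C_def by force
        then show ?thesis using j by (simp add: dist_real_def)
      qed
      then show "\<exists>M. \<forall>m\<ge>M. \<forall>n\<ge>M. dist (Y m x) (Y n x) < e" by blast
    qed
    then show "convergent (\<lambda>n. Y n x)" by (rule Cauchy_convergent)
  qed
qed

end
section \<open>Kernels on a standard Borel space\<close>

locale coded_space =
  fixes X :: "'a measure" and code :: "'a \<Rightarrow> real"
  assumes isomorphism: "borel_isomorphism X (restrict_space borel {0..1}) code"
begin

definition decode :: "real \<Rightarrow> 'a" where "decode = inv_into (space X) code"

text \<open>The half-lines at rational points pulled back along the code. They form a countable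
  generating family stable under intersection, so a finite measure is determined by countably many
  values and almost sure equality of kernels can be tested one rational at a time.\<close>

definition below :: "rat \<Rightarrow> 'a set" where "below q = {x\<in>space X. code x \<le> of_rat q}"

lemma measurable_code_unit: "code \<in> measurable X (restrict_space borel {0..1})"
  using isomorphism by (simp add: borel_isomorphism_def)

lemma measurable_code [measurable]: "code \<in> borel_measurable X"
  using measurable_code_unit by (simp add: measurable_restrict_space2_iff)

lemma measurable_decode: "decode \<in> measurable (restrict_space borel {0..1}) X"
  using isomorphism by (simp add: borel_isomorphism_def decode_def)

lemma code_range: "x \<in> space X \<Longrightarrow> code x \<in> {0..1}"
  using measurable_space[OF measurable_code_unit] by (simp add: space_restrict_space)

lemma bij_betw_code: "bij_betw code (space X) {0..1}"
  using isomorphism by (simp add: borel_isomorphism_def space_restrict_space)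

lemma decode_code: "x \<in> space X \<Longrightarrow> decode (code x) = x"
  unfolding decode_def by (rule bij_betw_inv_into_left[OF bij_betw_code])

lemma code_decode: "u \<in> {0..1} \<Longrightarrow> code (decode u) = u"
  unfolding decode_def by (rule bij_betw_inv_into_right[OF bij_betw_code])

lemma space_not_empty: "space X \<noteq> {}"
  using isomorphism by (auto simp: borel_isomorphism_def space_restrict_space bij_betw_def)

lemma below_in_sets [measurable, simp]: "below q \<in> sets X"
  unfolding below_def by measurable

lemma below_mono: "q \<le> r \<Longrightarrow> below q \<subseteq> below r"
  unfolding below_def by (auto intro: order_trans simp: of_rat_less_eq)

lemma below_ge_1: "1 \<le> q \<Longrightarrow> below q = space X"
  using code_range unfolding below_def by (force intro: order_trans simp: one_le_of_rat_iff)

lemma below_neg: "q < 0 \<Longrightarrow> below q = {}"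
proof -
  assume "q < 0"
  then have "of_rat q < (0::real)" by (simp add: of_rat_less_0_iff)
  then have "\<not> code x \<le> of_rat q" if "x \<in> space X" for x
    using code_range[OF that] by (simp del: of_rat_less_0_iff)
  then show ?thesis by (auto simp: below_def)
qed

lemma sets_borel_eq_rat_atMost: "sets borel = sigma_sets UNIV (range (\<lambda>q. {..of_rat q :: real}))"
proof
  let ?N = "sigma UNIV (range (\<lambda>q. {..of_rat q :: real}))"
  have N: "sets ?N = sigma_sets UNIV (range (\<lambda>q. {..of_rat q :: real}))" by (simp add: sets_measure_of)
  have "{..a} \<in> sets ?N" for a :: real
  proof -
    have "{..a} = (\<Inter>q\<in>{q. a < of_rat q}. {..of_rat q})"
    proof (intro equalityI subsetI)
      fix x assume x: "x \<in> (\<Inter>q\<in>{q. a < of_rat q}. {..of_rat q :: real})"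
      show "x \<in> {..a}"
      proof (rule ccontr)
        assume "x \<notin> {..a}"
        then obtain q where "a < of_rat q" "of_rat q < x" using of_rat_dense[of a x] by auto
        then show False using x by auto
      qed
    qed auto
    moreover obtain q where "a < of_rat q" using of_rat_dense[of a "a + 1"] by auto
    then have "(\<Inter>q\<in>{q. a < of_rat q}. {..of_rat q :: real}) \<in> sets ?N"
      by (intro sets.countable_INT') (auto simp: N)
    ultimately show ?thesis by simp
  qed
  then have "sigma_sets UNIV (range (\<lambda>a::real. {..a})) \<subseteq> sets ?N"
    using sets.sigma_sets_subset[of "range (\<lambda>a::real. {..a})" ?N] by auto
  then show "sets borel \<subseteq> sigma_sets UNIV (range (\<lambda>q. {..of_rat q :: real}))"
    unfolding N borel_eq_atMost by (simp add: sets_measure_of)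
  show "sigma_sets UNIV (range (\<lambda>q. {..of_rat q :: real})) \<subseteq> sets borel"
    using sets.sigma_sets_subset[of "range (\<lambda>q. {..of_rat q :: real})" borel] by (simp add: image_subset_iff)
qed

text \<open>Every measurable set is the preimage under \<open>code\<close> of a Borel set, and
  taking preimages commutes with generating a sigma-algebra.\<close>

lemma sets_eq_sigma_below: "sets X = sigma_sets (space X) (range below)"
proof
  show "sigma_sets (space X) (range below) \<subseteq> sets X"
    by (intro sets.sigma_sets_subset) auto
  show "sets X \<subseteq> sigma_sets (space X) (range below)"
  proof
    fix S assume S: "S \<in> sets X"
    let ?A = "decode -` S \<inter> {0..1}"
    have "?A \<in> sets (restrict_space borel {0..1})"
      using measurable_sets[OF measurable_decode S] by (simp add: space_restrict_space)
    then have "?A \<in> sets borel"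
      by (auto simp: sets_restrict_space)
    then have "code -` ?A \<inter> space X \<in> {code -` A \<inter> space X |A. A \<in> sigma_sets UNIV (range (\<lambda>q. {..of_rat q}))}"
      unfolding sets_borel_eq_rat_atMost by blast
    also have "\<dots> = sigma_sets (space X) {code -` A \<inter> space X |A. A \<in> range (\<lambda>q. {..of_rat q})}"
      by (intro sigma_sets_vimage_commute) auto
    also have "{code -` A \<inter> space X |A. A \<in> range (\<lambda>q. {..of_rat q})} = range below"
    proof (intro equalityI subsetI)
      fix S assume "S \<in> {code -` A \<inter> space X |A. A \<in> range (\<lambda>q. {..of_rat q})}"
      then obtain q where "S = code -` {..of_rat q} \<inter> space X" by blast
      then have "S = below q" by (auto simp: below_def)
      then show "S \<in> range below" by simp
    next
      fix S assume "S \<in> range below"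
      then obtain q where "S = below q" by blast
      then have "S = code -` {..of_rat q} \<inter> space X" by (auto simp: below_def)
      then show "S \<in> {code -` A \<inter> space X |A. A \<in> range (\<lambda>q. {..of_rat q})}" by blast
    qed
    also have "code -` ?A \<inter> space X = S"
      using sets.sets_into_space[OF S] code_range decode_code by auto
    finally show "S \<in> sigma_sets (space X) (range below)" .
  qed
qed

lemma measure_eqI_below:
  assumes "sets P = sets X" "sets Q = sets X" and fin: "emeasure P (space X) \<noteq> \<infinity>"
    and eq: "\<And>q. emeasure P (below q) = emeasure Q (below q)"
  shows "P = Q"
proof (rule measure_eqI_generator_eq[where E = "range below" and \<Omega> = "space X" and A = "\<lambda>_. below 1"])
  show "Int_stable (range below)"
  proof (rule Int_stableI)
    fix a b assume "a \<in> range below" "b \<in> range below"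
    then obtain q r where qr: "a = below q" "b = below r" by blast
    have "below q \<inter> below r = below (min q r)"
      using below_mono[of q r] below_mono[of r q] by (cases "q \<le> r") (auto simp: min_def)
    then show "a \<inter> b \<in> range below" using qr by simp
  qed
  show "range below \<subseteq> Pow (space X)" by (auto simp: below_def)
  show "sets P = sigma_sets (space X) (range below)" "sets Q = sigma_sets (space X) (range below)"
    using assms(1,2) sets_eq_sigma_below by simp_all
  show "(\<Union>i::nat. below 1) = space X" "emeasure P (below 1) \<noteq> \<infinity>"
    using fin by (simp_all add: below_ge_1)
qed (use eq in auto)

definition unit_uniform :: "real measure" where
  "unit_uniform = restrict_space lborel {0..1}"

lemma sets_unit_uniform [measurable_cong]: "sets unit_uniform = sets (restrict_space borel {0..1})"
  by (simp add: unit_uniform_def sets_restrict_space)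

lemma space_unit_uniform: "space unit_uniform = {0..1}"
  by (simp add: unit_uniform_def space_restrict_space)

lemma emeasure_unit_uniform: "A \<subseteq> {0..1} \<Longrightarrow> A \<in> sets borel \<Longrightarrow> emeasure unit_uniform A = emeasure lborel A"
  unfolding unit_uniform_def by (intro emeasure_restrict_space) auto

lemma prob_space_unit_uniform: "prob_space unit_uniform"
  by (rule prob_spaceI) (simp add: space_unit_uniform emeasure_unit_uniform)

end

text \<open>The limit kernel at \<open>x\<close> is the law of the quantile function of the pointwise limit of the
  distribution functions of \<open>Q n x\<close>; the supremum \<open>1\<close> of the coded space is inserted so that the
  infimum is never taken over the empty set.\<close>

locale kernel_sequence = coded_space X code for X :: "'a measure" and code +
  fixes Q :: "nat \<Rightarrow> 'a \<Rightarrow> 'a measure"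
begin

text \<open>No law enters here: \<open>lim\<close> is total, so there is a value, meaningless where
  the sequence diverges, at every point. This is what later makes the limit kernel common to all
  laws.\<close>

definition limit_cdf :: "'a \<Rightarrow> rat \<Rightarrow> real" where
  "limit_cdf x q = lim (\<lambda>n. measure (Q n x) (below q))"

definition quantile :: "'a \<Rightarrow> real \<Rightarrow> real" where
  "quantile x u = Inf (insert 1 {of_rat q | q. 0 \<le> q \<and> q \<le> 1 \<and> u \<le> limit_cdf x q})"

definition limit_kernel :: "'a \<Rightarrow> 'a measure" where
  "limit_kernel x = distr unit_uniform X (\<lambda>u. decode (quantile x u))"

lemma bdd_below_quantile: "bdd_below (insert 1 {of_rat q :: real | q. 0 \<le> q \<and> q \<le> 1 \<and> u \<le> limit_cdf x q})"
  by (rule bdd_belowI[of _ 0]) auto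

text \<open>An infimum is below \<open>a\<close> iff some member is. Strict sublevel sets thus
  become countable unions over rationals, which yields joint measurability in \<open>x\<close> and
  \<open>u\<close> even where \<open>limit_cdf x\<close> is not a distribution function.\<close>

lemma quantile_less_iff:
  "quantile x u < a \<longleftrightarrow> 1 < a \<or> (\<exists>q. of_rat q < a \<and> 0 \<le> q \<and> q \<le> 1 \<and> u \<le> limit_cdf x q)"
  unfolding quantile_def using bdd_below_quantile by (subst cInf_less_iff) auto

lemma quantile_range: "quantile x u \<in> {0..1}"
proof -
  have "0 \<le> quantile x u"
    unfolding quantile_def by (rule cInf_greatest) auto
  moreover have "quantile x u \<le> 1"
    unfolding quantile_def by (rule cInf_lower[OF _ bdd_below_quantile]) simp
  ultimately show ?thesis by simp
qed

lemma measurable_decode_quantile_pair: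
  assumes N: "\<And>q. (\<lambda>x. limit_cdf x q) \<in> borel_measurable N"
  shows "(\<lambda>(x, u). decode (quantile x u)) \<in> measurable (N \<Otimes>\<^sub>M unit_uniform) X"
proof -
  have "(\<lambda>(x, u). quantile x u) \<in> borel_measurable (N \<Otimes>\<^sub>M unit_uniform)"
  proof (rule borel_measurableI_less)
    fix a
    have [measurable]: "(\<lambda>x. limit_cdf x q) \<in> borel_measurable N" for q by fact
    have [measurable]: "(\<lambda>u. u) \<in> borel_measurable unit_uniform"
      by (simp add: unit_uniform_def measurable_restrict_space1)
    show "{p\<in>space (N \<Otimes>\<^sub>M unit_uniform). (case p of (x, u) \<Rightarrow> quantile x u) < a} \<in> sets (N \<Otimes>\<^sub>M unit_uniform)"
      unfolding split_beta quantile_less_iff by measurable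
  qed
  then have "(\<lambda>(x, u). quantile x u) \<in> measurable (N \<Otimes>\<^sub>M unit_uniform) (restrict_space borel {0..1})"
    using quantile_range by (intro measurable_restrict_space2) auto
  from measurable_compose[OF this measurable_decode]
  show ?thesis by (simp add: split_beta)
qed

lemma measurable_decode_quantile:
  assumes "\<And>q. (\<lambda>x. limit_cdf x q) \<in> borel_measurable N" "x \<in> space N"
  shows "(\<lambda>u. decode (quantile x u)) \<in> measurable unit_uniform X"
  using measurable_Pair2[OF measurable_decode_quantile_pair[OF assms(1)] assms(2)] by simp

text \<open>Pushing forward one fixed probability measure gives a probability measure at every
  point, whatever \<open>limit_cdf\<close> does there. \<open>N\<close> is left general so that a
  smaller sigma-algebra than that of \<open>X\<close> can be used.\<close>

lemma measurable_limit_kernel: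
  assumes N: "\<And>q. (\<lambda>x. limit_cdf x q) \<in> borel_measurable N"
  shows "limit_kernel \<in> measurable N (prob_algebra X)"
proof -
  note m = measurable_decode_quantile_pair[OF N]
  interpret u: prob_space unit_uniform by (rule prob_space_unit_uniform)
  show ?thesis
  proof (rule measurable_prob_algebraI)
    show "limit_kernel \<in> measurable N (subprob_algebra X)"
      unfolding limit_kernel_def using m u.subprob_space_axioms
      by (intro measurable_distr2[of _ _ unit_uniform]) (auto intro!: measurable_const simp: space_subprob_algebra)
    fix x assume "x \<in> space N"
    then show "prob_space (limit_kernel x)"
      unfolding limit_kernel_def by (intro u.prob_space_distr measurable_decode_quantile[OF N])
  qed
qed

text \<open>For a right continuous distribution function, \<open>quantile x u \<le> of_rat q\<close>
  is equivalent to \<open>u \<le> limit_cdf x q\<close>, and the uniform measure of these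
  \<open>u\<close> is the value at \<open>q\<close>. The assumption \<open>right\<close> is right
  continuity along the rationals.\<close>

lemma emeasure_limit_kernel_below:
  assumes prob: "\<And>n. prob_space (Q n x)" and sets: "\<And>n. sets (Q n x) = sets X"
    and conv: "\<And>q. convergent (\<lambda>n. measure (Q n x) (below q))"
    and meas: "(\<lambda>u. decode (quantile x u)) \<in> measurable unit_uniform X"
    and right: "\<And>q u. (\<And>r. q < r \<Longrightarrow> u \<le> limit_cdf x r) \<Longrightarrow> u \<le> limit_cdf x q"
  shows "emeasure (limit_kernel x) (below q) = ennreal (limit_cdf x q)"
proof -
  have lim: "(\<lambda>n. measure (Q n x) (below q)) \<longlonglongrightarrow> limit_cdf x q" for q
    unfolding limit_cdf_def using conv[of q] by (simp add: convergent_LIMSEQ_iff)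
  have mono: "limit_cdf x q \<le> limit_cdf x r" if "q \<le> r" for q r
  proof (rule LIMSEQ_le[OF lim lim], intro exI allI impI)
    fix n
    interpret prob_space "Q n x" by (rule prob)
    show "measure (Q n x) (below q) \<le> measure (Q n x) (below r)"
      using below_mono[OF that] by (intro finite_measure_mono) (auto simp: sets)
  qed
  have range: "limit_cdf x q \<in> {0..1}" for q
  proof -
    have "measure (Q n x) (below q) \<le> 1" for n
      using prob by (rule prob_space.prob_le_1)
    then have "limit_cdf x q \<le> 1" by (intro LIMSEQ_le_const2[OF lim]) auto
    moreover have "0 \<le> limit_cdf x q" by (intro LIMSEQ_le_const[OF lim]) auto
    ultimately show ?thesis by simp
  qed
  have one: "limit_cdf x q = 1" if "1 \<le> q" for q
  proof -
    have "measure (Q n x) (below q) = 1" for n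
      using prob_space.prob_space[OF prob[of n]] sets_eq_imp_space_eq[OF sets[of n]] below_ge_1[OF that] by simp
    then show ?thesis using LIMSEQ_unique[OF lim[of q]] by simp
  qed
  have "emeasure (limit_kernel x) (below q) = emeasure unit_uniform {u\<in>{0..1}. decode (quantile x u) \<in> below q}"
    unfolding limit_kernel_def using meas
    by (subst emeasure_distr) (auto simp: space_unit_uniform vimage_def Int_def conj_commute)
  also have "{u\<in>{0..1}. decode (quantile x u) \<in> below q} = {u\<in>{0..1}. quantile x u \<le> of_rat q}"
    using measurable_space[OF meas] code_decode[OF quantile_range] by (auto simp: below_def space_unit_uniform)
  also have "emeasure unit_uniform \<dots> = ennreal (limit_cdf x q)"
  proof (cases "q < 0")
    case True
    then have "of_rat q < (0::real)" by (simp add: of_rat_less_0_iff)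
    then have "\<not> quantile x u \<le> of_rat q" for u
      using quantile_range[of x u] by (simp del: of_rat_less_0_iff)
    moreover have "limit_cdf x q = 0"
      using True LIMSEQ_unique[OF lim[of q]] by (simp add: below_neg)
    ultimately show ?thesis by simp
  next
    case False
    have "quantile x u \<le> of_rat q \<longleftrightarrow> u \<le> limit_cdf x q" if u: "u \<in> {0..1}" for u
    proof
      assume le: "u \<le> limit_cdf x q"
      show "quantile x u \<le> of_rat q"
      proof (cases "q \<le> 1")
        case True
        then show ?thesis
          unfolding quantile_def using False le by (intro cInf_lower[OF _ bdd_below_quantile]) auto
      next
        case False
        then have "(1::real) \<le> of_rat q" by (simp add: one_le_of_rat_iff)
        then show ?thesis using quantile_range[of x u] by (simp del: one_le_of_rat_iff)
      qed
    next
      assume le: "quantile x u \<le> of_rat q"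
      show "u \<le> limit_cdf x q"
      proof (rule right)
        \<comment> \<open>The infimum need not be attained, so the bound by \<open>q\<close> only
          provides admissible rationals below each \<open>r > q\<close>.\<close>
        fix r assume "q < r"
        then have "quantile x u < of_rat r" using le by (meson of_rat_less order_le_less_trans)
        then consider "1 < (of_rat r :: real)" | r' where "(of_rat r' :: real) < of_rat r" "u \<le> limit_cdf x r'"
          unfolding quantile_less_iff by blast
        then show "u \<le> limit_cdf x r"
        proof cases
          case 1 then show ?thesis using one[of r] u by (simp add: one_less_of_rat_iff)
        next
          case 2 then show ?thesis using mono[of r' r] by (simp add: of_rat_less)
        qed
      qed
    qed
    then have "{u\<in>{0..1}. quantile x u \<le> of_rat q} = {0..limit_cdf x q}"
      using range[of q] by auto
    then show ?thesis
      using range[of q] by (simp add: emeasure_unit_uniform)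
  qed
  finally show ?thesis .
qed

end
section \<open>Decreasing sequences of proper kernels\<close>

lemma prob_algebraD:
  assumes "P \<in> space (prob_algebra X)"
  shows "sets P = sets X" "space P = space X" "prob_space P"
  using assms sets_eq_imp_space_eq by (auto simp: space_prob_algebra)

text \<open>The indicator of \<open>B\<close> is almost surely constant under \<open>N\<close>, with
  its value at \<open>x\<close>, so it can be taken out of the integral.\<close>

lemma nn_integral_zero_one:
  assumes "prob_space N" and B: "B \<in> sets N" "emeasure N B = indicator B x"
    and h: "h \<in> borel_measurable N"
  shows "(\<integral>\<^sup>+y. indicator B y * h y \<partial>N) = indicator B x * (\<integral>\<^sup>+y. h y \<partial>N)"
proof (cases "x \<in> B")
  case True
  interpret prob_space N by fact
  have "AE y in N. y \<in> B"
    using B True by (intro AE_prob_1) (simp add: emeasure_eq_measure)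
  then have "AE y in N. indicator B y * h y = h y"
    by eventually_elim simp
  then have "(\<integral>\<^sup>+y. indicator B y * h y \<partial>N) = (\<integral>\<^sup>+y. h y \<partial>N)"
    by (rule nn_integral_cong_AE)
  then show ?thesis using True by simp
next
  case False
  then have "AE y in N. y \<notin> B"
    using B by (intro AE_not_in null_setsI) auto
  then have "AE y in N. indicator B y * h y = 0"
    by eventually_elim simp
  then have "(\<integral>\<^sup>+y. indicator B y * h y \<partial>N) = (\<integral>\<^sup>+y. 0 \<partial>N)"
    by (rule nn_integral_cong_AE)
  then show ?thesis using False by simp
qed

text \<open>Properness at every point, together with stationarity of a law, makes \<open>Q n\<close>
  its conditional distribution given \<open>F n\<close>; the kernel is the same for all such
  laws.\<close>

locale decreasing_kernels = kernel_sequence X code Q for X :: "'a measure" and code Q +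
  fixes F :: "nat \<Rightarrow> 'a measure"
  assumes subalgebra: "subalgebra X (F n)"
    and decreasing: "m \<le> n \<Longrightarrow> sets (F n) \<subseteq> sets (F m)"
    and measurable_kernel: "Q n \<in> measurable (F n) (prob_algebra X)"
    and proper: "x \<in> space X \<Longrightarrow> B \<in> sets (F n) \<Longrightarrow> emeasure (Q n x) B = indicator B x"
begin

definition stationary :: "'a measure set" where
  "stationary = {P\<in>space (prob_algebra X). \<forall>n. P \<bind> Q n = P}"

definition tail :: "'a measure" where "tail = sigma (space X) (\<Inter>n. sets (F n))"

lemma space_F: "space (F n) = space X" and sets_F_subset: "sets (F n) \<subseteq> sets X"
  using subalgebra[of n] by (auto simp: subalgebra_def)

lemma sets_tail: "sets tail = (\<Inter>n. sets (F n))"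
proof -
  have sub: "(\<Inter>n. sets (F n)) \<subseteq> Pow (space X)"
    using sets.space_closed[of "F 0"] space_F[of 0] by auto
  have "sigma_sets (space X) (\<Inter>n. sets (F n)) \<subseteq> sets (F n)" for n
    using sets.sigma_sets_subset[of "\<Inter>n. sets (F n)" "F n"] by (auto simp: space_F)
  then show ?thesis using sub by (auto simp: tail_def sets_measure_of)
qed

lemma space_tail: "space tail = space X"
  by (simp add: tail_def space_measure_of_conv)

lemma sets_tail_subset: "sets tail \<subseteq> sets X"
  using sets_F_subset[of 0] by (auto simp: sets_tail)

lemma subalgebra_tail: "sets P = sets X \<Longrightarrow> subalgebra P tail"
  using sets_eq_imp_space_eq[of P X] sets_tail_subset by (simp add: subalgebra_def space_tail)

lemma measurable_tailI:
  assumes "\<And>n. f \<in> measurable (F n) N" shows "f \<in> measurable tail N"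
proof (rule measurableI)
  show "f x \<in> space N" if "x \<in> space tail" for x
    using that measurable_space[OF assms[of 0]] by (simp add: space_F space_tail)
  show "f -` A \<inter> space tail \<in> sets tail" if "A \<in> sets N" for A
    using measurable_sets[OF assms that] by (simp add: space_F space_tail sets_tail)
qed

lemma measurable_from_tail: "f \<in> measurable tail N \<Longrightarrow> f \<in> measurable X N"
  by (rule measurable_from_subalg[OF subalgebra_tail]) simp_all

lemma measurable_kernel_X: "Q n \<in> measurable X (prob_algebra X)"
  by (rule measurable_from_subalg[OF subalgebra measurable_kernel])

lemma kernel_prob:
  assumes "x \<in> space X"
  shows "sets (Q n x) = sets X" "space (Q n x) = space X" "prob_space (Q n x)"
  using prob_algebraD[OF measurable_space[OF measurable_kernel_X assms]] by auto

lemma measurable_measure_kernel: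
  assumes "E \<in> sets X" shows "(\<lambda>x. measure (Q n x) E) \<in> borel_measurable (F n)"
  using measurable_compose[OF measurable_prob_algebraD[OF measurable_kernel] measurable_measure_subprob_algebra[OF assms]] .

text \<open>A limit ignores the first \<open>n\<close> terms, and all later ones are measurable for
  \<open>F n\<close>.\<close>

lemma measurable_limit_cdf: "(\<lambda>x. limit_cdf x q) \<in> borel_measurable tail"
proof (rule measurable_tailI)
  fix n
  have "lim (\<lambda>k. measure (Q k x) (below q)) = lim (\<lambda>k. measure (Q (k + n) x) (below q))" for x
  proof -
    have "(\<lambda>k. measure (Q (k + n) x) (below q)) \<longlonglongrightarrow> L \<longleftrightarrow> (\<lambda>k. measure (Q k x) (below q)) \<longlonglongrightarrow> L" for L
      using LIMSEQ_offset[of "\<lambda>k. measure (Q k x) (below q)" n L]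
        LIMSEQ_ignore_initial_segment[of "\<lambda>k. measure (Q k x) (below q)" L n] by blast
    then show ?thesis by (simp add: lim_def)
  qed
  moreover have "(\<lambda>x. measure (Q (k + n) x) (below q)) \<in> borel_measurable (F n)" for k
    using measurable_measure_kernel[of "below q" "k + n"] decreasing[of n "k + n"] space_F
    by (intro measurable_from_subalg[of "F n" "F (k + n)"]) (auto simp: subalgebra_def)
  ultimately show "(\<lambda>x. limit_cdf x q) \<in> borel_measurable (F n)"
    unfolding limit_cdf_def by (simp add: borel_measurable_lim_metric)
qed

lemma measurable_limit_kernel_tail: "limit_kernel \<in> measurable tail (prob_algebra X)"
  by (rule measurable_limit_kernel[OF measurable_limit_cdf])

lemma measurable_limit_kernel_X: "limit_kernel \<in> measurable X (prob_algebra X)"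
  by (rule measurable_from_tail[OF measurable_limit_kernel_tail])

lemma stationaryD:
  assumes "P \<in> stationary"
  shows "P \<in> space (prob_algebra X)" "sets P = sets X" "space P = space X" "prob_space P" "P \<bind> Q n = P"
  using assms prob_algebraD[of P X] by (auto simp: stationary_def)

lemma nn_integral_kernel:
  assumes P: "sets P = sets X" and k: "k \<in> measurable X (prob_algebra X)" and h: "h \<in> borel_measurable X"
  shows "(\<integral>\<^sup>+x. h x \<partial>(P \<bind> k)) = (\<integral>\<^sup>+x. \<integral>\<^sup>+y. h y \<partial>k x \<partial>P)"
  using measurable_prob_algebraD[OF k] P by (intro nn_integral_bind[OF h]) (simp cong: measurable_cong_sets)

text \<open>Stationarity replaces \<open>P\<close> by its average over \<open>Q n\<close>;
  properness then takes the indicator of the \<open>F n\<close>-event out of the inner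
  integral.\<close>

lemma nn_integral_stationary:
  assumes P: "P \<in> stationary" and B: "B \<in> sets (F n)" and h: "h \<in> borel_measurable X"
  shows "(\<integral>\<^sup>+x. indicator B x * (\<integral>\<^sup>+y. h y \<partial>Q n x) \<partial>P) = (\<integral>\<^sup>+x. indicator B x * h x \<partial>P)"
proof -
  note PD = stationaryD[OF P]
  have BX: "B \<in> sets X" using B sets_F_subset by auto
  have m: "(\<lambda>x. indicator B x * h x) \<in> borel_measurable X" using BX h by measurable
  have "(\<integral>\<^sup>+x. indicator B x * h x \<partial>P) = (\<integral>\<^sup>+x. indicator B x * h x \<partial>(P \<bind> Q n))"
    by (simp add: PD(5))
  also have "\<dots> = (\<integral>\<^sup>+x. \<integral>\<^sup>+y. indicator B y * h y \<partial>Q n x \<partial>P)"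
    by (rule nn_integral_kernel[OF PD(2) measurable_kernel_X m])
  also have "\<dots> = (\<integral>\<^sup>+x. indicator B x * (\<integral>\<^sup>+y. h y \<partial>Q n x) \<partial>P)"
  proof (rule nn_integral_cong)
    fix x assume "x \<in> space P"
    then have x: "x \<in> space X" by (simp add: PD)
    show "(\<integral>\<^sup>+y. indicator B y * h y \<partial>Q n x) = indicator B x * (\<integral>\<^sup>+y. h y \<partial>Q n x)"
      using kernel_prob[OF x, of n] BX h proper[OF x B]
      by (intro nn_integral_zero_one) (simp_all cong: measurable_cong_sets)
  qed
  finally show ?thesis by simp
qed

lemma integral_stationary:
  assumes P: "P \<in> stationary" and B: "B \<in> sets (F n)" and E: "E \<in> sets X"
  shows "(\<integral>x. indicator B x * measure (Q n x) E \<partial>P) = measure P (B \<inter> E)"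
proof -
  note PD = stationaryD[OF P]
  have BX: "B \<in> sets X" using B sets_F_subset by auto
  have [measurable]: "(\<lambda>x. measure (Q n x) E) \<in> borel_measurable P"
    using measurable_from_subalg[OF subalgebra measurable_measure_kernel[OF E]] PD(2)
    by (simp cong: measurable_cong_sets)
  have [measurable]: "B \<in> sets P" using BX PD by simp
  have "(\<integral>x. indicator B x * measure (Q n x) E \<partial>P) = enn2real (\<integral>\<^sup>+x. ennreal (indicator B x * measure (Q n x) E) \<partial>P)"
    by (intro integral_eq_nn_integral) auto
  also have "(\<integral>\<^sup>+x. ennreal (indicator B x * measure (Q n x) E) \<partial>P) = (\<integral>\<^sup>+x. indicator B x * (\<integral>\<^sup>+y. indicator E y \<partial>Q n x) \<partial>P)"
  proof (rule nn_integral_cong)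
    fix x assume "x \<in> space P"
    then have x: "x \<in> space X" by (simp add: PD)
    interpret prob_space "Q n x" by (rule kernel_prob[OF x])
    show "ennreal (indicator B x * measure (Q n x) E) = indicator B x * (\<integral>\<^sup>+y. indicator E y \<partial>Q n x)"
      using E by (simp add: kernel_prob[OF x] emeasure_eq_measure ennreal_mult ennreal_indicator)
  qed
  also have "\<dots> = (\<integral>\<^sup>+x. indicator B x * indicator E x \<partial>P)"
    using E by (intro nn_integral_stationary[OF P B]) simp
  also have "\<dots> = emeasure P (B \<inter> E)"
    using BX E PD(2) by (simp flip: indicator_inter_arith)
  finally show ?thesis by (simp add: measure_def)
qed

text \<open>The reverse martingale property holds because an event of the smaller algebra lies in
  both: each of the two integrals equals the probability of its intersection with
  \<open>E\<close>.\<close>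

lemma AE_convergent_kernel:
  assumes P: "P \<in> stationary" and E: "E \<in> sets X"
  shows "AE x in P. convergent (\<lambda>n. measure (Q n x) E)"
proof -
  note PD = stationaryD[OF P]
  interpret P: prob_space P by (rule PD)
  interpret bounded_reverse_martingale P F "\<lambda>n x. measure (Q n x) E"
  proof
    show "subalgebra P (F n)" for n
      using sets_F_subset space_F by (simp add: subalgebra_def PD)
    show "sets (F n) \<subseteq> sets (F m)" if "m \<le> n" for m n by (rule decreasing[OF that])
    show "(\<lambda>x. measure (Q n x) E) \<in> borel_measurable (F n)" for n by (rule measurable_measure_kernel[OF E])
    show "\<bar>measure (Q n x) E\<bar> \<le> 1" if "x \<in> space P" for x n
      using prob_space.prob_le_1[OF kernel_prob(3)] that by (simp add: PD)
    show "(\<integral>x. indicator B x * measure (Q m x) E \<partial>P) = (\<integral>x. indicator B x * measure (Q n x) E \<partial>P)"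
      if "m \<le> n" "B \<in> sets (F n)" for m n B
      using that decreasing[OF that(1)] integral_stationary[OF P _ E, of B] by auto
  qed
  show ?thesis by (rule AE_convergent)
qed

context
  fixes P assumes P: "P \<in> stationary"
begin

interpretation P: prob_space P by (rule stationaryD[OF P])

lemma measurable_limit_cdf_P: "(\<lambda>x. limit_cdf x q) \<in> borel_measurable P"
  using measurable_from_tail[OF measurable_limit_cdf] stationaryD(2)[OF P] by (simp cong: measurable_cong_sets)

lemma AE_limit_cdf: "AE x in P. \<forall>q. (\<lambda>n. measure (Q n x) (below q)) \<longlonglongrightarrow> limit_cdf x q"
  unfolding AE_all_countable
proof
  fix q
  show "AE x in P. (\<lambda>n. measure (Q n x) (below q)) \<longlonglongrightarrow> limit_cdf x q"
    using AE_convergent_kernel[OF P below_in_sets[of q]]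
    by eventually_elim (simp add: limit_cdf_def convergent_LIMSEQ_iff)
qed

lemma AE_limit_cdf_mono: "AE x in P. \<forall>q r. 0 \<le> limit_cdf x q \<and> limit_cdf x q \<le> 1 \<and> (q \<le> r \<longrightarrow> limit_cdf x q \<le> limit_cdf x r)"
  using AE_limit_cdf AE_space
proof eventually_elim
  case (elim x)
  then have x: "x \<in> space X" by (simp add: stationaryD[OF P])
  have lim: "(\<lambda>n. measure (Q n x) (below q)) \<longlonglongrightarrow> limit_cdf x q" for q using elim by blast
  show ?case
  proof (intro allI conjI impI)
    fix q r
    show "0 \<le> limit_cdf x q" by (intro LIMSEQ_le_const[OF lim]) auto
    show "limit_cdf x q \<le> 1"
      using prob_space.prob_le_1[OF kernel_prob(3)[OF x]] by (intro LIMSEQ_le_const2[OF lim]) auto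
    assume qr: "q \<le> r"
    show "limit_cdf x q \<le> limit_cdf x r"
    proof (rule LIMSEQ_le[OF lim lim], intro exI allI impI)
      fix n
      interpret prob_space "Q n x" by (rule kernel_prob[OF x])
      show "measure (Q n x) (below q) \<le> measure (Q n x) (below r)"
        using below_mono[OF qr] by (intro finite_measure_mono) (auto simp: kernel_prob[OF x])
    qed
  qed
qed

lemma integrable_limit_cdf:
  assumes "B \<in> sets X" shows "integrable P (\<lambda>x. indicator B x * limit_cdf x q)"
proof (rule P.integrable_const_bound[where B = 1])
  show "AE x in P. norm (indicator B x * limit_cdf x q) \<le> 1"
    using AE_limit_cdf_mono by eventually_elim (auto simp: indicator_def)
  show "(\<lambda>x. indicator B x * limit_cdf x q) \<in> borel_measurable P"
    using assms stationaryD(2)[OF P]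
    by (intro borel_measurable_times borel_measurable_indicator measurable_limit_cdf_P) simp
qed

lemma integral_limit_cdf:
  assumes B: "B \<in> sets tail"
  shows "(\<integral>x. indicator B x * limit_cdf x q \<partial>P) = measure P (B \<inter> below q)"
proof -
  have BX: "B \<in> sets X" using B sets_tail_subset by blast
  have "(\<lambda>n. \<integral>x. indicator B x * measure (Q n x) (below q) \<partial>P) \<longlonglongrightarrow> (\<integral>x. indicator B x * limit_cdf x q \<partial>P)"
  proof (rule integral_dominated_convergence[where w = "\<lambda>_. 1"])
    show "(\<lambda>x. indicator B x * limit_cdf x q) \<in> borel_measurable P"
      using integrable_limit_cdf[OF BX] by (rule borel_measurable_integrable)
    fix n
    show "(\<lambda>x. indicator B x * measure (Q n x) (below q)) \<in> borel_measurable P"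
      using measurable_from_subalg[OF subalgebra measurable_measure_kernel[of "below q" n]] BX stationaryD(2)[OF P]
      by (intro borel_measurable_times borel_measurable_indicator) (simp_all cong: measurable_cong_sets)
    show "AE x in P. norm (indicator B x * measure (Q n x) (below q)) \<le> 1"
      using prob_space.prob_le_1[OF kernel_prob(3)]
      by (intro AE_I2) (auto simp: indicator_def stationaryD[OF P])
  next
    show "AE x in P. (\<lambda>n. indicator B x * measure (Q n x) (below q)) \<longlonglongrightarrow> indicator B x * limit_cdf x q"
      using AE_limit_cdf by eventually_elim (intro tendsto_mult_left, blast)
  qed simp
  moreover have "(\<integral>x. indicator B x * measure (Q n x) (below q) \<partial>P) = measure P (B \<inter> below q)" for n
    using B by (intro integral_stationary[OF P]) (auto simp: sets_tail)
  ultimately show ?thesis by (simp add: LIMSEQ_const_iff)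
qed

text \<open>By monotonicity the limit from the right exists almost surely and is at least the value
  at \<open>q\<close>. Dominated convergence and continuity of \<open>P\<close> from above give both
  the integral \<open>measure P (below q)\<close>, so they agree almost surely.\<close>

lemma AE_limit_cdf_right_continuous:
  "AE x in P. (\<lambda>k. limit_cdf x (q + 1 / of_nat (Suc k))) \<longlonglongrightarrow> limit_cdf x q"
proof -
  define r where "r k = q + 1 / of_nat (Suc k)" for k
  define h where "h x = lim (\<lambda>k. limit_cdf x (r k))" for x
  have r_dec: "r l \<le> r k" if "k \<le> l" for k l
    unfolding r_def using that by (intro add_left_mono divide_left_mono) (auto simp del: of_nat_Suc)
  have r_gt: "q < r k" for k by (simp add: r_def)
  have sp: "space X \<in> sets tail" using sets.top[of tail] by (simp add: space_tail)
  have int_cdf: "(\<integral>x. limit_cdf x s \<partial>P) = measure P (below s)" and integrable: "integrable P (\<lambda>x. limit_cdf x s)" for s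
  proof -
    have "below s \<subseteq> space X" by (auto simp: below_def)
    then show "(\<integral>x. limit_cdf x s \<partial>P) = measure P (below s)"
      using integral_limit_cdf[OF sp, of s] Bochner_Integration.integral_cong[of P P "\<lambda>x. indicator (space X) x * limit_cdf x s" "\<lambda>x. limit_cdf x s"]
      by (simp add: stationaryD[OF P] Int_absorb1)
    show "integrable P (\<lambda>x. limit_cdf x s)"
      using integrable_limit_cdf[of "space X" s] Bochner_Integration.integrable_cong[of P P "\<lambda>x. indicator (space X) x * limit_cdf x s" "\<lambda>x. limit_cdf x s"]
      by (simp add: stationaryD[OF P])
  qed
  have conv: "AE x in P. (\<lambda>k. limit_cdf x (r k)) \<longlonglongrightarrow> h x \<and> limit_cdf x q \<le> h x"
    using AE_limit_cdf_mono
  proof eventually_elim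
    case (elim x)
    have "decseq (\<lambda>k. limit_cdf x (r k))"
      using elim r_dec by (auto simp: decseq_def)
    then have "convergent (\<lambda>k. limit_cdf x (r k))"
      using elim decseq_convergent[of "\<lambda>k. limit_cdf x (r k)" 0] by (metis convergentI)
    then have l: "(\<lambda>k. limit_cdf x (r k)) \<longlonglongrightarrow> h x"
      by (simp add: h_def convergent_LIMSEQ_iff)
    moreover have "limit_cdf x q \<le> h x"
      using elim r_gt less_imp_le by (intro LIMSEQ_le_const[OF l]) blast
    ultimately show ?case by simp
  qed
  have [measurable]: "h \<in> borel_measurable P"
    unfolding h_def using measurable_limit_cdf_P by (rule borel_measurable_lim_metric)
  have bound: "AE x in P. norm (limit_cdf x s) \<le> 1" for s
    using AE_limit_cdf_mono by eventually_elim auto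
  have dom: "integrable P h" "(\<lambda>k. \<integral>x. limit_cdf x (r k) \<partial>P) \<longlonglongrightarrow> (\<integral>x. h x \<partial>P)"
    using conv bound measurable_limit_cdf_P
      integrable_dominated_convergence[where M = P and f = h and s = "\<lambda>k x. limit_cdf x (r k)" and w = "\<lambda>_. 1"]
      integral_dominated_convergence[where M = P and f = h and s = "\<lambda>k x. limit_cdf x (r k)" and w = "\<lambda>_. 1"]
    by auto
  have "(\<lambda>k. measure P (below (r k))) \<longlonglongrightarrow> measure P (\<Inter>k. below (r k))"
  proof (rule P.finite_Lim_measure_decseq)
    show "range (\<lambda>k. below (r k)) \<subseteq> P.events" by (auto simp: stationaryD[OF P])
    show "decseq (\<lambda>k. below (r k))" using r_dec below_mono by (auto simp: decseq_def)
  qed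
  also have "(\<Inter>k. below (r k)) = below q"
  proof (intro equalityI subsetI)
    fix x assume x: "x \<in> (\<Inter>k. below (r k))"
    have "code x \<le> of_rat q"
    proof (rule ccontr)
      assume "\<not> code x \<le> of_rat q"
      then obtain k where "inverse (of_nat (Suc k)) < code x - of_rat q"
        using reals_Archimedean[of "code x - of_rat q"] by auto
      then have "of_rat (r k) < code x"
        by (simp add: r_def of_rat_add of_rat_divide inverse_eq_divide del: of_nat_Suc)
      moreover have "x \<in> below (r k)" using x by blast
      ultimately show False by (simp add: below_def)
    qed
    then show "x \<in> below q" using x by (auto simp: below_def)
  qed (use below_mono r_gt less_imp_le in blast)
  finally have "(\<integral>x. h x \<partial>P) = (\<integral>x. limit_cdf x q \<partial>P)"
    using dom(2) by (simp add: int_cdf LIMSEQ_unique)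
  then have "(\<integral>x. h x - limit_cdf x q \<partial>P) = 0"
    using dom(1) integrable by simp
  moreover have "AE x in P. 0 \<le> h x - limit_cdf x q"
    using conv by eventually_elim simp
  ultimately have "AE x in P. h x - limit_cdf x q = 0"
    using dom(1) integrable by (subst (asm) integral_nonneg_eq_0_iff_AE) auto
  then show ?thesis
    using conv unfolding r_def by eventually_elim simp
qed

lemma AE_emeasure_limit_kernel_below:
  "AE x in P. \<forall>q. emeasure (limit_kernel x) (below q) = ennreal (limit_cdf x q)"
proof -
  have "AE x in P. \<forall>q. (\<lambda>k. limit_cdf x (q + 1 / of_nat (Suc k))) \<longlonglongrightarrow> limit_cdf x q"
    unfolding AE_all_countable using AE_limit_cdf_right_continuous by blast
  then show ?thesis
    using AE_limit_cdf AE_space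
  proof eventually_elim
    case (elim x)
    then have x: "x \<in> space X" by (simp add: stationaryD[OF P])
    show ?case
    proof (intro allI emeasure_limit_kernel_below)
      show "convergent (\<lambda>n. measure (Q n x) (below q))" for q using elim convergentI by blast
      show "u \<le> limit_cdf x q" if "\<And>r. q < r \<Longrightarrow> u \<le> limit_cdf x r" for q u
      proof (rule LIMSEQ_le_const)
        show "(\<lambda>k. limit_cdf x (q + 1 / of_nat (Suc k))) \<longlonglongrightarrow> limit_cdf x q" using elim by blast
        show "\<exists>N. \<forall>k\<ge>N. u \<le> limit_cdf x (q + 1 / of_nat (Suc k))" using that by simp
      qed
      show "(\<lambda>u. decode (quantile x u)) \<in> measurable unit_uniform X"
        using measurable_decode_quantile[OF measurable_limit_cdf] x by (simp add: space_tail)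
    qed (use kernel_prob[OF x] in auto)
  qed
qed

text \<open>The limit kernel is a version of the conditional distribution given the tail algebra, the same
  for all stationary measures.\<close>

theorem nn_integral_limit_kernel:
  assumes B: "B \<in> sets tail" and h: "h \<in> borel_measurable X"
  shows "(\<integral>\<^sup>+x. indicator B x * (\<integral>\<^sup>+y. h y \<partial>limit_kernel x) \<partial>P) = (\<integral>\<^sup>+x. indicator B x * h x \<partial>P)"
proof -
  have BX: "B \<in> sets X" using B sets_tail_subset by blast
  have BP [measurable]: "B \<in> sets P" using BX by (simp add: stationaryD[OF P])
  \<comment> \<open>Cutting \<open>P\<close> down to \<open>B\<close> turns the claim into the
    equality of two finite measures, \<open>?P\<close> and its image under the kernel, which need be
    compared only on the sets \<open>below q\<close>.\<close>
  let ?P = "density P (indicator B)"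
  have sP: "sets ?P = sets X" by (simp add: stationaryD[OF P])
  have k: "limit_kernel \<in> measurable ?P (subprob_algebra X)"
    using measurable_prob_algebraD[OF measurable_limit_kernel_X] sP by (simp cong: measurable_cong_sets)
  have m [measurable]: "(\<lambda>x. \<integral>\<^sup>+y. g y \<partial>limit_kernel x) \<in> borel_measurable P" if "g \<in> borel_measurable X" for g
    using measurable_compose[OF measurable_prob_algebraD[OF measurable_limit_kernel_X] nn_integral_measurable_subprob_algebra[OF that]]
      stationaryD(2)[OF P] by (simp cong: measurable_cong_sets)
  have *: "(\<integral>\<^sup>+x. g x \<partial>(?P \<bind> limit_kernel)) = (\<integral>\<^sup>+x. indicator B x * (\<integral>\<^sup>+y. g y \<partial>limit_kernel x) \<partial>P)"
    if "g \<in> borel_measurable X" for g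
    using nn_integral_kernel[OF sP measurable_limit_kernel_X that] m[OF that] by (simp add: nn_integral_density)
  have "?P \<bind> limit_kernel = ?P"
  proof (rule measure_eqI_below)
    show sb: "sets (?P \<bind> limit_kernel) = sets X"
      using k space_not_empty sets_eq_imp_space_eq[OF sP] by (intro sets_bind) (auto simp: sets_kernel)
    show "sets ?P = sets X" by (rule sP)
    have eq: "emeasure (?P \<bind> limit_kernel) E = (\<integral>\<^sup>+x. indicator B x * emeasure (limit_kernel x) E \<partial>P)" if E: "E \<in> sets X" for E
    proof -
      have "emeasure (?P \<bind> limit_kernel) E = (\<integral>\<^sup>+x. indicator E x \<partial>(?P \<bind> limit_kernel))"
        using E sb by simp
      also have "\<dots> = (\<integral>\<^sup>+x. indicator B x * (\<integral>\<^sup>+y. indicator E y \<partial>limit_kernel x) \<partial>P)"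
        using E by (intro *) simp
      also have "\<dots> = (\<integral>\<^sup>+x. indicator B x * emeasure (limit_kernel x) E \<partial>P)"
        using E prob_algebraD[OF measurable_space[OF measurable_limit_kernel_X]]
        by (intro nn_integral_cong) (simp add: stationaryD[OF P])
      finally show ?thesis .
    qed
    have "(\<integral>\<^sup>+x. indicator B x * emeasure (limit_kernel x) (space X) \<partial>P) \<le> (\<integral>\<^sup>+x. 1 \<partial>P)"
    proof (rule nn_integral_mono)
      fix x assume "x \<in> space P"
      then have "prob_space (limit_kernel x)"
        using prob_algebraD[OF measurable_space[OF measurable_limit_kernel_X]] by (simp add: stationaryD[OF P])
      then have "emeasure (limit_kernel x) (space X) \<le> 1"
        by (intro subprob_space.subprob_emeasure_le_1 prob_space_imp_subprob_space)
      then show "indicator B x * emeasure (limit_kernel x) (space X) \<le> 1"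
        by (auto simp: indicator_def)
    qed
    also have "\<dots> < \<infinity>" by (simp add: P.emeasure_space_1)
    finally show "emeasure (?P \<bind> limit_kernel) (space X) \<noteq> \<infinity>"
      by (simp add: eq)
    fix q
    have "emeasure (?P \<bind> limit_kernel) (below q) = (\<integral>\<^sup>+x. ennreal (indicator B x * limit_cdf x q) \<partial>P)"
      unfolding eq[OF below_in_sets]
    proof (rule nn_integral_cong_AE)
      show "AE x in P. indicator B x * emeasure (limit_kernel x) (below q) = ennreal (indicator B x * limit_cdf x q)"
        using AE_emeasure_limit_kernel_below by eventually_elim (simp add: indicator_def)
    qed
    also have "\<dots> = ennreal (\<integral>x. indicator B x * limit_cdf x q \<partial>P)"
    proof (rule nn_integral_eq_integral[OF integrable_limit_cdf[OF BX]])
      show "AE x in P. 0 \<le> indicator B x * limit_cdf x q"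
        using AE_limit_cdf_mono by eventually_elim simp
    qed
    also have "\<dots> = emeasure P (B \<inter> below q)"
      by (simp add: integral_limit_cdf[OF B] P.emeasure_eq_measure)
    also have "\<dots> = emeasure ?P (below q)"
    proof -
      have "below q \<in> sets P" by (simp add: stationaryD[OF P])
      then show ?thesis
        by (simp add: emeasure_density flip: indicator_inter_arith)
    qed
    finally show "emeasure (?P \<bind> limit_kernel) (below q) = emeasure ?P (below q)" .
  qed
  then have "(\<integral>\<^sup>+x. h x \<partial>(?P \<bind> limit_kernel)) = (\<integral>\<^sup>+x. h x \<partial>?P)" by simp
  moreover have "(\<integral>\<^sup>+x. h x \<partial>?P) = (\<integral>\<^sup>+x. indicator B x * h x \<partial>P)"
    using h stationaryD(2)[OF P] by (intro nn_integral_density) (simp_all cong: measurable_cong_sets)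
  ultimately show ?thesis using *[OF h] by simp
qed

end

end
section \<open>Ergodic decomposition for decreasing kernels\<close>

context decreasing_kernels
begin

text \<open>This form of ergodicity amounts to countably many measurable conditions on
  \<open>P\<close>, whereas triviality of the tail algebra quantifies over possibly uncountably many
  events. The two are shown equivalent below.\<close>

definition ergodic_laws :: "'a measure set" where
  "ergodic_laws = {P\<in>stationary. AE y in P. limit_kernel y = P}"

section \<open>Measurability of the sets of stationary and of ergodic laws\<close>

lemma measurable_nn_integral_prob_algebra:
  "h \<in> borel_measurable X \<Longrightarrow> (\<lambda>P. \<integral>\<^sup>+x. h x \<partial>P) \<in> borel_measurable (prob_algebra X)"
  using measurable_compose[OF measurable_prob_algebraD[OF measurable_ident_sets[OF refl]] nn_integral_measurable_subprob_algebra] .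

lemma measurable_emeasure_prob_algebra:
  "E \<in> sets X \<Longrightarrow> (\<lambda>P. emeasure P E) \<in> borel_measurable (prob_algebra X)"
  using measurable_compose[OF measurable_prob_algebraD[OF measurable_ident_sets[OF refl]] measurable_emeasure_subprob_algebra] .

lemma measurable_emeasure_kernel: "E \<in> sets X \<Longrightarrow> (\<lambda>x. emeasure (Q n x) E) \<in> borel_measurable X"
  using measurable_compose[OF measurable_kernel_X measurable_emeasure_prob_algebra] .

lemma measurable_emeasure_limit_kernel:
  "E \<in> sets X \<Longrightarrow> (\<lambda>x. emeasure (limit_kernel x) E) \<in> borel_measurable tail"
  using measurable_compose[OF measurable_limit_kernel_tail measurable_emeasure_prob_algebra] .

lemma limit_kernel_prob:
  assumes "x \<in> space X"
  shows "limit_kernel x \<in> space (prob_algebra X)" "sets (limit_kernel x) = sets X"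
    "space (limit_kernel x) = space X" "prob_space (limit_kernel x)"
  using measurable_space[OF measurable_limit_kernel_X assms] prob_algebraD[of "limit_kernel x" X] by auto

lemma prob_eqI_below:
  assumes "P \<in> space (prob_algebra X)" "R \<in> space (prob_algebra X)"
    "\<And>q. emeasure P (below q) = emeasure R (below q)"
  shows "P = R"
proof (rule measure_eqI_below)
  interpret prob_space P by (rule prob_algebraD[OF assms(1)])
  show "emeasure P (space X) \<noteq> \<infinity>" by simp
qed (use assms prob_algebraD in auto)

lemma bind_kernel_prob:
  assumes P: "P \<in> space (prob_algebra X)"
  shows "P \<bind> Q n \<in> space (prob_algebra X)"
    and "E \<in> sets X \<Longrightarrow> emeasure (P \<bind> Q n) E = (\<integral>\<^sup>+x. emeasure (Q n x) E \<partial>P)"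
proof -
  note PD = prob_algebraD[OF P]
  have k: "Q n \<in> measurable P (subprob_algebra X)"
    using measurable_prob_algebraD[OF measurable_kernel_X] PD(1) by (simp cong: measurable_cong_sets)
  have ne: "space P \<noteq> {}" using space_not_empty PD by simp
  have s: "sets (P \<bind> Q n) = sets X"
    using kernel_prob(1) PD ne by (intro sets_bind) auto
  have e: "emeasure (P \<bind> Q n) E = (\<integral>\<^sup>+x. emeasure (Q n x) E \<partial>P)" if "E \<in> sets X" for E
    by (rule emeasure_bind[OF ne k that])
  then show "E \<in> sets X \<Longrightarrow> emeasure (P \<bind> Q n) E = (\<integral>\<^sup>+x. emeasure (Q n x) E \<partial>P)" .
  have "prob_space (P \<bind> Q n)"
  proof (rule prob_spaceI)
    have "emeasure (P \<bind> Q n) (space (P \<bind> Q n)) = (\<integral>\<^sup>+x. emeasure (Q n x) (space X) \<partial>P)"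
      using e[of "space X"] sets_eq_imp_space_eq[OF s] by simp
    also have "\<dots> = (\<integral>\<^sup>+x. 1 \<partial>P)"
    proof (rule nn_integral_cong)
      fix x assume "x \<in> space P"
      then have x: "x \<in> space X" by (simp add: PD)
      show "emeasure (Q n x) (space X) = 1"
        using prob_space.emeasure_space_1[OF kernel_prob(3)[OF x]] by (simp add: kernel_prob[OF x])
    qed
    also have "\<dots> = 1"
      using prob_space.emeasure_space_1[OF PD(3)] by simp
    finally show "emeasure (P \<bind> Q n) (space (P \<bind> Q n)) = 1" .
  qed
  then show "P \<bind> Q n \<in> space (prob_algebra X)" using s by (simp add: space_prob_algebra)
qed

text \<open>The rational half-lines determine a law, so stationarity becomes countably many
  equations between measurable functions of \<open>P\<close>. They are also linear in
  \<open>P\<close>, which later serves for mixtures.\<close>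

lemma stationary_iff_below:
  assumes P: "P \<in> space (prob_algebra X)"
  shows "P \<in> stationary \<longleftrightarrow> (\<forall>n q. (\<integral>\<^sup>+x. emeasure (Q n x) (below q) \<partial>P) = emeasure P (below q))"
proof
  assume "P \<in> stationary"
  then show "\<forall>n q. (\<integral>\<^sup>+x. emeasure (Q n x) (below q) \<partial>P) = emeasure P (below q)"
    using bind_kernel_prob(2)[OF P below_in_sets] by (simp add: stationary_def)
next
  assume "\<forall>n q. (\<integral>\<^sup>+x. emeasure (Q n x) (below q) \<partial>P) = emeasure P (below q)"
  then have "P \<bind> Q n = P" for n
    using bind_kernel_prob(1)[OF P] bind_kernel_prob(2)[OF P below_in_sets] P
    by (intro prob_eqI_below) auto
  then show "P \<in> stationary" using P by (simp add: stationary_def)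
qed

lemma stationary_in_sets: "stationary \<in> sets (prob_algebra X)"
proof -
  have "stationary = {P\<in>space (prob_algebra X). \<forall>n q. (\<integral>\<^sup>+x. emeasure (Q n x) (below q) \<partial>P) = emeasure P (below q)}"
    using stationary_iff_below stationaryD(1) by blast
  moreover have [measurable]: "(\<lambda>P. \<integral>\<^sup>+x. emeasure (Q n x) (below q) \<partial>P) \<in> borel_measurable (prob_algebra X)"
    "(\<lambda>P. emeasure P (below q)) \<in> borel_measurable (prob_algebra X)" for n q
    by (intro measurable_nn_integral_prob_algebra measurable_emeasure_kernel measurable_emeasure_prob_algebra below_in_sets)+
  have "{P\<in>space (prob_algebra X). \<forall>n q. (\<integral>\<^sup>+x. emeasure (Q n x) (below q) \<partial>P) = emeasure P (below q)} \<in> sets (prob_algebra X)"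
    by measurable
  ultimately show ?thesis by simp
qed

lemma AE_limit_kernel_eq_iff:
  assumes P: "P \<in> space (prob_algebra X)" and R: "R \<in> space (prob_algebra X)"
  shows "(AE y in P. limit_kernel y = R) \<longleftrightarrow> (\<forall>q. AE y in P. emeasure (limit_kernel y) (below q) = emeasure R (below q))"
proof
  assume "AE y in P. limit_kernel y = R"
  then show "\<forall>q. AE y in P. emeasure (limit_kernel y) (below q) = emeasure R (below q)"
    by auto
next
  assume "\<forall>q. AE y in P. emeasure (limit_kernel y) (below q) = emeasure R (below q)"
  then have "AE y in P. \<forall>q. emeasure (limit_kernel y) (below q) = emeasure R (below q)"
    by (simp add: AE_all_countable)
  then show "AE y in P. limit_kernel y = R"
    using AE_space
  proof eventually_elim
    case (elim y)
    then have "y \<in> space X" using prob_algebraD[OF P] by simp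
    then show ?case using elim R by (intro prob_eqI_below limit_kernel_prob) auto
  qed
qed

text \<open>Almost sure equality at \<open>q\<close> means that the indicator of disagreement has
  integral zero. This integrand depends on the law as well as on the point, so joint measurability
  is required.\<close>

lemma ergodic_laws_in_sets: "ergodic_laws \<in> sets (prob_algebra X)"
proof -
  define g where "g q P = (\<integral>\<^sup>+y. (if emeasure (limit_kernel y) (below q) = emeasure P (below q) then 0 else 1) \<partial>P)"
    for q and P :: "'a measure"
  have g [measurable]: "g q \<in> borel_measurable (prob_algebra X)" for q
  proof -
    have [measurable]: "(\<lambda>y. emeasure (limit_kernel y) (below q)) \<in> borel_measurable X"
      by (rule measurable_from_tail[OF measurable_emeasure_limit_kernel]) simp
    have [measurable]: "(\<lambda>P. emeasure P (below q)) \<in> borel_measurable (prob_algebra X)"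
      by (rule measurable_emeasure_prob_algebra) simp
    have "(\<lambda>(P, y). if emeasure (limit_kernel y) (below q) = emeasure P (below q) then 0 else 1 :: ennreal)
        \<in> borel_measurable (prob_algebra X \<Otimes>\<^sub>M X)"
      by measurable
    note m = nn_integral_measurable_subprob_algebra2[OF this measurable_prob_algebraD[OF measurable_ident_sets[OF refl]]]
    show ?thesis unfolding g_def by (rule m)
  qed
  have "P \<in> ergodic_laws \<longleftrightarrow> P \<in> stationary \<and> (\<forall>q. g q P = 0)" for P
  proof (cases "P \<in> stationary")
    case True
    note PD = stationaryD[OF True]
    have "g q P = 0 \<longleftrightarrow> (AE y in P. emeasure (limit_kernel y) (below q) = emeasure P (below q))" for q
    proof -
      have [measurable]: "(\<lambda>y. emeasure (limit_kernel y) (below q)) \<in> borel_measurable P"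
        using measurable_from_tail[OF measurable_emeasure_limit_kernel[of "below q"]] PD(2)
        by (simp cong: measurable_cong_sets)
      show ?thesis
        unfolding g_def by (subst nn_integral_0_iff_AE) auto
    qed
    then show ?thesis
      using AE_limit_kernel_eq_iff[OF PD(1) PD(1)] by (simp add: ergodic_laws_def True)
  qed (simp add: ergodic_laws_def)
  then have "ergodic_laws = {P\<in>space (prob_algebra X). P \<in> stationary \<and> (\<forall>q. g q P = 0)}"
    using stationaryD(1) by blast
  moreover have [measurable]: "Measurable.pred (prob_algebra X) (\<lambda>P. P \<in> stationary)"
    using stationary_in_sets by (simp add: pred_def Int_def[symmetric] stationary_def Collect_conj_eq Int_absorb)
  have "{P\<in>space (prob_algebra X). P \<in> stationary \<and> (\<forall>q. g q P = 0)} \<in> sets (prob_algebra X)"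
    by measurable
  ultimately show ?thesis by simp
qed

text \<open>On the restriction of \<open>P\<close> to the tail algebra both functions are densities
  of the same measure, and densities are almost surely unique.\<close>

lemma tail_AE_eqI:
  assumes P: "P \<in> space (prob_algebra X)"
    and f: "f \<in> borel_measurable tail" and g: "g \<in> borel_measurable tail"
    and eq: "\<And>B. B \<in> sets tail \<Longrightarrow> (\<integral>\<^sup>+x. indicator B x * f x \<partial>P) = (\<integral>\<^sup>+x. indicator B x * g x \<partial>P)"
  shows "AE x in P. f x = (g x :: ennreal)"
proof -
  note PD = prob_algebraD[OF P]
  note sub = subalgebra_tail[OF PD(1)]
  interpret R: prob_space "restr_to_subalg P tail"
    by (rule prob_space_restr_to_subalg[OF sub PD(3)])
  have [measurable]: "f \<in> borel_measurable (restr_to_subalg P tail)" "g \<in> borel_measurable (restr_to_subalg P tail)"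
    using f g measurable_in_subalg'[OF sub] measurable_in_subalg[OF sub] by auto
  have "density (restr_to_subalg P tail) f = density (restr_to_subalg P tail) g"
  proof (rule measure_eqI)
    fix B assume "B \<in> sets (density (restr_to_subalg P tail) f)"
    then have B: "B \<in> sets tail" by (simp add: sets_restr_to_subalg[OF sub])
    then have B' [measurable]: "B \<in> sets (restr_to_subalg P tail)" by (simp add: sets_restr_to_subalg[OF sub])
    have *: "emeasure (density (restr_to_subalg P tail) h) B = (\<integral>\<^sup>+x. indicator B x * h x \<partial>P)"
      if h: "h \<in> borel_measurable tail" for h :: "'a \<Rightarrow> ennreal"
    proof -
      have "h \<in> borel_measurable (restr_to_subalg P tail)" using h measurable_in_subalg[OF sub] by auto
      then have "emeasure (density (restr_to_subalg P tail) h) B = (\<integral>\<^sup>+x. h x * indicator B x \<partial>restr_to_subalg P tail)"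
        by (rule emeasure_density) (rule B')
      also have "\<dots> = (\<integral>\<^sup>+x. h x * indicator B x \<partial>P)"
        using h B by (intro nn_integral_subalgebra2[OF sub] borel_measurable_times_ennreal borel_measurable_indicator)
      finally show ?thesis by (simp add: mult.commute)
    qed
    show "emeasure (density (restr_to_subalg P tail) f) B = emeasure (density (restr_to_subalg P tail) g) B"
      by (simp add: * f g eq[OF B])
  qed simp
  then have "AE x in restr_to_subalg P tail. f x = g x"
    by (subst (asm) R.density_unique_iff) simp_all
  then show ?thesis by (rule AE_restr_to_subalg[OF sub])
qed

text \<open>Given the tail algebra, a tail event is its own conditional probability. The exceptional
  null set depends on \<open>B\<close>, so only countably many events can be treated
  together.\<close>

lemma AE_limit_kernel_zero_one:
  assumes P: "P \<in> stationary" and B: "B \<in> sets tail"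
  shows "AE x in P. emeasure (limit_kernel x) B = indicator B x"
proof (rule tail_AE_eqI)
  have BX: "B \<in> sets X" using B sets_tail_subset by blast
  show "P \<in> space (prob_algebra X)" by (rule stationaryD[OF P])
  show "(\<lambda>x. emeasure (limit_kernel x) B) \<in> borel_measurable tail"
    by (rule measurable_emeasure_limit_kernel[OF BX])
  show "indicator B \<in> borel_measurable tail" using B by measurable
  fix C assume C: "C \<in> sets tail"
  have "(\<integral>\<^sup>+x. indicator C x * emeasure (limit_kernel x) B \<partial>P) = (\<integral>\<^sup>+x. indicator C x * (\<integral>\<^sup>+y. indicator B y \<partial>limit_kernel x) \<partial>P)"
    using BX by (intro nn_integral_cong) (simp add: stationaryD[OF P] limit_kernel_prob)
  also have "\<dots> = (\<integral>\<^sup>+x. indicator C x * indicator B x \<partial>P)"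
    using BX by (intro nn_integral_limit_kernel[OF P C]) simp
  finally show "(\<integral>\<^sup>+x. indicator C x * emeasure (limit_kernel x) B \<partial>P) = (\<integral>\<^sup>+x. indicator C x * indicator B x \<partial>P)" .
qed

text \<open>Tower property: tail events belong to \<open>F n\<close>, so
  \<open>emeasure (Q n y) (below q)\<close> and the indicator of \<open>below q\<close> have the
  same conditional expectation given the tail.\<close>

lemma AE_limit_kernel_stationary:
  assumes P: "P \<in> stationary" shows "AE x in P. limit_kernel x \<in> stationary"
proof -
  have "AE x in P. (\<integral>\<^sup>+y. emeasure (Q n y) (below q) \<partial>limit_kernel x) = emeasure (limit_kernel x) (below q)" for n q
  proof (rule tail_AE_eqI)
    show "P \<in> space (prob_algebra X)" by (rule stationaryD[OF P])
    show "(\<lambda>x. \<integral>\<^sup>+y. emeasure (Q n y) (below q) \<partial>limit_kernel x) \<in> borel_measurable tail"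
      using measurable_compose[OF measurable_limit_kernel_tail measurable_nn_integral_prob_algebra[OF measurable_emeasure_kernel[OF below_in_sets]]] .
    show "(\<lambda>x. emeasure (limit_kernel x) (below q)) \<in> borel_measurable tail"
      by (rule measurable_emeasure_limit_kernel) simp
    fix B assume B: "B \<in> sets tail"
    then have BF: "B \<in> sets (F n)" by (simp add: sets_tail)
    have "(\<integral>\<^sup>+x. indicator B x * (\<integral>\<^sup>+y. emeasure (Q n y) (below q) \<partial>limit_kernel x) \<partial>P)
        = (\<integral>\<^sup>+x. indicator B x * emeasure (Q n x) (below q) \<partial>P)"
      by (intro nn_integral_limit_kernel[OF P B] measurable_emeasure_kernel below_in_sets)
    also have "\<dots> = (\<integral>\<^sup>+x. indicator B x * (\<integral>\<^sup>+y. indicator (below q) y \<partial>Q n x) \<partial>P)"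
      by (intro nn_integral_cong) (simp add: stationaryD[OF P] kernel_prob)
    also have "\<dots> = (\<integral>\<^sup>+x. indicator B x * indicator (below q) x \<partial>P)"
      by (intro nn_integral_stationary[OF P BF]) simp
    also have "\<dots> = (\<integral>\<^sup>+x. indicator B x * (\<integral>\<^sup>+y. indicator (below q) y \<partial>limit_kernel x) \<partial>P)"
      by (intro nn_integral_limit_kernel[OF P B, symmetric]) simp
    also have "\<dots> = (\<integral>\<^sup>+x. indicator B x * emeasure (limit_kernel x) (below q) \<partial>P)"
      by (intro nn_integral_cong) (simp add: stationaryD[OF P] limit_kernel_prob)
    finally show "(\<integral>\<^sup>+x. indicator B x * (\<integral>\<^sup>+y. emeasure (Q n y) (below q) \<partial>limit_kernel x) \<partial>P)
        = (\<integral>\<^sup>+x. indicator B x * emeasure (limit_kernel x) (below q) \<partial>P)" .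
  qed
  then have "AE x in P. \<forall>n q. (\<integral>\<^sup>+y. emeasure (Q n y) (below q) \<partial>limit_kernel x) = emeasure (limit_kernel x) (below q)"
    by (simp add: AE_all_countable)
  then show ?thesis
    using AE_space
    by eventually_elim (simp add: stationary_iff_below limit_kernel_prob stationaryD[OF P])
qed

text \<open>For almost every \<open>x\<close>, the countably many tail events \<open>B q s\<close> separate \<open>x\<close> only from a null set
  of \<open>limit_kernel x\<close>.\<close>

lemma AE_limit_kernel_idempotent:
  assumes P: "P \<in> stationary" shows "AE x in P. AE y in limit_kernel x. limit_kernel y = limit_kernel x"
proof -
  define B where "B q s = {y\<in>space X. measure (limit_kernel y) (below q) \<le> of_rat s}" for q s
  have B: "B q s \<in> sets tail" for q s
  proof -
    have [measurable]: "(\<lambda>x. emeasure (limit_kernel x) (below q)) \<in> borel_measurable tail"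
      by (rule measurable_emeasure_limit_kernel) simp
    have "{y\<in>space tail. enn2real (emeasure (limit_kernel y) (below q)) \<le> of_rat s} \<in> sets tail"
      by measurable
    then show ?thesis by (simp add: B_def space_tail measure_def)
  qed
  have "AE x in P. \<forall>q s. emeasure (limit_kernel x) (B q s) = indicator (B q s) x"
    unfolding AE_all_countable using AE_limit_kernel_zero_one[OF P B] by blast
  then show ?thesis
    using AE_space
  proof eventually_elim
    case (elim x)
    then have x: "x \<in> space X" by (simp add: stationaryD[OF P])
    interpret x: prob_space "limit_kernel x" by (rule limit_kernel_prob[OF x])
    have "AE y in limit_kernel x. y \<in> B q s \<longleftrightarrow> x \<in> B q s" for q s
    proof (cases "x \<in> B q s")
      case True
      then have "AE y in limit_kernel x. y \<in> B q s"
        using spec[OF spec[OF elim(1), of q], of s] by (intro x.AE_prob_1) (simp add: x.emeasure_eq_measure)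
      then show ?thesis by eventually_elim (simp add: True)
    next
      case False
      have "B q s \<in> null_sets (limit_kernel x)"
        using elim False B[of q s] sets_tail_subset by (intro null_setsI) (auto simp: limit_kernel_prob[OF x])
      from AE_not_in[OF this] show ?thesis by eventually_elim (simp add: False)
    qed
    then have "AE y in limit_kernel x. \<forall>q s. y \<in> B q s \<longleftrightarrow> x \<in> B q s"
      by (simp add: AE_all_countable)
    then show ?case
      using AE_space
    proof eventually_elim
      case (elim y)
      then have y: "y \<in> space X" by (simp add: limit_kernel_prob[OF x])
      interpret y: prob_space "limit_kernel y" by (rule limit_kernel_prob[OF y])
      have "measure (limit_kernel y) (below q) = measure (limit_kernel x) (below q)" for q
      proof (rule ccontr)
        assume "measure (limit_kernel y) (below q) \<noteq> measure (limit_kernel x) (below q)"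
        \<comment> \<open>Distinct reals are separated by a rational, and \<open>x\<close> and
          \<open>y\<close> lie in the same sets \<open>B q s\<close>.\<close>
        then obtain s where "(measure (limit_kernel y) (below q) \<le> of_rat s) \<noteq> (measure (limit_kernel x) (below q) \<le> of_rat s)"
          using of_rat_dense[of "measure (limit_kernel y) (below q)" "measure (limit_kernel x) (below q)"]
            of_rat_dense[of "measure (limit_kernel x) (below q)" "measure (limit_kernel y) (below q)"]
          by (metis less_imp_le linorder_neqE not_less)
        then show False using elim x y by (auto simp: B_def)
      qed
      then show ?case
        using limit_kernel_prob[OF x] limit_kernel_prob[OF y]
        by (intro prob_eqI_below) (simp_all add: x.emeasure_eq_measure y.emeasure_eq_measure)
    qed
  qed
qed

theorem AE_limit_kernel_ergodic:
  assumes P: "P \<in> stationary" shows "AE x in P. limit_kernel x \<in> ergodic_laws"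
  using AE_limit_kernel_stationary[OF P] AE_limit_kernel_idempotent[OF P]
  by eventually_elim (simp add: ergodic_laws_def)

text \<open>Under an ergodic \<open>P\<close> the limit kernel is distributed as the point mass at
  \<open>P\<close>. This lets a decomposing measure be read off from the measure it
  decomposes.\<close>

lemma ergodic_laws_preimage:
  assumes P: "P \<in> ergodic_laws" and C: "C \<in> sets (prob_algebra X)"
  shows "emeasure P (limit_kernel -` C \<inter> space X) = indicator C P"
proof -
  have St: "P \<in> stationary" and ae: "AE y in P. limit_kernel y = P"
    using P by (auto simp: ergodic_laws_def)
  interpret prob_space P by (rule stationaryD[OF St])
  have m: "limit_kernel -` C \<inter> space X \<in> sets P"
    using measurable_sets[OF measurable_limit_kernel_X C] by (simp add: stationaryD[OF St])
  have "emeasure P (limit_kernel -` C \<inter> space X) = (\<integral>\<^sup>+y. indicator (limit_kernel -` C \<inter> space X) y \<partial>P)"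
    using m by simp
  also have "\<dots> = (\<integral>\<^sup>+y. indicator C P \<partial>P)"
  proof (rule nn_integral_cong_AE)
    show "AE y in P. indicator (limit_kernel -` C \<inter> space X) y = indicator C P"
      using ae AE_space by eventually_elim (auto simp: indicator_def stationaryD[OF St])
  qed
  finally show ?thesis by (simp add: emeasure_space_1)
qed

text \<open>If the kernel is almost surely \<open>P\<close>, the zero-one values of the kernel on
  tail events are those of \<open>P\<close>. Conversely, an event of mass 0 or 1 is independent of
  every other, so the constant \<open>emeasure P (below q)\<close> is a version of the conditional
  probability.\<close>

theorem ergodic_laws_iff_tail_trivial:
  assumes P: "P \<in> stationary"
  shows "P \<in> ergodic_laws \<longleftrightarrow> (\<forall>B\<in>sets tail. emeasure P B = 0 \<or> emeasure P B = 1)"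
proof
  interpret prob_space P by (rule stationaryD[OF P])
  note PD = stationaryD[OF P]
  {
    assume "P \<in> ergodic_laws"
    then have ae: "AE y in P. limit_kernel y = P" by (simp add: ergodic_laws_def)
    show "\<forall>B\<in>sets tail. emeasure P B = 0 \<or> emeasure P B = 1"
    proof
      fix B assume "B \<in> sets tail"
      from AE_limit_kernel_zero_one[OF P this] ae
      have "AE y in P. emeasure P B = 0 \<or> emeasure P B = 1"
        by eventually_elim (auto simp: indicator_def split: if_splits)
      then show "emeasure P B = 0 \<or> emeasure P B = 1" by simp
    qed
  next
    assume trivial: "\<forall>B\<in>sets tail. emeasure P B = 0 \<or> emeasure P B = 1"
    have "AE y in P. emeasure (limit_kernel y) (below q) = emeasure P (below q)" for q
    proof (rule tail_AE_eqI[OF PD(1)])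
      show "(\<lambda>x. emeasure (limit_kernel x) (below q)) \<in> borel_measurable tail"
        by (rule measurable_emeasure_limit_kernel) simp
      fix B assume B: "B \<in> sets tail"
      have BP [measurable]: "B \<in> sets P" "below q \<in> sets P" using B sets_tail_subset PD by auto
      have "(\<integral>\<^sup>+x. indicator B x * emeasure (limit_kernel x) (below q) \<partial>P)
          = (\<integral>\<^sup>+x. indicator B x * (\<integral>\<^sup>+y. indicator (below q) y \<partial>limit_kernel x) \<partial>P)"
        by (intro nn_integral_cong) (simp add: PD limit_kernel_prob)
      also have "\<dots> = (\<integral>\<^sup>+x. indicator B x * indicator (below q) x \<partial>P)"
        by (intro nn_integral_limit_kernel[OF P B]) simp
      also have "\<dots> = emeasure P (B \<inter> below q)"
        by (simp flip: indicator_inter_arith)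
      also have "\<dots> = emeasure P B * emeasure P (below q)"
        using trivial B
      proof (elim ballE disjE)
        assume "emeasure P B = 0"
        moreover have "emeasure P (B \<inter> below q) \<le> emeasure P B" by (intro emeasure_mono) auto
        ultimately show ?thesis by simp
      next
        assume 1: "emeasure P B = 1"
        then have "AE x in P. x \<in> B" by (intro AE_prob_1) (simp add: emeasure_eq_measure)
        then have "AE x in P. x \<in> B \<inter> below q \<longleftrightarrow> x \<in> below q"
          by eventually_elim auto
        then have "emeasure P (B \<inter> below q) = emeasure P (below q)"
          by (rule emeasure_eq_AE) measurable
        then show ?thesis by (simp add: 1)
      qed simp
      also have "\<dots> = (\<integral>\<^sup>+x. indicator B x * emeasure P (below q) \<partial>P)"
        by (simp add: nn_integral_multc)
      finally show "(\<integral>\<^sup>+x. indicator B x * emeasure (limit_kernel x) (below q) \<partial>P) = (\<integral>\<^sup>+x. indicator B x * emeasure P (below q) \<partial>P)" .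
    qed simp
    then show "P \<in> ergodic_laws"
      using AE_limit_kernel_eq_iff[OF PD(1) PD(1)] P by (simp add: ergodic_laws_def)
  }
qed

end
section \<open>Averages over the compact subgroups\<close>

lemma space_borel_of_topology: "space (borel_of_topology \<tau>) = topspace \<tau>"
  by (simp add: borel_of_topology_def space_measure_of_conv)

lemma sets_borel_of_topology: "sets (borel_of_topology \<tau>) = sigma_sets (topspace \<tau>) {U. openin \<tau> U}"
  using openin_subset unfolding borel_of_topology_def by (intro sets_measure_of) auto

lemma openin_in_sets_borel: "openin \<tau> U \<Longrightarrow> U \<in> sets (borel_of_topology \<tau>)"
  by (simp add: sets_borel_of_topology)

lemma closedin_in_sets_borel: "closedin \<tau> C \<Longrightarrow> C \<in> sets (borel_of_topology \<tau>)"
  using sets.compl_sets[OF openin_in_sets_borel[of \<tau> "topspace \<tau> - C"]] closedin_subset[of \<tau> C]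
  by (auto simp: space_borel_of_topology closedin_def double_diff)

lemma measurable_borel_of_topology:
  assumes "continuous_map \<tau> \<sigma> \<phi>" shows "\<phi> \<in> measurable (borel_of_topology \<tau>) (borel_of_topology \<sigma>)"
proof (rule measurable_sigma_sets)
  show "sets (borel_of_topology \<sigma>) = sigma_sets (topspace \<sigma>) {U. openin \<sigma> U}" by (rule sets_borel_of_topology)
  show "{U. openin \<sigma> U} \<subseteq> Pow (topspace \<sigma>)" using openin_subset by auto
  show "\<phi> \<in> space (borel_of_topology \<tau>) \<rightarrow> topspace \<sigma>"
    using continuous_map_image_subset_topspace[OF assms] by (auto simp: space_borel_of_topology)
  fix U assume "U \<in> {U. openin \<sigma> U}"
  then have "openin \<tau> {x \<in> topspace \<tau>. \<phi> x \<in> U}"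
    using openin_continuous_map_preimage[OF assms] by simp
  moreover have "\<phi> -` U \<inter> space (borel_of_topology \<tau>) = {x \<in> topspace \<tau>. \<phi> x \<in> U}"
    by (auto simp: space_borel_of_topology)
  ultimately show "\<phi> -` U \<inter> space (borel_of_topology \<tau>) \<in> sets (borel_of_topology \<tau>)"
    by (simp add: openin_in_sets_borel)
qed

lemma sets_borel_of_subtopology:
  assumes "S \<subseteq> topspace \<tau>"
  shows "sets (borel_of_topology (subtopology \<tau> S)) = {A \<inter> S | A. A \<in> sets (borel_of_topology \<tau>)}"
proof -
  have "{(\<lambda>x. x) -` A \<inter> S |A. A \<in> sigma_sets (topspace \<tau>) {U. openin \<tau> U}}
      = sigma_sets S {(\<lambda>x. x) -` A \<inter> S |A. A \<in> {U. openin \<tau> U}}"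
    using assms by (intro sigma_sets_vimage_commute) auto
  moreover have "{(\<lambda>x. x) -` A \<inter> S |A. A \<in> {U. openin \<tau> U}} = {U. openin (subtopology \<tau> S) U}"
    by (auto simp: openin_subtopology)
  ultimately show ?thesis
    using assms by (simp add: sets_borel_of_topology Int_absorb1)
qed

context inductively_compact_group
begin

lemma topspace_mono: "m \<le> n \<Longrightarrow> topspace (K m) \<subseteq> topspace (K n)"
  by (rule lift_Suc_mono_le[of "\<lambda>n. topspace (K n)"]) (rule topspace_Suc)

lemma subtopology_mono:
  assumes "m \<le> n" shows "K m = subtopology (K n) (topspace (K m))"
  using assms
proof (induction n rule: dec_induct)
  case (step n)
  have "subtopology (K n) (topspace (K m)) = subtopology (K (Suc n)) (topspace (K n) \<inter> topspace (K m))"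
    by (subst subtopology_Suc[of n]) (simp add: subtopology_subtopology)
  also have "topspace (K n) \<inter> topspace (K m) = topspace (K m)"
    using topspace_mono[OF step(1)] by blast
  finally show ?case using step by simp
qed simp

text \<open>A Borel set of \<open>K m\<close> must meet \<open>K n\<close> in a Borel set. For
  \<open>m \<le> n\<close> this holds since \<open>K m\<close> is compact, hence closed in
  \<open>K n\<close>; otherwise the trace on a subspace is Borel there.\<close>

lemma measurable_inductive_limit_borel:
  "(\<lambda>g. g) \<in> measurable (borel_of_topology (K n)) (inductive_limit_borel K)"
  unfolding inductive_limit_borel_def
proof (rule measurable_measure_of)
  show "(\<Union>n. sets (borel_of_topology (K n))) \<subseteq> Pow (\<Union>n. topspace (K n))"
    using sets.sets_into_space by (force simp: space_borel_of_topology)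
  show "(\<lambda>g. g) \<in> space (borel_of_topology (K n)) \<rightarrow> (\<Union>n. topspace (K n))"
    by (auto simp: space_borel_of_topology)
  fix A assume "A \<in> (\<Union>n. sets (borel_of_topology (K n)))"
  then obtain m where A: "A \<in> sets (borel_of_topology (K m))" by blast
  have "A \<inter> topspace (K n) \<in> sets (borel_of_topology (K n))"
  proof (cases "m \<le> n")
    case True
    note sub = topspace_mono[OF True]
    obtain A' where A': "A' \<in> sets (borel_of_topology (K n))" "A = A' \<inter> topspace (K m)"
      using A sets_borel_of_subtopology[OF sub] subtopology_mono[OF True] by auto
    have "compactin (K n) (topspace (K m))"
      using compact_space[of m] subtopology_mono[OF True] sub
      by (metis compact_space_subtopology compactin_subspace compact_space_def topspace_subtopology_subset)
    then have "closedin (K n) (topspace (K m))"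
      using metrizable_space[of n] compactin_imp_closedin metrizable_imp_Hausdorff_space by blast
    then have "A \<in> sets (borel_of_topology (K n))"
      using A' closedin_in_sets_borel by auto
    moreover have "A \<inter> topspace (K n) = A" using A' sub by auto
    ultimately show ?thesis by simp
  next
    case False
    then have nm: "n \<le> m" by simp
    show ?thesis
      using A sets_borel_of_subtopology[OF topspace_mono[OF nm]] subtopology_mono[OF nm] by auto
  qed
  then show "(\<lambda>g. g) -` A \<inter> space (borel_of_topology (K n)) \<in> sets (borel_of_topology (K n))"
    by (simp add: space_borel_of_topology)
qed

definition haar :: "nat \<Rightarrow> 'g measure" where
  "haar n = (SOME \<mu>. sets \<mu> = sets (borel_of_topology (K n)) \<and> space \<mu> = topspace (K n) \<and> prob_space \<mu> \<and>
    (\<forall>g\<in>topspace (K n). distr \<mu> \<mu> (\<lambda>x. g \<otimes> x) = \<mu> \<and> distr \<mu> \<mu> (\<lambda>x. x \<otimes> g) = \<mu>) \<and>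
    distr \<mu> \<mu> (\<lambda>x. inv x) = \<mu>)"

lemma haar_properties:
  "sets (haar n) = sets (borel_of_topology (K n)) \<and> space (haar n) = topspace (K n) \<and> prob_space (haar n) \<and>
    (\<forall>g\<in>topspace (K n). distr (haar n) (haar n) (\<lambda>x. g \<otimes> x) = haar n \<and> distr (haar n) (haar n) (\<lambda>x. x \<otimes> g) = haar n) \<and>
    distr (haar n) (haar n) (\<lambda>x. inv x) = haar n"
  unfolding haar_def
proof (rule someI_ex)
  show "\<exists>\<mu>. sets \<mu> = sets (borel_of_topology (K n)) \<and> space \<mu> = topspace (K n) \<and> prob_space \<mu> \<and>
    (\<forall>g\<in>topspace (K n). distr \<mu> \<mu> (\<lambda>x. g \<otimes> x) = \<mu> \<and> distr \<mu> \<mu> (\<lambda>x. x \<otimes> g) = \<mu>) \<and>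
    distr \<mu> \<mu> (\<lambda>x. inv x) = \<mu>"
    by (rule haar_measure_exists[OF subgroup_topspace continuous_map_mult continuous_map_inv compact_space metrizable_space])
       blast
qed

lemma sets_haar [measurable_cong]: "sets (haar n) = sets (borel_of_topology (K n))"
  and space_haar: "space (haar n) = topspace (K n)"
  and prob_space_haar: "prob_space (haar n)"
  using haar_properties by auto

lemma continuous_map_translation:
  assumes "g \<in> topspace (K n)"
  shows "continuous_map (K n) (K n) (\<lambda>x. g \<otimes> x)" "continuous_map (K n) (K n) (\<lambda>x. x \<otimes> g)"
proof -
  have c: "continuous_map (K n) (K n) (\<lambda>x. g)" using assms by simp
  have i: "continuous_map (K n) (K n) (\<lambda>x. x)" by simp
  show "continuous_map (K n) (K n) (\<lambda>x. g \<otimes> x)" "continuous_map (K n) (K n) (\<lambda>x. x \<otimes> g)"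
    using continuous_map_compose[OF continuous_map_pairedI[OF c i] continuous_map_mult[of n]]
      continuous_map_compose[OF continuous_map_pairedI[OF i c] continuous_map_mult[of n]]
    by (simp_all add: o_def)
qed

lemma nn_integral_haar_invariant:
  assumes h: "h \<in> borel_measurable (haar n)"
  shows "g \<in> topspace (K n) \<Longrightarrow> (\<integral>\<^sup>+x. h (g \<otimes> x) \<partial>haar n) = (\<integral>\<^sup>+x. h x \<partial>haar n)"
    and "g \<in> topspace (K n) \<Longrightarrow> (\<integral>\<^sup>+x. h (x \<otimes> g) \<partial>haar n) = (\<integral>\<^sup>+x. h x \<partial>haar n)"
    and "(\<integral>\<^sup>+x. h (inv x) \<partial>haar n) = (\<integral>\<^sup>+x. h x \<partial>haar n)"
proof -
  have *: "(\<integral>\<^sup>+x. h (\<phi> x) \<partial>haar n) = (\<integral>\<^sup>+x. h x \<partial>haar n)"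
    if c: "continuous_map (K n) (K n) \<phi>" and d: "distr (haar n) (haar n) \<phi> = haar n" for \<phi>
  proof -
    have "\<phi> \<in> measurable (haar n) (haar n)"
      using measurable_borel_of_topology[OF c] by (simp cong: measurable_cong_sets add: sets_haar)
    then have "(\<integral>\<^sup>+x. h x \<partial>distr (haar n) (haar n) \<phi>) = (\<integral>\<^sup>+x. h (\<phi> x) \<partial>haar n)"
      using h by (intro nn_integral_distr) simp_all
    then show ?thesis by (simp add: d)
  qed
  show "g \<in> topspace (K n) \<Longrightarrow> (\<integral>\<^sup>+x. h (g \<otimes> x) \<partial>haar n) = (\<integral>\<^sup>+x. h x \<partial>haar n)"
    "g \<in> topspace (K n) \<Longrightarrow> (\<integral>\<^sup>+x. h (x \<otimes> g) \<partial>haar n) = (\<integral>\<^sup>+x. h x \<partial>haar n)"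
    "(\<integral>\<^sup>+x. h (inv x) \<partial>haar n) = (\<integral>\<^sup>+x. h x \<partial>haar n)"
    using haar_properties[of n] continuous_map_translation continuous_map_inv by (auto intro!: *)
qed

end

section \<open>Weighted orbit averages of a measurable action\<close>

locale compact_averages = inductively_compact_group G K + coded_space X code
  for G :: "('g, 'm) monoid_scheme" (structure) and K :: "nat \<Rightarrow> 'g topology"
    and X :: "'a measure" and code :: "'a \<Rightarrow> real" +
  fixes T :: "'g \<Rightarrow> 'a \<Rightarrow> 'a" and f :: "'a \<Rightarrow> real"
  assumes action: "measurable_action G K X T"
    and f_pos: "x \<in> space X \<Longrightarrow> 0 < f x"
    and f_cont: "fibrewise_continuous K X T f"
begin

lemma group_action: "group_action G (space X) T"
  using action by (simp add: measurable_action_def)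

lemma topspace_carrier: "g \<in> topspace (K n) \<Longrightarrow> g \<in> carrier G"
  using carrier_eq_Union by auto

lemma act_closed: "g \<in> carrier G \<Longrightarrow> x \<in> space X \<Longrightarrow> T g x \<in> space X"
  by (rule group_action.element_image[OF group_action]) simp_all

lemma act_mult: "g \<in> carrier G \<Longrightarrow> h \<in> carrier G \<Longrightarrow> x \<in> space X \<Longrightarrow> T g (T h x) = T (g \<otimes> h) x"
  by (rule group_action.composition_rule[OF group_action, symmetric])

lemma act_one: "x \<in> space X \<Longrightarrow> T \<one> x = x"
  using group_action.id_eq_one[OF group_action] by (metis restrict_apply')

lemma act_inv: "g \<in> carrier G \<Longrightarrow> x \<in> space X \<Longrightarrow> T (inv g) (T g x) = x" "g \<in> carrier G \<Longrightarrow> x \<in> space X \<Longrightarrow> T g (T (inv g) x) = x"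
  by (simp_all add: act_mult act_one)

lemma measurable_f [measurable]: "f \<in> borel_measurable X"
  using f_cont by (simp add: fibrewise_continuous_def)

lemma measurable_act_pair: "(\<lambda>(g, x). T g x) \<in> measurable (haar n \<Otimes>\<^sub>M X) X"
proof -
  have "(\<lambda>p. (fst p, snd p)) \<in> measurable (haar n \<Otimes>\<^sub>M X) (inductive_limit_borel K \<Otimes>\<^sub>M X)"
    using measurable_inductive_limit_borel[of n]
    by (intro measurable_Pair measurable_snd measurable_compose[OF measurable_fst])
       (simp cong: measurable_cong_sets add: sets_haar)
  moreover have "(\<lambda>(g, x). T g x) \<in> measurable (inductive_limit_borel K \<Otimes>\<^sub>M X) X"
    using action by (simp add: measurable_action_def)
  ultimately have "(\<lambda>p. (\<lambda>(g, x). T g x) (fst p, snd p)) \<in> measurable (haar n \<Otimes>\<^sub>M X) X"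
    by (rule measurable_compose)
  then show ?thesis by (simp only: prod.collapse)
qed

lemma measurable_act_fst: "x \<in> space X \<Longrightarrow> (\<lambda>g. T g x) \<in> measurable (haar n) X"
  using measurable_Pair1[OF measurable_act_pair] by simp

lemma measurable_act: "g \<in> carrier G \<Longrightarrow> T g \<in> measurable X X"
proof -
  assume "g \<in> carrier G"
  then obtain n where "g \<in> topspace (K n)" using carrier_eq_Union by auto
  then show ?thesis using measurable_Pair2[OF measurable_act_pair, of g n] by (simp add: space_haar)
qed

lemma measurable_act_swap:
  assumes "u \<in> borel_measurable X" shows "(\<lambda>(x, g). u (T g x)) \<in> borel_measurable (X \<Otimes>\<^sub>M haar n)"
  using measurable_compose[OF measurable_pair_swap'[of X "haar n"] measurable_compose[OF measurable_act_pair assms]]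
  by (simp add: split_beta)

lemma measurable_orbit_integral:
  assumes "u \<in> borel_measurable X" shows "(\<lambda>x. \<integral>\<^sup>+g. u (T g x) \<partial>haar n) \<in> borel_measurable X"
proof -
  interpret prob_space "haar n" by (rule prob_space_haar)
  show ?thesis using measurable_act_swap[OF assms] by (rule borel_measurable_nn_integral)
qed

text \<open>Right invariance of Haar measure: the integral does not depend on the base point of the
  orbit. This makes \<open>weight n\<close> and \<open>average n\<close> constant along it.\<close>

lemma orbit_integral_right:
  assumes u: "u \<in> borel_measurable X" and h: "h \<in> topspace (K n)" and x: "x \<in> space X"
  shows "(\<integral>\<^sup>+g. u (T g (T h x)) \<partial>haar n) = (\<integral>\<^sup>+g. u (T g x) \<partial>haar n)"
proof -
  have "(\<integral>\<^sup>+g. u (T g (T h x)) \<partial>haar n) = (\<integral>\<^sup>+g. u (T (g \<otimes> h) x) \<partial>haar n)"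
    using h x by (intro nn_integral_cong) (simp add: space_haar act_mult topspace_carrier)
  also have "\<dots> = (\<integral>\<^sup>+g. u (T g x) \<partial>haar n)"
    using measurable_compose[OF measurable_act_fst[OF x] u] h by (rule nn_integral_haar_invariant(2))
  finally show ?thesis .
qed

text \<open>Left invariance concerns a translation after the averaging; this is what makes the
  measure belonging to a stationary law invariant.\<close>

lemma orbit_integral_left:
  assumes u: "u \<in> borel_measurable X" and h: "h \<in> topspace (K n)" and x: "x \<in> space X"
  shows "(\<integral>\<^sup>+g. u (T h (T g x)) \<partial>haar n) = (\<integral>\<^sup>+g. u (T g x) \<partial>haar n)"
proof -
  have "(\<integral>\<^sup>+g. u (T h (T g x)) \<partial>haar n) = (\<integral>\<^sup>+g. u (T (h \<otimes> g) x) \<partial>haar n)"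
    using h x by (intro nn_integral_cong) (simp add: space_haar act_mult topspace_carrier)
  also have "\<dots> = (\<integral>\<^sup>+g. u (T g x) \<partial>haar n)"
    using measurable_compose[OF measurable_act_fst[OF x] u] h by (rule nn_integral_haar_invariant(1))
  finally show ?thesis .
qed

definition weight :: "nat \<Rightarrow> 'a \<Rightarrow> ennreal" where
  "weight n x = (\<integral>\<^sup>+g. ennreal (f (T g x)) \<partial>haar n)"

lemma measurable_weight [measurable]: "weight n \<in> borel_measurable X"
  unfolding weight_def using measurable_orbit_integral[of "\<lambda>x. ennreal (f x)" n] by simp

text \<open>Fibrewise continuity acts here: \<open>f\<close> is continuous along the compact group
  \<open>K n\<close>, hence bounded on the orbit, and Haar measure is a probability.\<close>

lemma weight_finite:
  assumes x: "x \<in> space X" shows "weight n x < \<infinity>"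
proof -
  interpret prob_space "haar n" by (rule prob_space_haar)
  have "continuous_map (K n) euclideanreal (\<lambda>g. f (T g x))"
    using f_cont x by (simp add: fibrewise_continuous_def continuous_map_inductive_limit_topology)
  then have "compactin euclideanreal ((\<lambda>g. f (T g x)) ` topspace (K n))"
    using compact_space[of n] by (intro image_compactin) (simp_all add: compact_space_def)
  then have "bounded ((\<lambda>g. f (T g x)) ` topspace (K n))"
    by (simp add: compact_imp_bounded)
  then obtain c where c: "\<And>g. g \<in> topspace (K n) \<Longrightarrow> f (T g x) \<le> c"
    unfolding bounded_real by (metis abs_le_D1 imageI)
  have "weight n x \<le> (\<integral>\<^sup>+g. ennreal c \<partial>haar n)"
    unfolding weight_def using c by (intro nn_integral_mono ennreal_leI) (simp add: space_haar)
  also have "\<dots> < \<infinity>" by (simp add: emeasure_space_1)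
  finally show ?thesis .
qed

lemma weight_pos:
  assumes x: "x \<in> space X" shows "0 < weight n x"
proof -
  interpret prob_space "haar n" by (rule prob_space_haar)
  have m: "(\<lambda>g. ennreal (f (T g x))) \<in> borel_measurable (haar n)"
    using measurable_compose[OF measurable_act_fst[OF x] measurable_f] by simp
  have "\<not> (AE g in haar n. ennreal (f (T g x)) = 0)"
  proof
    assume "AE g in haar n. ennreal (f (T g x)) = 0"
    moreover have "0 < f (T g x)" if "g \<in> space (haar n)" for g
      using that x by (intro f_pos act_closed topspace_carrier[of g n]) (simp_all add: space_haar)
    then have "AE g in haar n. 0 < f (T g x)" by (rule AE_I2)
    ultimately have "AE g in haar n. False"
      by eventually_elim (simp add: ennreal_eq_0_iff)
    then show False by simp
  qed
  then have "weight n x \<noteq> 0"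
    unfolding weight_def using m by (simp add: nn_integral_0_iff_AE)
  then show ?thesis by (simp add: zero_less_iff_neq_zero)
qed

lemma weight_invariant: "h \<in> topspace (K n) \<Longrightarrow> x \<in> space X \<Longrightarrow> weight n (T h x) = weight n x"
  unfolding weight_def by (rule orbit_integral_right[of "\<lambda>x. ennreal (f x)"]) simp_all

text \<open>Conditional distribution of a point of an orbit of \<open>K n\<close> under \<open>f\<close> times an invariant measure.\<close>

definition average :: "nat \<Rightarrow> 'a \<Rightarrow> 'a measure" where
  "average n x = distr (density (haar n) (\<lambda>g. ennreal (f (T g x)) / weight n x)) X (\<lambda>g. T g x)"

lemma sets_average: "sets (average n x) = sets X" and space_average: "space (average n x) = space X"
  by (simp_all add: average_def)

lemma nn_integral_average:
  fixes h :: "'a \<Rightarrow> ennreal"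
  assumes x: "x \<in> space X" and h: "h \<in> borel_measurable X"
  shows "(\<integral>\<^sup>+y. h y \<partial>average n x) = (\<integral>\<^sup>+g. ennreal (f (T g x)) * h (T g x) \<partial>haar n) / weight n x"
proof -
  note [measurable] = measurable_act_fst[OF x, of n] h
  have [measurable]: "(\<lambda>g. h (T g x)) \<in> borel_measurable (haar n)" "(\<lambda>g. f (T g x)) \<in> borel_measurable (haar n)"
    by (rule measurable_compose[OF measurable_act_fst[OF x]]; measurable)+
  have "(\<integral>\<^sup>+y. h y \<partial>average n x) = (\<integral>\<^sup>+g. h (T g x) \<partial>density (haar n) (\<lambda>g. ennreal (f (T g x)) / weight n x))"
    unfolding average_def by (intro nn_integral_distr) simp_all
  also have "\<dots> = (\<integral>\<^sup>+g. ennreal (f (T g x)) / weight n x * h (T g x) \<partial>haar n)"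
    by (intro nn_integral_density) simp_all
  also have "\<dots> = (\<integral>\<^sup>+g. ennreal (f (T g x)) * h (T g x) / weight n x \<partial>haar n)"
    by (intro nn_integral_cong) (simp add: divide_ennreal_def mult_ac)
  also have "\<dots> = (\<integral>\<^sup>+g. ennreal (f (T g x)) * h (T g x) \<partial>haar n) / weight n x"
    by (intro nn_integral_divide) simp
  finally show ?thesis .
qed

lemma emeasure_average:
  assumes x: "x \<in> space X" and E: "E \<in> sets X"
  shows "emeasure (average n x) E = (\<integral>\<^sup>+g. ennreal (f (T g x)) * indicator E (T g x) \<partial>haar n) / weight n x"
  using nn_integral_average[OF x, of "indicator E" n] E by (simp add: sets_average)

lemma prob_space_average: "x \<in> space X \<Longrightarrow> prob_space (average n x)"
proof (rule prob_spaceI)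
  assume x: "x \<in> space X"
  have "(\<integral>\<^sup>+g. ennreal (f (T g x)) * indicator (space X) (T g x) \<partial>haar n) = weight n x"
    unfolding weight_def using x
    by (intro nn_integral_cong) (simp add: space_haar act_closed topspace_carrier)
  then show "emeasure (average n x) (space (average n x)) = 1"
    using weight_pos[OF x, of n] weight_finite[OF x, of n]
    by (simp add: emeasure_average[OF x] space_average ennreal_divide_self)
qed

lemma measurable_average_X: "average n \<in> measurable X (prob_algebra X)"
proof (rule measurable_prob_algebraI)
  show "prob_space (average n x)" if "x \<in> space X" for x by (rule prob_space_average[OF that])
  show "average n \<in> measurable X (subprob_algebra X)"
  proof (rule measurable_subprob_algebra)
    fix E assume E [measurable]: "E \<in> sets X"
    have "(\<lambda>x. \<integral>\<^sup>+g. ennreal (f (T g x)) * indicator E (T g x) \<partial>haar n) \<in> borel_measurable X"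
      using measurable_orbit_integral[of "\<lambda>x. ennreal (f x) * indicator E x" n] by simp
    then have "(\<lambda>x. (\<integral>\<^sup>+g. ennreal (f (T g x)) * indicator E (T g x) \<partial>haar n) / weight n x) \<in> borel_measurable X"
      by measurable
    then show "(\<lambda>x. emeasure (average n x) E) \<in> borel_measurable X"
      by (simp add: emeasure_average[OF _ E] cong: measurable_cong)
  qed (auto intro: prob_space_imp_subprob_space prob_space_average simp: sets_average)
qed

lemma average_invariant:
  assumes h: "h \<in> topspace (K n)" and x: "x \<in> space X"
  shows "average n (T h x) = average n x"
proof (rule measure_eqI)
  fix E assume "E \<in> sets (average n (T h x))"
  then have E [measurable]: "E \<in> sets X" by (simp add: sets_average)
  show "emeasure (average n (T h x)) E = emeasure (average n x) E"
    using orbit_integral_right[of "\<lambda>x. ennreal (f x) * indicator E x", OF _ h x] weight_invariant[OF h x]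
    by (simp add: emeasure_average[OF _ E] x act_closed topspace_carrier[OF h])
qed (simp add: sets_average)

text \<open>Invariance is strict and not merely up to null sets, so that the kernels are proper at
  every point and the intersection of all these algebras consists of the sets tested by
  \<open>ergodic\<close>. The generating family is already a sigma-algebra.\<close>

definition inv_algebra :: "nat \<Rightarrow> 'a measure" where
  "inv_algebra n = sigma (space X) {A\<in>sets X. \<forall>g\<in>topspace (K n). \<forall>x\<in>space X. T g x \<in> A \<longleftrightarrow> x \<in> A}"

lemma sets_inv_algebra: "sets (inv_algebra n) = {A\<in>sets X. \<forall>g\<in>topspace (K n). \<forall>x\<in>space X. T g x \<in> A \<longleftrightarrow> x \<in> A}"
proof -
  have "sigma_algebra (space X) {A\<in>sets X. \<forall>g\<in>topspace (K n). \<forall>x\<in>space X. T g x \<in> A \<longleftrightarrow> x \<in> A}"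
    unfolding sigma_algebra_iff2
  proof (intro conjI ballI allI impI)
    let ?I = "{A\<in>sets X. \<forall>g\<in>topspace (K n). \<forall>x\<in>space X. T g x \<in> A \<longleftrightarrow> x \<in> A}"
    show "?I \<subseteq> Pow (space X)" using sets.space_closed[of X] by blast
    show "{} \<in> ?I" by simp
    show "space X - A \<in> ?I" if "A \<in> ?I" for A
      using that act_closed[OF topspace_carrier] sets.compl_sets[of A X] by simp
    fix A :: "nat \<Rightarrow> 'a set"
    assume "range A \<subseteq> ?I"
    note A = range_subsetD[OF this]
    then have "(\<Union>i. A i) \<in> sets X" by (intro sets.countable_UN) auto
    then show "(\<Union>i. A i) \<in> ?I" using A by simp
  qed
  then show ?thesis
    unfolding inv_algebra_def by (rule sigma_algebra.sets_measure_of_eq)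
qed

lemma space_inv_algebra: "space (inv_algebra n) = space X"
  by (simp add: inv_algebra_def space_measure_of_conv)

lemma measurable_inv_algebraI:
  assumes "\<phi> \<in> measurable X N" and "\<And>g x. g \<in> topspace (K n) \<Longrightarrow> x \<in> space X \<Longrightarrow> \<phi> (T g x) = \<phi> x"
  shows "\<phi> \<in> measurable (inv_algebra n) N"
  using measurable_sets[OF assms(1)] measurable_space[OF assms(1)] assms(2) act_closed topspace_carrier
  by (intro measurableI) (auto simp: space_inv_algebra sets_inv_algebra)

text \<open>Properness: the indicator of a \<open>K n\<close>-invariant set is constant along the
  orbit, so the numerator of the average is \<open>weight n x\<close> times its value at
  \<open>x\<close>, and the weight is neither zero nor infinite.\<close>

sublocale decreasing_kernels X code average inv_algebra
proof
  show "subalgebra X (inv_algebra n)" for n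
    by (auto simp: subalgebra_def space_inv_algebra sets_inv_algebra)
  show "sets (inv_algebra n) \<subseteq> sets (inv_algebra m)" if "m \<le> n" for m n
    using topspace_mono[OF that] by (auto simp: sets_inv_algebra)
  show "average n \<in> measurable (inv_algebra n) (prob_algebra X)" for n
    by (intro measurable_inv_algebraI measurable_average_X average_invariant)
  fix x B n assume x: "x \<in> space X" and B: "B \<in> sets (inv_algebra n)"
  have "(\<integral>\<^sup>+g. ennreal (f (T g x)) * indicator B (T g x) \<partial>haar n) = (\<integral>\<^sup>+g. ennreal (f (T g x)) * indicator B x \<partial>haar n)"
    using x B by (intro nn_integral_cong) (simp add: space_haar sets_inv_algebra indicator_def)
  also have "\<dots> = weight n x * indicator B x"
    unfolding weight_def using measurable_compose[OF measurable_act_fst[OF x] measurable_f, of n]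
    by (intro nn_integral_multc) simp
  finally show "emeasure (average n x) B = indicator B x"
    using B weight_pos[OF x, of n] weight_finite[OF x, of n]
    by (simp add: emeasure_average[OF x] sets_inv_algebra indicator_def ennreal_divide_self)
qed

text \<open>\<open>G\<close> is the union of the \<open>K n\<close>, so the tail events are the sets
  invariant under all of \<open>G\<close>; applying inverses converts pointwise invariance into
  invariance of images.\<close>

lemma sets_tail_iff: "B \<in> sets tail \<longleftrightarrow> B \<in> sets X \<and> (\<forall>g\<in>carrier G. T g ` B = B)"
proof
  assume "B \<in> sets tail"
  then have B: "B \<in> sets X" and inv: "\<And>g x. g \<in> carrier G \<Longrightarrow> x \<in> space X \<Longrightarrow> T g x \<in> B \<longleftrightarrow> x \<in> B"
    unfolding sets_tail sets_inv_algebra carrier_eq_Union by auto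
  have BX: "B \<subseteq> space X" using B by (rule sets.sets_into_space)
  have "T g ` B = B" if g: "g \<in> carrier G" for g
  proof (intro equalityI subsetI)
    fix y assume "y \<in> B"
    then show "y \<in> T g ` B"
      using BX g inv[of "inv g" y] act_inv(2)[of g y] by (intro image_eqI[of _ _ "T (inv g) y"]) auto
  qed (use BX inv g in auto)
  then show "B \<in> sets X \<and> (\<forall>g\<in>carrier G. T g ` B = B)" using B by blast
next
  assume B: "B \<in> sets X \<and> (\<forall>g\<in>carrier G. T g ` B = B)"
  have "T g x \<in> B \<longleftrightarrow> x \<in> B" if g: "g \<in> carrier G" and x: "x \<in> space X" for g x
  proof
    assume "T g x \<in> B"
    then have "T (inv g) (T g x) \<in> T (inv g) ` B" by (rule imageI)
    then show "x \<in> B" using B g x act_inv(1)[OF g x] by simp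
  next
    assume "x \<in> B"
    then have "T g x \<in> T g ` B" by (rule imageI)
    then show "T g x \<in> B" using B g by simp
  qed
  then show "B \<in> sets tail"
    using B topspace_carrier by (auto simp: sets_tail sets_inv_algebra)
qed

end
section \<open>Invariant measures and stationary laws\<close>

context compact_averages
begin

definition to_prob :: "'a measure \<Rightarrow> 'a measure" where "to_prob \<nu> = density \<nu> (\<lambda>x. ennreal (f x))"

definition of_prob :: "'a measure \<Rightarrow> 'a measure" where "of_prob P = density P (\<lambda>x. ennreal (1 / f x))"

lemma sets_to_prob [simp]: "sets (to_prob \<nu>) = sets \<nu>" and space_to_prob [simp]: "space (to_prob \<nu>) = space \<nu>"
  and sets_of_prob [simp]: "sets (of_prob P) = sets P" and space_of_prob [simp]: "space (of_prob P) = space P"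
  by (simp_all add: to_prob_def of_prob_def)

lemma f_mult_inverse: "x \<in> space X \<Longrightarrow> ennreal (f x) * ennreal (1 / f x) = 1"
  using f_pos[of x] by (simp flip: ennreal_mult add: ennreal_1)

lemma nn_integral_to_prob:
  assumes "sets \<nu> = sets X" "h \<in> borel_measurable X"
  shows "(\<integral>\<^sup>+x. h x \<partial>to_prob \<nu>) = (\<integral>\<^sup>+x. ennreal (f x) * h x \<partial>\<nu>)"
  unfolding to_prob_def using assms by (intro nn_integral_density) (simp_all cong: measurable_cong_sets)

lemma nn_integral_of_prob:
  assumes "sets P = sets X" "h \<in> borel_measurable X"
  shows "(\<integral>\<^sup>+x. h x \<partial>of_prob P) = (\<integral>\<^sup>+x. ennreal (1 / f x) * h x \<partial>P)"
  unfolding of_prob_def using assms by (intro nn_integral_density) (simp_all cong: measurable_cong_sets)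

lemma to_of_prob:
  assumes P: "sets P = sets X" shows "to_prob (of_prob P) = P"
proof -
  have [measurable]: "f \<in> borel_measurable P" using P by (simp cong: measurable_cong_sets)
  have "to_prob (of_prob P) = density P (\<lambda>x. ennreal (1 / f x) * ennreal (f x))"
    unfolding to_prob_def of_prob_def by (intro density_density_eq) simp_all
  also have "\<dots> = density P (\<lambda>_. 1)"
    using f_mult_inverse sets_eq_imp_space_eq[OF P]
    by (intro density_cong AE_I2) (simp_all add: mult.commute)
  finally show ?thesis by (simp add: density_1)
qed

lemma of_to_prob:
  assumes P: "sets \<nu> = sets X" shows "of_prob (to_prob \<nu>) = \<nu>"
proof -
  have [measurable]: "f \<in> borel_measurable \<nu>" using P by (simp cong: measurable_cong_sets)
  have "of_prob (to_prob \<nu>) = density \<nu> (\<lambda>x. ennreal (f x) * ennreal (1 / f x))"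
    unfolding to_prob_def of_prob_def by (intro density_density_eq) simp_all
  also have "\<dots> = density \<nu> (\<lambda>_. 1)"
    using f_mult_inverse sets_eq_imp_space_eq[OF P] by (intro density_cong AE_I2) simp_all
  finally show ?thesis by (simp add: density_1)
qed

text \<open>The density \<open>1 / f\<close> is finite everywhere. For this reason sigma-finiteness
  never has to be checked separately for measures built from laws.\<close>

lemma sigma_finite_of_prob:
  assumes P: "P \<in> space (prob_algebra X)" shows "sigma_finite_measure (of_prob P)"
proof -
  note PD = prob_algebraD[OF P]
  interpret prob_space P by (rule PD)
  have "(\<lambda>x. ennreal (1 / f x)) \<in> borel_measurable P"
    using PD by (simp cong: measurable_cong_sets)
  then show ?thesis unfolding of_prob_def by (subst sigma_finite_iff_density_finite) simp_all
qed

lemma prob_to_prob_iff: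
  assumes \<nu>: "sets \<nu> = sets X"
  shows "to_prob \<nu> \<in> space (prob_algebra X) \<longleftrightarrow> (\<integral>\<^sup>+x. ennreal (f x) \<partial>\<nu>) = 1"
proof -
  have "emeasure (to_prob \<nu>) (space (to_prob \<nu>)) = (\<integral>\<^sup>+x. 1 \<partial>to_prob \<nu>)" by simp
  also have "\<dots> = (\<integral>\<^sup>+x. ennreal (f x) \<partial>\<nu>)"
    using nn_integral_to_prob[OF \<nu>, of "\<lambda>_. 1"] by simp
  finally have "emeasure (to_prob \<nu>) (space (to_prob \<nu>)) = (\<integral>\<^sup>+x. ennreal (f x) \<partial>\<nu>)" .
  then show ?thesis
    using \<nu> prob_space.emeasure_space_1[of "to_prob \<nu>"] prob_spaceI[of "to_prob \<nu>"]
    by (auto simp: space_prob_algebra)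
qed

definition invariant :: "'a measure \<Rightarrow> bool" where
  "invariant \<nu> \<longleftrightarrow> (\<forall>g\<in>carrier G. distr \<nu> X (T g) = \<nu>)"

lemma nn_integral_invariant:
  assumes \<nu>: "sets \<nu> = sets X" "invariant \<nu>" and g: "g \<in> carrier G" and h: "h \<in> borel_measurable X"
  shows "(\<integral>\<^sup>+x. h (T g x) \<partial>\<nu>) = (\<integral>\<^sup>+x. h x \<partial>\<nu>)"
proof -
  have "(\<integral>\<^sup>+x. h x \<partial>distr \<nu> X (T g)) = (\<integral>\<^sup>+x. h (T g x) \<partial>\<nu>)"
    using measurable_act[OF g] \<nu>(1) h by (intro nn_integral_distr) (simp_all cong: measurable_cong_sets)
  then show ?thesis using \<nu>(2) g by (simp add: invariant_def)
qed

text \<open>Averaging under \<open>P\<close> weights the orbit by \<open>f\<close>, which cancels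
  the density \<open>1 / f\<close> and leaves an unweighted Haar integral. The index
  \<open>n\<close> is free.\<close>

lemma nn_integral_of_prob_stationary:
  assumes P: "P \<in> stationary" and u: "u \<in> borel_measurable X"
  shows "(\<integral>\<^sup>+x. u x \<partial>of_prob P) = (\<integral>\<^sup>+x. (\<integral>\<^sup>+g. u (T g x) \<partial>haar n) / weight n x \<partial>P)"
proof -
  note PD = stationaryD[OF P]
  have "(\<integral>\<^sup>+x. u x \<partial>of_prob P) = (\<integral>\<^sup>+x. ennreal (1 / f x) * u x \<partial>(P \<bind> average n))"
    by (simp add: nn_integral_of_prob[OF PD(2) u] PD(5))
  also have "\<dots> = (\<integral>\<^sup>+x. \<integral>\<^sup>+y. ennreal (1 / f y) * u y \<partial>average n x \<partial>P)"
    using u by (intro nn_integral_kernel PD measurable_average_X) measurable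
  also have "\<dots> = (\<integral>\<^sup>+x. (\<integral>\<^sup>+g. u (T g x) \<partial>haar n) / weight n x \<partial>P)"
  proof (rule nn_integral_cong)
    fix x assume "x \<in> space P"
    then have x: "x \<in> space X" by (simp add: PD)
    have "(\<lambda>y. ennreal (1 / f y) * u y) \<in> borel_measurable X" using u by measurable
    then have "(\<integral>\<^sup>+y. ennreal (1 / f y) * u y \<partial>average n x)
        = (\<integral>\<^sup>+g. ennreal (f (T g x)) * (ennreal (1 / f (T g x)) * u (T g x)) \<partial>haar n) / weight n x"
      by (rule nn_integral_average[OF x])
    also have "(\<integral>\<^sup>+g. ennreal (f (T g x)) * (ennreal (1 / f (T g x)) * u (T g x)) \<partial>haar n) = (\<integral>\<^sup>+g. u (T g x) \<partial>haar n)"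
    proof (rule nn_integral_cong)
      fix g assume "g \<in> space (haar n)"
      then have "T g x \<in> space X" using x by (simp add: space_haar act_closed topspace_carrier)
      then show "ennreal (f (T g x)) * (ennreal (1 / f (T g x)) * u (T g x)) = u (T g x)"
        by (simp add: f_mult_inverse flip: mult.assoc)
    qed
    finally show "(\<integral>\<^sup>+y. ennreal (1 / f y) * u y \<partial>average n x) = (\<integral>\<^sup>+g. u (T g x) \<partial>haar n) / weight n x" .
  qed
  finally show ?thesis .
qed

text \<open>For a given \<open>g\<close>, choose \<open>n\<close> with \<open>g\<close> in
  \<open>K n\<close>; the Haar integral over the orbit then absorbs the translation by
  \<open>g\<close>.\<close>

lemma stationary_imp_invariant:
  assumes P: "P \<in> stationary" shows "invariant (of_prob P)"
  unfolding invariant_def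
proof
  note PD = stationaryD[OF P]
  fix g assume g: "g \<in> carrier G"
  then obtain n where n: "g \<in> topspace (K n)" using carrier_eq_Union by auto
  show "distr (of_prob P) X (T g) = of_prob P"
  proof (rule measure_eqI)
    fix E assume "E \<in> sets (distr (of_prob P) X (T g))"
    then have E [measurable]: "E \<in> sets X" by simp
    have [measurable]: "T g \<in> measurable X X" by (rule measurable_act[OF g])
    have Tg: "T g \<in> measurable (of_prob P) X" using PD(2) by (simp cong: measurable_cong_sets)
    have "emeasure (distr (of_prob P) X (T g)) E = (\<integral>\<^sup>+x. indicator E x \<partial>distr (of_prob P) X (T g))"
      by simp
    also have "\<dots> = (\<integral>\<^sup>+x. indicator E (T g x) \<partial>of_prob P)"
      using Tg by (intro nn_integral_distr) simp_all
    also have "\<dots> = (\<integral>\<^sup>+x. (\<integral>\<^sup>+a. indicator E (T g (T a x)) \<partial>haar n) / weight n x \<partial>P)"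
      by (rule nn_integral_of_prob_stationary[OF P]) measurable
    also have "\<dots> = (\<integral>\<^sup>+x. (\<integral>\<^sup>+a. indicator E (T a x) \<partial>haar n) / weight n x \<partial>P)"
      using orbit_integral_left[of "indicator E", OF _ n] by (intro nn_integral_cong) (simp add: PD)
    also have "\<dots> = (\<integral>\<^sup>+x. indicator E x \<partial>of_prob P)"
      by (rule nn_integral_of_prob_stationary[OF P, symmetric]) measurable
    also have "\<dots> = emeasure (of_prob P) E"
      by (simp add: PD)
    finally show "emeasure (distr (of_prob P) X (T g)) E = emeasure (of_prob P) E" .
  qed (simp add: PD)
qed

text \<open>The operator of integration against \<open>average n\<close> is symmetric: Fubini's theorem and the invariance
  of Haar measure under inversion exchange the roles of \<open>x\<close> and \<open>T g x\<close>.\<close>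

lemma invariant_imp_stationary:
  assumes \<nu>: "sets \<nu> = sets X" "invariant \<nu>" "sigma_finite_measure \<nu>"
    and P: "to_prob \<nu> \<in> space (prob_algebra X)"
  shows "to_prob \<nu> \<in> stationary"
  unfolding stationary_iff_below[OF P]
proof (intro allI)
  fix n q
  interpret \<nu>: sigma_finite_measure \<nu> by fact
  interpret H: prob_space "haar n" by (rule prob_space_haar)
  interpret pair_sigma_finite \<nu> "haar n" ..
  define h where "h x = ennreal (f x) * indicator (below q) x" for x
  have [measurable]: "h \<in> borel_measurable X" unfolding h_def by measurable
  have sp: "space \<nu> = space X" by (rule sets_eq_imp_space_eq[OF \<nu>(1)])
  have pair: "measurable (\<nu> \<Otimes>\<^sub>M haar n) N = measurable (X \<Otimes>\<^sub>M haar n) N" for N :: "ennreal measure"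
    using \<nu>(1) by (intro measurable_cong_sets sets_pair_measure_cong) simp_all
  have act [measurable]: "(\<lambda>(x, g). u (T g x)) \<in> borel_measurable (X \<Otimes>\<^sub>M haar n)"
    if "u \<in> borel_measurable X" for u :: "'a \<Rightarrow> ennreal"
    by (rule measurable_act_swap[OF that])
  have inv: "(\<lambda>g. inv g) \<in> measurable (haar n) (haar n)"
    using measurable_borel_of_topology[OF continuous_map_inv[of n]] by (simp cong: measurable_cong_sets add: sets_haar)
  have act_i: "(\<lambda>(x, g). ennreal (f (T (inv g) x))) \<in> borel_measurable (X \<Otimes>\<^sub>M haar n)"
  proof -
    have "(\<lambda>p. (fst p, inv (snd p))) \<in> measurable (X \<Otimes>\<^sub>M haar n) (X \<Otimes>\<^sub>M haar n)"
      using inv by (intro measurable_Pair measurable_fst measurable_compose[OF measurable_snd])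
    from measurable_compose[OF this act[of "\<lambda>x. ennreal (f x)"]] show ?thesis
      by (simp add: split_beta)
  qed
  have m1: "(\<lambda>(x, g). ennreal (f x) / weight n x * h (T g x)) \<in> borel_measurable (X \<Otimes>\<^sub>M haar n)"
    using act[of h] by (simp add: split_beta)
  have m2: "(\<lambda>(x, g). h x / weight n x * ennreal (f (T (inv g) x))) \<in> borel_measurable (X \<Otimes>\<^sub>M haar n)"
    using act_i by (simp add: split_beta)
  have "(\<integral>\<^sup>+x. emeasure (average n x) (below q) \<partial>to_prob \<nu>) = (\<integral>\<^sup>+x. ennreal (f x) * emeasure (average n x) (below q) \<partial>\<nu>)"
    by (intro nn_integral_to_prob[OF \<nu>(1)] measurable_emeasure_kernel) simp
  also have "\<dots> = (\<integral>\<^sup>+x. \<integral>\<^sup>+g. ennreal (f x) / weight n x * h (T g x) \<partial>haar n \<partial>\<nu>)"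
  proof (rule nn_integral_cong)
    fix x assume "x \<in> space \<nu>"
    then have x: "x \<in> space X" by (simp add: sp)
    have "(\<lambda>g. h (T g x)) \<in> borel_measurable (haar n)"
      by (rule measurable_compose[OF measurable_act_fst[OF x]]) simp
    then have "(\<integral>\<^sup>+g. ennreal (f x) / weight n x * h (T g x) \<partial>haar n) = ennreal (f x) / weight n x * (\<integral>\<^sup>+g. h (T g x) \<partial>haar n)"
      by (rule nn_integral_cmult)
    then show "ennreal (f x) * emeasure (average n x) (below q) = (\<integral>\<^sup>+g. ennreal (f x) / weight n x * h (T g x) \<partial>haar n)"
      by (simp add: emeasure_average[OF x] h_def divide_ennreal_def mult_ac)
  qed
  also have "\<dots> = (\<integral>\<^sup>+g. \<integral>\<^sup>+x. ennreal (f x) / weight n x * h (T g x) \<partial>\<nu> \<partial>haar n)"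
    using m1 unfolding pair[symmetric] by (rule Fubini'[symmetric])
  \<comment> \<open>Substituting \<open>T (inv g) x\<close> for \<open>x\<close> under the invariant
    \<open>\<nu>\<close> moves \<open>h\<close> back to \<open>x\<close> and \<open>f\<close> to
    \<open>T (inv g) x\<close>; the weight does not change, as \<open>inv g\<close> lies in
    \<open>K n\<close>.\<close>
  also have "\<dots> = (\<integral>\<^sup>+g. \<integral>\<^sup>+x. h x / weight n x * ennreal (f (T (inv g) x)) \<partial>\<nu> \<partial>haar n)"
  proof (rule nn_integral_cong)
    fix g assume "g \<in> space (haar n)"
    then have gn: "g \<in> topspace (K n)" by (simp add: space_haar)
    then have g: "g \<in> carrier G" and ign: "inv g \<in> topspace (K n)"
      using topspace_carrier subgroup.m_inv_closed[OF subgroup_topspace] by auto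
    have [measurable]: "T g \<in> measurable X X" by (rule measurable_act[OF g])
    have "(\<integral>\<^sup>+x. ennreal (f x) / weight n x * h (T g x) \<partial>\<nu>)
        = (\<integral>\<^sup>+x. ennreal (f (T (inv g) x)) / weight n (T (inv g) x) * h (T g (T (inv g) x)) \<partial>\<nu>)"
      using g by (intro nn_integral_invariant[OF \<nu>(1,2), symmetric]) (simp, measurable)
    also have "\<dots> = (\<integral>\<^sup>+x. h x / weight n x * ennreal (f (T (inv g) x)) \<partial>\<nu>)"
      using g ign by (intro nn_integral_cong) (simp add: sp act_inv weight_invariant divide_ennreal_def mult_ac)
    finally show "(\<integral>\<^sup>+x. ennreal (f x) / weight n x * h (T g x) \<partial>\<nu>) = (\<integral>\<^sup>+x. h x / weight n x * ennreal (f (T (inv g) x)) \<partial>\<nu>)" .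
  qed
  also have "\<dots> = (\<integral>\<^sup>+x. \<integral>\<^sup>+g. h x / weight n x * ennreal (f (T (inv g) x)) \<partial>haar n \<partial>\<nu>)"
    using m2 unfolding pair[symmetric] by (rule Fubini')
  \<comment> \<open>By inversion invariance the Haar integral of \<open>f (T (inv g) x)\<close> is
    \<open>weight n x\<close>, which cancels the normalisation.\<close>
  also have "\<dots> = (\<integral>\<^sup>+x. h x \<partial>\<nu>)"
  proof (rule nn_integral_cong)
    fix x assume "x \<in> space \<nu>"
    then have x: "x \<in> space X" by (simp add: sp)
    have fm: "(\<lambda>g. ennreal (f (T g x))) \<in> borel_measurable (haar n)"
      using measurable_compose[OF measurable_act_fst[OF x] measurable_f] by simp
    have "(\<integral>\<^sup>+g. h x / weight n x * ennreal (f (T (inv g) x)) \<partial>haar n) = h x / weight n x * (\<integral>\<^sup>+g. ennreal (f (T (inv g) x)) \<partial>haar n)"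
      by (rule nn_integral_cmult) (rule measurable_compose[OF inv fm])
    also have "(\<integral>\<^sup>+g. ennreal (f (T (inv g) x)) \<partial>haar n) = weight n x"
      unfolding weight_def using nn_integral_haar_invariant(3)[OF fm] .
    also have "h x / weight n x * weight n x = h x"
      using weight_pos[OF x, of n] weight_finite[OF x, of n]
      by (simp add: ennreal_divide_times ennreal_divide_self ennreal_times_divide[symmetric])
    finally show "(\<integral>\<^sup>+g. h x / weight n x * ennreal (f (T (inv g) x)) \<partial>haar n) = h x" .
  qed
  also have "\<dots> = emeasure (to_prob \<nu>) (below q)"
    using nn_integral_to_prob[OF \<nu>(1), of "indicator (below q)"] \<nu>(1) by (simp add: h_def)
  finally show "(\<integral>\<^sup>+x. emeasure (average n x) (below q) \<partial>to_prob \<nu>) = emeasure (to_prob \<nu>) (below q)" .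
qed

abbreviation "Inv \<equiv> invariant_measures G X T f"
abbreviation "Erg \<equiv> ergodic_measures G X T f"

text \<open>Positivity of \<open>f\<close> turns integrability with integral 1 into the statement
  that \<open>to_prob \<nu>\<close> has total mass 1. In the other direction sigma-finiteness and
  invariance are recovered from \<open>of_prob (to_prob \<nu>) = \<nu>\<close>.\<close>

lemma invariant_measures_iff:
  "\<nu> \<in> Inv \<longleftrightarrow> sets \<nu> = sets X \<and> to_prob \<nu> \<in> stationary"
proof
  assume \<nu>: "\<nu> \<in> Inv"
  then have s: "sets \<nu> = sets X" "sigma_finite_measure \<nu>" "invariant \<nu>" "integrable \<nu> f" "(\<integral>x. f x \<partial>\<nu>) = 1"
    by (auto simp: invariant_measures_def sigma_finite_measures_def invariant_def)
  have "(\<integral>\<^sup>+x. ennreal (f x) \<partial>\<nu>) = ennreal (\<integral>x. f x \<partial>\<nu>)"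
    using s f_pos sets_eq_imp_space_eq[OF s(1)] by (intro nn_integral_eq_integral AE_I2) (auto intro: less_imp_le)
  then have "to_prob \<nu> \<in> space (prob_algebra X)"
    using s by (simp add: prob_to_prob_iff)
  then show "sets \<nu> = sets X \<and> to_prob \<nu> \<in> stationary"
    using invariant_imp_stationary s by simp
next
  assume "sets \<nu> = sets X \<and> to_prob \<nu> \<in> stationary"
  then have \<nu>: "sets \<nu> = sets X" and St: "to_prob \<nu> \<in> stationary" by auto
  have sp: "space \<nu> = space X" by (rule sets_eq_imp_space_eq[OF \<nu>])
  have [measurable]: "f \<in> borel_measurable \<nu>" using \<nu> by (simp cong: measurable_cong_sets)
  have "sigma_finite_measure \<nu>"
    using sigma_finite_of_prob[OF stationaryD(1)[OF St]] by (simp add: of_to_prob[OF \<nu>])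
  moreover have "invariant \<nu>"
    using stationary_imp_invariant[OF St] by (simp add: of_to_prob[OF \<nu>])
  moreover have 1: "(\<integral>\<^sup>+x. ennreal (f x) \<partial>\<nu>) = 1"
    using stationaryD(1)[OF St] prob_to_prob_iff[OF \<nu>] by simp
  moreover have nonneg: "AE x in \<nu>. 0 \<le> f x"
    using f_pos by (intro AE_I2) (simp add: sp less_imp_le)
  moreover have "integrable \<nu> f"
    using 1 nonneg by (intro integrableI_nonneg) simp_all
  moreover have "(\<integral>x. f x \<partial>\<nu>) = 1"
    using 1 nonneg by (subst integral_eq_nn_integral) simp_all
  ultimately show "\<nu> \<in> Inv"
    using \<nu> by (simp add: invariant_measures_def sigma_finite_measures_def invariant_def)
qed

lemma emeasure_to_prob_eq_0_iff:
  assumes \<nu>: "sets \<nu> = sets X" and A: "A \<in> sets X"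
  shows "emeasure (to_prob \<nu>) A = 0 \<longleftrightarrow> emeasure \<nu> A = 0"
proof -
  have sp: "space \<nu> = space X" by (rule sets_eq_imp_space_eq[OF \<nu>])
  have [measurable]: "A \<in> sets \<nu>" "f \<in> borel_measurable \<nu>" using \<nu> A by (simp_all cong: measurable_cong_sets)
  have "emeasure (to_prob \<nu>) A = 0 \<longleftrightarrow> (AE x in \<nu>. x \<in> A \<longrightarrow> ennreal (f x) = 0)"
    using null_sets_density_iff[of "\<lambda>x. ennreal (f x)" \<nu> A] \<nu> A by (simp add: to_prob_def null_sets_def)
  also have "\<dots> \<longleftrightarrow> (AE x in \<nu>. x \<notin> A)"
  proof (rule AE_cong)
    fix x assume "x \<in> space \<nu>"
    then have "0 < f x" by (simp add: sp f_pos)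
    then show "(x \<in> A \<longrightarrow> ennreal (f x) = 0) \<longleftrightarrow> x \<notin> A" by (simp add: ennreal_eq_0_iff)
  qed
  also have "\<dots> \<longleftrightarrow> emeasure \<nu> A = 0"
    using AE_iff_null_sets[of A \<nu>] by (simp add: null_sets_def)
  finally show ?thesis .
qed

text \<open>Since \<open>f\<close> is positive, \<open>\<nu>\<close> and
  \<open>to_prob \<nu>\<close> have the same null sets, and the tail events are the invariant sets;
  ergodicity is thus triviality of the tail under the law.\<close>

lemma ergodic_measures_iff:
  "\<nu> \<in> Erg \<longleftrightarrow> sets \<nu> = sets X \<and> to_prob \<nu> \<in> ergodic_laws"
proof (cases "\<nu> \<in> Inv")
  case True
  then have \<nu>: "sets \<nu> = sets X" and St: "to_prob \<nu> \<in> stationary" by (simp_all add: invariant_measures_iff)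
  have sp: "space \<nu> = space X" by (rule sets_eq_imp_space_eq[OF \<nu>])
  note null = emeasure_to_prob_eq_0_iff[OF \<nu>]
  interpret prob_space "to_prob \<nu>" by (rule stationaryD[OF St])
  have "emeasure (to_prob \<nu>) A = 1 \<longleftrightarrow> emeasure \<nu> (space X - A) = 0" if A: "A \<in> sets X" for A
  proof -
    have "emeasure (to_prob \<nu>) (space X - A) = 1 - emeasure (to_prob \<nu>) A"
      using emeasure_compl[of A "to_prob \<nu>"] A \<nu> emeasure_space_1 by (simp add: sp)
    then have "emeasure (to_prob \<nu>) A = 1 \<longleftrightarrow> emeasure (to_prob \<nu>) (space X - A) = 0"
      using prob_le_1[of A] by (simp add: emeasure_eq_measure ennreal_minus flip: ennreal_1)
    also have "\<dots> \<longleftrightarrow> emeasure \<nu> (space X - A) = 0"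
      using A by (intro null) auto
    finally show ?thesis .
  qed
  then have "to_prob \<nu> \<in> ergodic_laws \<longleftrightarrow> ergodic G X T \<nu>"
    unfolding ergodic_laws_iff_tail_trivial[OF St] ergodic_def using null sets_tail_iff by auto
  then show ?thesis using True \<nu> by (simp add: ergodic_measures_def)
next
  case False
  then show ?thesis
    by (auto simp: ergodic_measures_def invariant_measures_iff ergodic_laws_def)
qed

end

subsection \<open>Measurability on the space of sigma-finite measures\<close>

lemma space_sigma_finite_algebra: "space (sigma_finite_algebra X) = sigma_finite_measures X"
  by (simp add: sigma_finite_algebra_def space_measure_of_conv)

lemma sigma_finite_algebra_generator:
  assumes "A \<in> sets X"
  shows "{\<nu>\<in>sigma_finite_measures X. ereal \<alpha> < enn2ereal (emeasure \<nu> A) \<and> enn2ereal (emeasure \<nu> A) < ereal \<beta>}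
    \<in> sets (sigma_finite_algebra X)"
  unfolding sigma_finite_algebra_def using assms by (subst sets_measure_of) auto

lemma measurable_emeasure_sigma_finite [measurable]:
  assumes A: "A \<in> sets X"
  shows "(\<lambda>\<nu>. emeasure \<nu> A) \<in> borel_measurable (sigma_finite_algebra X)"
proof (rule borel_measurableI_less)
  let ?S = "\<lambda>y. {\<nu>\<in>space (sigma_finite_algebra X). emeasure \<nu> A < y}"
  have real: "?S (ennreal b) \<in> sets (sigma_finite_algebra X)" if "0 \<le> b" for b
  proof -
    \<comment> \<open>The generators are bounded on both sides; the lower bound -1 is satisfied by
      every measure.\<close>
    have "?S (ennreal b) = {\<nu>\<in>sigma_finite_measures X. ereal (- 1) < enn2ereal (emeasure \<nu> A) \<and> enn2ereal (emeasure \<nu> A) < ereal b}"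
      using that enn2ereal_nonneg by (auto simp: space_sigma_finite_algebra less_ennreal.rep_eq enn2ereal_ennreal
        intro: less_le_trans[of "ereal (- 1)" 0])
    then show ?thesis using sigma_finite_algebra_generator[OF A] by simp
  qed
  fix y
  show "?S y \<in> sets (sigma_finite_algebra X)"
  proof (cases y)
    case (real b)
    then show ?thesis using \<open>\<And>b. 0 \<le> b \<Longrightarrow> ?S (ennreal b) \<in> _\<close> by simp
  next
    case top
    \<comment> \<open>Having finite measure is not a generator, but it is a countable union of
      bounds by natural numbers.\<close>
    have "?S y = (\<Union>n. ?S (ennreal (real n)))"
      using ennreal_Ex_less_of_nat by (auto simp: top ennreal_of_nat_eq_real_of_nat less_top[symmetric] intro: less_trans)
    then show ?thesis using real by auto
  qed
qed

lemma measurable_sigma_finite_algebraI: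
  assumes sp: "\<And>x. x \<in> space M \<Longrightarrow> \<phi> x \<in> sigma_finite_measures X"
    and m: "\<And>A. A \<in> sets X \<Longrightarrow> (\<lambda>x. emeasure (\<phi> x) A) \<in> borel_measurable M"
  shows "\<phi> \<in> measurable M (sigma_finite_algebra X)"
  unfolding sigma_finite_algebra_def
proof (rule measurable_measure_of)
  show "\<phi> \<in> space M \<rightarrow> sigma_finite_measures X" using sp by auto
  fix S assume "S \<in> {{\<nu> \<in> sigma_finite_measures X. ereal \<alpha> < enn2ereal (emeasure \<nu> A) \<and> enn2ereal (emeasure \<nu> A) < ereal \<beta>} |\<alpha> \<beta> A. A \<in> sets X}"
  then obtain \<alpha> \<beta> A where A: "A \<in> sets X"
    and S: "S = {\<nu> \<in> sigma_finite_measures X. ereal \<alpha> < enn2ereal (emeasure \<nu> A) \<and> enn2ereal (emeasure \<nu> A) < ereal \<beta>}"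
    by blast
  note [measurable] = m[OF A]
  have "{x\<in>space M. ereal \<alpha> < enn2ereal (emeasure (\<phi> x) A) \<and> enn2ereal (emeasure (\<phi> x) A) < ereal \<beta>} \<in> sets M"
    by measurable
  moreover have "\<phi> -` S \<inter> space M = {x\<in>space M. ereal \<alpha> < enn2ereal (emeasure (\<phi> x) A) \<and> enn2ereal (emeasure (\<phi> x) A) < ereal \<beta>}"
    using sp by (auto simp: S)
  ultimately show "\<phi> -` S \<inter> space M \<in> sets M" by simp
qed auto

lemma measurable_nn_integral_sigma_finite:
  assumes h: "h \<in> borel_measurable X"
  shows "(\<lambda>\<nu>. \<integral>\<^sup>+x. h x \<partial>\<nu>) \<in> borel_measurable (sigma_finite_algebra X)"
proof -
  have sets: "\<nu> \<in> space (sigma_finite_algebra X) \<Longrightarrow> sets \<nu> = sets X" for \<nu>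
    by (simp add: space_sigma_finite_algebra sigma_finite_measures_def)
  have mcong: "\<nu> \<in> space (sigma_finite_algebra X) \<Longrightarrow> measurable \<nu> N = measurable X N" for \<nu> N
    using sets by (intro measurable_cong_sets) simp_all
  from h show ?thesis
  proof (induction rule: borel_measurable_induct)
    case (cong f g)
    have "(\<integral>\<^sup>+x. f x \<partial>\<nu>) = (\<integral>\<^sup>+x. g x \<partial>\<nu>)" if "\<nu> \<in> space (sigma_finite_algebra X)" for \<nu>
      using cong(3) sets_eq_imp_space_eq[OF sets[OF that]] by (intro nn_integral_cong) simp
    then show ?case using cong(4) by (simp cong: measurable_cong)
  next
    case (set A)
    have "(\<integral>\<^sup>+x. indicator A x \<partial>\<nu>) = emeasure \<nu> A" if "\<nu> \<in> space (sigma_finite_algebra X)" for \<nu>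
      using set sets[OF that] by simp
    then show ?case using measurable_emeasure_sigma_finite[OF set] by (simp cong: measurable_cong)
  next
    case (mult u c)
    have "(\<integral>\<^sup>+x. c * u x \<partial>\<nu>) = c * (\<integral>\<^sup>+x. u x \<partial>\<nu>)" if "\<nu> \<in> space (sigma_finite_algebra X)" for \<nu>
      using mult(2) by (intro nn_integral_cmult) (simp add: mcong[OF that])
    then show ?case using mult by (simp cong: measurable_cong)
  next
    case (add u v)
    have "(\<integral>\<^sup>+x. v x + u x \<partial>\<nu>) = (\<integral>\<^sup>+x. v x \<partial>\<nu>) + (\<integral>\<^sup>+x. u x \<partial>\<nu>)" if "\<nu> \<in> space (sigma_finite_algebra X)" for \<nu>
      using add by (intro nn_integral_add) (simp_all add: mcong[OF that])
    then show ?case using add by (simp cong: measurable_cong)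
  next
    case (seq U)
    have "(\<integral>\<^sup>+x. (SUP i. U i) x \<partial>\<nu>) = (SUP i. \<integral>\<^sup>+x. U i x \<partial>\<nu>)" if "\<nu> \<in> space (sigma_finite_algebra X)" for \<nu>
      unfolding SUP_apply using seq by (intro nn_integral_monotone_convergence_SUP) (simp_all add: mcong[OF that])
    then show ?case using seq by (simp cong: measurable_cong)
  qed
qed

section \<open>Borel sets of invariant and of ergodic measures\<close>

context compact_averages
begin

lemma measurable_of_prob: "of_prob \<in> measurable (prob_algebra X) (sigma_finite_algebra X)"
proof (rule measurable_sigma_finite_algebraI)
  show "of_prob P \<in> sigma_finite_measures X" if "P \<in> space (prob_algebra X)" for P
    using sigma_finite_of_prob[OF that] prob_algebraD[OF that] by (simp add: sigma_finite_measures_def)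
  fix A assume A [measurable]: "A \<in> sets X"
  have "emeasure (of_prob P) A = (\<integral>\<^sup>+x. ennreal (1 / f x) * indicator A x \<partial>P)" if "P \<in> space (prob_algebra X)" for P
    using nn_integral_of_prob[of P "indicator A"] prob_algebraD(1)[OF that] A by simp
  moreover have "(\<lambda>P. \<integral>\<^sup>+x. ennreal (1 / f x) * indicator A x \<partial>P) \<in> borel_measurable (prob_algebra X)"
    by (rule measurable_nn_integral_prob_algebra) measurable
  ultimately show "(\<lambda>P. emeasure (of_prob P) A) \<in> borel_measurable (prob_algebra X)"
    by (simp cong: measurable_cong)
qed

text \<open>Exactly the measures that \<open>to_prob\<close> sends to probability measures. The set
  is measurable, so preimages taken inside it are Borel in the whole space.\<close>

definition normalised :: "'a measure set" where
  "normalised = {\<nu>\<in>space (sigma_finite_algebra X). (\<integral>\<^sup>+x. ennreal (f x) \<partial>\<nu>) = 1}"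

lemma normalised_in_sets: "normalised \<in> sets (sigma_finite_algebra X)"
proof -
  have [measurable]: "(\<lambda>\<nu>. \<integral>\<^sup>+x. ennreal (f x) \<partial>\<nu>) \<in> borel_measurable (sigma_finite_algebra X)"
    by (rule measurable_nn_integral_sigma_finite) simp
  show ?thesis unfolding normalised_def by measurable
qed

lemma normalisedD:
  assumes "\<nu> \<in> normalised"
  shows "sets \<nu> = sets X" "to_prob \<nu> \<in> space (prob_algebra X)" "prob_space (to_prob \<nu>)"
  using assms prob_to_prob_iff prob_algebraD(3)[of "to_prob \<nu>" X]
  by (auto simp: normalised_def space_sigma_finite_algebra sigma_finite_measures_def)

lemma measurable_to_prob: "to_prob \<in> measurable (restrict_space (sigma_finite_algebra X) normalised) (prob_algebra X)"
proof (rule measurable_prob_algebraI)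
  have sp: "space (restrict_space (sigma_finite_algebra X) normalised) = normalised"
    by (auto simp: space_restrict_space normalised_def)
  show "prob_space (to_prob \<nu>)" if "\<nu> \<in> space (restrict_space (sigma_finite_algebra X) normalised)" for \<nu>
    using that normalisedD by (simp add: sp)
  show "to_prob \<in> measurable (restrict_space (sigma_finite_algebra X) normalised) (subprob_algebra X)"
  proof (rule measurable_subprob_algebra)
    fix A assume A [measurable]: "A \<in> sets X"
    have "emeasure (to_prob \<nu>) A = (\<integral>\<^sup>+x. ennreal (f x) * indicator A x \<partial>\<nu>)" if "\<nu> \<in> normalised" for \<nu>
      using nn_integral_to_prob[of \<nu> "indicator A"] normalisedD(1)[OF that] A by simp
    moreover have "(\<lambda>\<nu>. \<integral>\<^sup>+x. ennreal (f x) * indicator A x \<partial>\<nu>) \<in> borel_measurable (restrict_space (sigma_finite_algebra X) normalised)"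
      by (intro measurable_restrict_space1 measurable_nn_integral_sigma_finite) measurable
    ultimately show "(\<lambda>\<nu>. emeasure (to_prob \<nu>) A) \<in> borel_measurable (restrict_space (sigma_finite_algebra X) normalised)"
      by (subst measurable_cong) (simp_all add: sp)
  qed (use normalisedD prob_space_imp_subprob_space[OF normalisedD(3)] in \<open>auto simp: sp\<close>)
qed

lemma normalised_iff: "\<nu> \<in> normalised \<longleftrightarrow> sets \<nu> = sets X \<and> to_prob \<nu> \<in> space (prob_algebra X)"
proof
  assume "sets \<nu> = sets X \<and> to_prob \<nu> \<in> space (prob_algebra X)"
  then have \<nu>: "sets \<nu> = sets X" "to_prob \<nu> \<in> space (prob_algebra X)" by auto
  then have "sigma_finite_measure \<nu>"
    using sigma_finite_of_prob[OF \<nu>(2)] by (simp add: of_to_prob)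
  then show "\<nu> \<in> normalised"
    using \<nu> prob_to_prob_iff[OF \<nu>(1)] by (simp add: normalised_def space_sigma_finite_algebra sigma_finite_measures_def)
qed (use normalisedD in blast)

lemma vimage_to_prob_in_sets:
  assumes "S \<in> sets (prob_algebra X)"
  shows "{\<nu>. sets \<nu> = sets X \<and> to_prob \<nu> \<in> S} \<in> sets (sigma_finite_algebra X)"
proof -
  have SP: "S \<subseteq> space (prob_algebra X)" by (rule sets.sets_into_space[OF assms])
  have "to_prob -` S \<inter> space (restrict_space (sigma_finite_algebra X) normalised) \<in> sets (restrict_space (sigma_finite_algebra X) normalised)"
    by (rule measurable_sets[OF measurable_to_prob assms])
  then have "to_prob -` S \<inter> space (restrict_space (sigma_finite_algebra X) normalised) \<in> sets (sigma_finite_algebra X)"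
    using normalised_in_sets by (subst (asm) sets_restrict_space_iff) auto
  moreover have "to_prob -` S \<inter> space (restrict_space (sigma_finite_algebra X) normalised) = {\<nu>. sets \<nu> = sets X \<and> to_prob \<nu> \<in> S}"
  proof -
    have "space (restrict_space (sigma_finite_algebra X) normalised) = normalised"
      by (auto simp: space_restrict_space normalised_def)
    then show ?thesis using SP normalised_iff by blast
  qed
  ultimately show ?thesis by simp
qed

lemma Inv_in_sets: "Inv \<in> sets (sigma_finite_algebra X)"
proof -
  have "Inv = {\<nu>. sets \<nu> = sets X \<and> to_prob \<nu> \<in> stationary}"
    using invariant_measures_iff by blast
  then show ?thesis using vimage_to_prob_in_sets[OF stationary_in_sets] by simp
qed

lemma Erg_in_sets: "Erg \<in> sets (sigma_finite_algebra X)"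
proof -
  have "Erg = {\<nu>. sets \<nu> = sets X \<and> to_prob \<nu> \<in> ergodic_laws}"
    using ergodic_measures_iff by blast
  then show ?thesis using vimage_to_prob_in_sets[OF ergodic_laws_in_sets] by simp
qed

lemma Inv_subset_normalised: "Inv \<subseteq> normalised"
  using stationaryD(1) by (auto simp: invariant_measures_iff normalised_iff)

lemma Erg_subset_Inv: "Erg \<subseteq> Inv"
  by (auto simp: ergodic_measures_def)

end
section \<open>The decomposing measure\<close>

context compact_averages
begin

abbreviation "EB \<equiv> ergodic_borel_space G X T f"

definition kern :: "'a \<Rightarrow> 'a measure" where "kern x = of_prob (limit_kernel x)"

text \<open>The kernel takes ergodic values only almost surely, so its image measure is formed on
  all sigma-finite measures and then restricted to \<open>Erg\<close>, which carries full
  mass.\<close>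

definition law :: "'a measure \<Rightarrow> 'a measure measure" where
  "law \<nu> = restrict_space (distr (to_prob \<nu>) (sigma_finite_algebra X) kern) Erg"

text \<open>The mixture of the measures \<open>\<eta>\<close> under \<open>m\<close>. It is formed
  on the level of laws, where \<open>to_prob\<close> is a probability kernel and \<open>bind\<close>
  applies, and then transported back.\<close>

definition barycentre :: "'a measure measure \<Rightarrow> 'a measure" where
  "barycentre m = of_prob (m \<bind> to_prob)"

lemma Erg_subset_space: "Erg \<subseteq> space (sigma_finite_algebra X)"
  using sets.sets_into_space[OF Erg_in_sets] .

lemma space_EB: "space EB = Erg"
  using Erg_subset_space by (auto simp: ergodic_borel_space_def space_restrict_space)

lemma sets_EB: "C \<in> sets EB \<longleftrightarrow> C \<in> sets (sigma_finite_algebra X) \<and> C \<subseteq> Erg"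
  unfolding ergodic_borel_space_def using Erg_in_sets by (subst sets_restrict_space_iff) auto

lemma measurable_EB: "\<phi> \<in> measurable (sigma_finite_algebra X) N \<Longrightarrow> \<phi> \<in> measurable EB N"
  unfolding ergodic_borel_space_def by (rule measurable_restrict_space1)

lemma measurable_kern: "kern \<in> measurable X (sigma_finite_algebra X)"
  using measurable_compose[OF measurable_limit_kernel_X measurable_of_prob] by (simp add: kern_def[abs_def])

lemma to_prob_EB: "to_prob \<in> measurable EB (prob_algebra X)"
  unfolding ergodic_borel_space_def
  by (rule measurable_restrict_mono[OF measurable_to_prob]) (use Erg_subset_Inv Inv_subset_normalised in blast)

lemma InvD:
  assumes "\<nu> \<in> Inv" shows "sets \<nu> = sets X" "to_prob \<nu> \<in> stationary" "sets (to_prob \<nu>) = sets X"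
  using assms by (simp_all add: invariant_measures_iff)

lemma ErgD:
  assumes "\<eta> \<in> Erg" shows "sets \<eta> = sets X" "to_prob \<eta> \<in> ergodic_laws" "to_prob \<eta> \<in> stationary"
  using assms by (simp_all add: ergodic_measures_iff ergodic_laws_def)

lemma of_prob_Inv: "P \<in> stationary \<Longrightarrow> of_prob P \<in> Inv"
  using stationaryD(2)[of P] by (simp add: invariant_measures_iff to_of_prob)

lemma AE_kern_Erg:
  assumes P: "P \<in> stationary" shows "AE x in P. kern x \<in> Erg"
  using AE_limit_kernel_ergodic[OF P] AE_space
proof eventually_elim
  case (elim x)
  then have "sets (limit_kernel x) = sets X" by (simp add: limit_kernel_prob stationaryD[OF P])
  then show ?case using elim by (simp add: kern_def ergodic_measures_iff to_of_prob)
qed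

lemma emeasure_law:
  assumes \<nu>: "\<nu> \<in> Inv" and C: "C \<in> sets EB"
  shows "emeasure (law \<nu>) C = emeasure (to_prob \<nu>) (kern -` C \<inter> space X)"
proof -
  have C': "C \<in> sets (sigma_finite_algebra X)" "C \<subseteq> Erg" using C by (simp_all add: sets_EB)
  have k: "kern \<in> measurable (to_prob \<nu>) (sigma_finite_algebra X)"
    using measurable_kern InvD(3)[OF \<nu>] by (simp cong: measurable_cong_sets)
  have "emeasure (law \<nu>) C = emeasure (distr (to_prob \<nu>) (sigma_finite_algebra X) kern) C"
    unfolding law_def using C' Erg_in_sets Erg_subset_space
    by (intro emeasure_restrict_space) (auto simp: Int_absorb2)
  also have "\<dots> = emeasure (to_prob \<nu>) (kern -` C \<inter> space X)"
    using k C' sets_eq_imp_space_eq[OF InvD(1)[OF \<nu>]] by (simp add: emeasure_distr)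
  finally show ?thesis .
qed

lemma sets_law: "sets (law \<nu>) = sets EB"
  by (simp add: law_def ergodic_borel_space_def sets_restrict_space)

lemma law_prob:
  assumes \<nu>: "\<nu> \<in> Inv" shows "law \<nu> \<in> space (prob_algebra EB)"
proof -
  note St = InvD(2)[OF \<nu>]
  interpret prob_space "to_prob \<nu>" by (rule stationaryD[OF St])
  have "Erg \<in> sets EB" using sets.top[of EB] by (simp add: space_EB)
  then have "emeasure (law \<nu>) (space (law \<nu>)) = emeasure (to_prob \<nu>) (kern -` Erg \<inter> space X)"
    using emeasure_law[OF \<nu>, of Erg] sets_eq_imp_space_eq[OF sets_law[of \<nu>]] by (simp add: space_EB)
  also have "\<dots> = 1"
  proof (rule emeasure_eq_1_AE)
    show "kern -` Erg \<inter> space X \<in> events"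
      using measurable_sets[OF measurable_kern Erg_in_sets] by (simp add: InvD[OF \<nu>])
    show "AE x in to_prob \<nu>. x \<in> kern -` Erg \<inter> space X"
      using AE_kern_Erg[OF St] AE_space by eventually_elim (simp add: stationaryD(3)[OF St, simplified])
  qed
  finally have "prob_space (law \<nu>)" by (rule prob_spaceI)
  then show ?thesis using sets_law by (simp add: space_prob_algebra)
qed

lemma nn_integral_law:
  assumes \<nu>: "\<nu> \<in> Inv" and \<phi>: "\<phi> \<in> borel_measurable (sigma_finite_algebra X)"
  shows "(\<integral>\<^sup>+\<eta>. \<phi> \<eta> \<partial>law \<nu>) = (\<integral>\<^sup>+x. \<phi> (kern x) \<partial>to_prob \<nu>)"
proof -
  have k: "kern \<in> measurable (to_prob \<nu>) (sigma_finite_algebra X)"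
    using measurable_kern InvD(3)[OF \<nu>] by (simp cong: measurable_cong_sets)
  let ?D = "distr (to_prob \<nu>) (sigma_finite_algebra X) kern"
  have "(\<integral>\<^sup>+\<eta>. \<phi> \<eta> \<partial>law \<nu>) = (\<integral>\<^sup>+\<eta>. \<phi> \<eta> * indicator Erg \<eta> \<partial>?D)"
    unfolding law_def using Erg_in_sets Erg_subset_space by (intro nn_integral_restrict_space) (simp add: Int_absorb2)
  also have "\<dots> = (\<integral>\<^sup>+x. \<phi> (kern x) * indicator Erg (kern x) \<partial>to_prob \<nu>)"
    using k \<phi> Erg_in_sets by (intro nn_integral_distr) simp_all
  also have "\<dots> = (\<integral>\<^sup>+x. \<phi> (kern x) \<partial>to_prob \<nu>)"
  proof (rule nn_integral_cong_AE)
    show "AE x in to_prob \<nu>. \<phi> (kern x) * indicator Erg (kern x) = \<phi> (kern x)"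
      using AE_kern_Erg[OF InvD(2)[OF \<nu>]] by eventually_elim simp
  qed
  finally show ?thesis .
qed

text \<open>The conditional distribution property is applied to \<open>1 / f\<close> times the
  indicator of \<open>A\<close>. Everything is nonnegative, so sets of infinite measure are covered
  as well.\<close>

lemma emeasure_eq_nn_integral_law:
  assumes \<nu>: "\<nu> \<in> Inv" and A: "A \<in> sets X"
  shows "emeasure \<nu> A = (\<integral>\<^sup>+\<eta>. emeasure \<eta> A \<partial>law \<nu>)"
proof -
  note St = InvD(2)[OF \<nu>]
  have m: "(\<lambda>x. ennreal (1 / f x) * indicator A x) \<in> borel_measurable X" using A by measurable
  have of: "emeasure (of_prob P) A = (\<integral>\<^sup>+x. ennreal (1 / f x) * indicator A x \<partial>P)" if "sets P = sets X" for P
    using nn_integral_of_prob[OF that, of "indicator A"] A that by simp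
  have "(\<integral>\<^sup>+\<eta>. emeasure \<eta> A \<partial>law \<nu>) = (\<integral>\<^sup>+x. emeasure (kern x) A \<partial>to_prob \<nu>)"
    by (rule nn_integral_law[OF \<nu> measurable_emeasure_sigma_finite[OF A]])
  also have "\<dots> = (\<integral>\<^sup>+x. indicator (space X) x * (\<integral>\<^sup>+y. ennreal (1 / f y) * indicator A y \<partial>limit_kernel x) \<partial>to_prob \<nu>)"
    using sets_eq_imp_space_eq[OF InvD(1)[OF \<nu>]]
    by (intro nn_integral_cong) (simp add: kern_def of limit_kernel_prob)
  also have "\<dots> = (\<integral>\<^sup>+x. indicator (space X) x * (ennreal (1 / f x) * indicator A x) \<partial>to_prob \<nu>)"
    using sets.top[of tail] by (intro nn_integral_limit_kernel[OF St _ m]) (simp add: space_tail)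
  also have "\<dots> = (\<integral>\<^sup>+x. ennreal (1 / f x) * indicator A x \<partial>to_prob \<nu>)"
    using sets_eq_imp_space_eq[OF InvD(1)[OF \<nu>]] by (intro nn_integral_cong) simp
  also have "\<dots> = emeasure (of_prob (to_prob \<nu>)) A"
    by (rule of[symmetric]) (rule InvD[OF \<nu>])
  finally show ?thesis by (simp add: of_to_prob InvD[OF \<nu>])
qed

lemma is_decompositionI:
  assumes \<nu>: "sets \<nu> = sets X" and m: "sets m = sets EB"
    and eq: "\<And>A. A \<in> sets X \<Longrightarrow> emeasure \<nu> A = (\<integral>\<^sup>+\<eta>. emeasure \<eta> A \<partial>m)"
  shows "is_decomposition \<nu> m"
  unfolding is_decomposition_def
proof (intro ballI impI conjI)
  fix A assume "A \<in> sets \<nu>" and fin: "emeasure \<nu> A < \<infinity>"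
  then have A: "A \<in> sets X" using \<nu> by simp
  show "(\<lambda>\<eta>. emeasure \<eta> A) \<in> borel_measurable m"
    using measurable_EB[OF measurable_emeasure_sigma_finite[OF A]] m by (simp cong: measurable_cong_sets)
  show "emeasure \<nu> A = (\<integral>\<^sup>+\<eta>. emeasure \<eta> A \<partial>m)" by (rule eq[OF A])
  then show "(\<integral>\<^sup>+\<eta>. emeasure \<eta> A \<partial>m) < \<infinity>" using fin by simp
qed

text \<open>A decomposition is tested only on sets of finite measure. Cutting \<open>A\<close> by a
  disjoint partition into such sets and summing extends the identity to all measurable sets.\<close>

lemma is_decompositionD:
  assumes \<nu>: "\<nu> \<in> Inv" and m: "sets m = sets EB" and dec: "is_decomposition \<nu> m" and A: "A \<in> sets X"
  shows "emeasure \<nu> A = (\<integral>\<^sup>+\<eta>. emeasure \<eta> A \<partial>m)"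
proof -
  note sn = InvD(1)[OF \<nu>]
  interpret sigma_finite_measure \<nu> using \<nu> by (simp add: invariant_measures_def sigma_finite_measures_def)
  obtain B :: "nat \<Rightarrow> 'a set" where B: "range B \<subseteq> sets \<nu>" "(\<Union>i. B i) = space \<nu>" "\<And>i. emeasure \<nu> (B i) \<noteq> \<infinity>" "disjoint_family B"
    using sigma_finite_disjoint by metis
  have BX: "A \<inter> B i \<in> sets X" for i using B(1) A sn by auto
  have disj: "disjoint_family (\<lambda>i. A \<inter> B i)" using B(4) by (auto simp: disjoint_family_on_def)
  have Un: "(\<Union>i. A \<inter> B i) = A"
    using B(2) sets.sets_into_space[OF A] sets_eq_imp_space_eq[OF sn] by auto
  have sum: "emeasure \<eta> A = (\<Sum>i. emeasure \<eta> (A \<inter> B i))" if "sets \<eta> = sets X" for \<eta>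
  proof -
    have "(\<Sum>i. emeasure \<eta> (A \<inter> B i)) = emeasure \<eta> (\<Union>i. A \<inter> B i)"
      using BX disj that by (intro suminf_emeasure) auto
    then show ?thesis by (simp only: Un)
  qed
  have fin: "emeasure \<nu> (A \<inter> B i) < \<infinity>" for i
    using emeasure_mono[of "A \<inter> B i" "B i" \<nu>] B(1) B(3)[of i] by (auto simp: less_top top_unique)
  have d: "emeasure \<nu> (A \<inter> B i) = (\<integral>\<^sup>+\<eta>. emeasure \<eta> (A \<inter> B i) \<partial>m)" for i
    using dec fin[of i] BX[of i] sn by (simp add: is_decomposition_def)
  have "emeasure \<nu> A = (\<Sum>i. \<integral>\<^sup>+\<eta>. emeasure \<eta> (A \<inter> B i) \<partial>m)"
    by (simp add: sum[OF sn] d)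
  also have "\<dots> = (\<integral>\<^sup>+\<eta>. (\<Sum>i. emeasure \<eta> (A \<inter> B i)) \<partial>m)"
    using measurable_EB[OF measurable_emeasure_sigma_finite[OF BX]] m
    by (intro nn_integral_suminf[symmetric]) (simp cong: measurable_cong_sets)
  also have "\<dots> = (\<integral>\<^sup>+\<eta>. emeasure \<eta> A \<partial>m)"
    using sets_eq_imp_space_eq[OF m] ErgD(1) by (intro nn_integral_cong) (simp add: sum space_EB)
  finally show ?thesis .
qed

lemma nn_integral_decomposition:
  assumes \<nu>: "sets \<nu> = sets X" and m: "sets m = sets EB"
    and eq: "\<And>A. A \<in> sets X \<Longrightarrow> emeasure \<nu> A = (\<integral>\<^sup>+\<eta>. emeasure \<eta> A \<partial>m)"
    and h: "h \<in> borel_measurable X"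
  shows "(\<integral>\<^sup>+x. h x \<partial>\<nu>) = (\<integral>\<^sup>+\<eta>. \<integral>\<^sup>+x. h x \<partial>\<eta> \<partial>m)"
proof -
  have sp: "\<eta> \<in> space m \<Longrightarrow> sets \<eta> = sets X" for \<eta>
    using sets_eq_imp_space_eq[OF m] ErgD(1) by (simp add: space_EB)
  have mcong: "measurable \<nu> N = measurable X N" "\<eta> \<in> space m \<Longrightarrow> measurable \<eta> N = measurable X N"
    for \<eta> and N :: "ennreal measure"
    using sp \<nu> by (simp_all cong: measurable_cong_sets)
  have meas: "(\<lambda>\<eta>. \<integral>\<^sup>+x. u x \<partial>\<eta>) \<in> borel_measurable m" if "u \<in> borel_measurable X" for u
    using measurable_EB[OF measurable_nn_integral_sigma_finite[OF that]] m by (simp cong: measurable_cong_sets)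
  from h show ?thesis
  proof (induction rule: borel_measurable_induct)
    case (cong u v)
    have "(\<integral>\<^sup>+x. u x \<partial>\<eta>) = (\<integral>\<^sup>+x. v x \<partial>\<eta>)" if "sets \<eta> = sets X" for \<eta>
      using cong(3) sets_eq_imp_space_eq[OF that] by (intro nn_integral_cong) simp
    then show ?case using cong(4) \<nu> sp by (simp cong: nn_integral_cong)
  next
    case (set A)
    then show ?case using eq \<nu> sp by (simp cong: nn_integral_cong)
  next
    case (mult u c)
    then show ?case
      by (simp add: nn_integral_cmult mcong meas cong: nn_integral_cong)
  next
    case (add u v)
    then show ?case
      by (simp add: nn_integral_add mcong meas cong: nn_integral_cong)
  next
    case (seq U)
    have U: "U i \<in> borel_measurable X" for i by (rule seq)
    have inc: "incseq U" using seq by blast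
    have "(\<integral>\<^sup>+x. (SUP i. U i) x \<partial>\<nu>) = (SUP i. \<integral>\<^sup>+x. U i x \<partial>\<nu>)"
      unfolding SUP_apply using U inc by (intro nn_integral_monotone_convergence_SUP) (simp_all add: mcong)
    also have "\<dots> = (SUP i. \<integral>\<^sup>+\<eta>. \<integral>\<^sup>+x. U i x \<partial>\<eta> \<partial>m)"
      using seq by simp
    also have "\<dots> = (\<integral>\<^sup>+\<eta>. (SUP i. \<integral>\<^sup>+x. U i x \<partial>\<eta>) \<partial>m)"
    proof (rule nn_integral_monotone_convergence_SUP[symmetric])
      show "incseq (\<lambda>i \<eta>. \<integral>\<^sup>+x. U i x \<partial>\<eta>)"
        using inc by (auto simp: incseq_def le_fun_def intro!: nn_integral_mono)
      show "(\<lambda>\<eta>. \<integral>\<^sup>+x. U i x \<partial>\<eta>) \<in> borel_measurable m" for i by (rule meas[OF U])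
    qed
    also have "\<dots> = (\<integral>\<^sup>+\<eta>. \<integral>\<^sup>+x. (SUP i. U i) x \<partial>\<eta> \<partial>m)"
    proof (rule nn_integral_cong)
      fix \<eta> assume "\<eta> \<in> space m"
      then show "(SUP i. \<integral>\<^sup>+x. U i x \<partial>\<eta>) = (\<integral>\<^sup>+x. (SUP i. U i) x \<partial>\<eta>)"
        unfolding SUP_apply using U inc by (intro nn_integral_monotone_convergence_SUP[symmetric]) (simp_all add: mcong)
    qed
    finally show ?case .
  qed
qed

text \<open>The event that \<open>kern x\<close> lies in \<open>C\<close> has mass
  \<open>indicator C \<eta>\<close> under the law of each ergodic \<open>\<eta>\<close>. Integration
  against \<open>m\<close> gives \<open>emeasure m C\<close> on one side and the mass of the event
  under \<open>to_prob \<nu>\<close>, which is that of \<open>C\<close> under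
  \<open>law \<nu>\<close>, on the other.\<close>

theorem decomposition_unique:
  assumes \<nu>: "\<nu> \<in> Inv" and m: "m \<in> space (prob_algebra EB)" and dec: "is_decomposition \<nu> m"
  shows "m = law \<nu>"
proof (rule measure_eqI)
  have sm: "sets m = sets EB" by (rule prob_algebraD[OF m])
  have spm: "space m = Erg" using sets_eq_imp_space_eq[OF sm] by (simp add: space_EB)
  show "sets m = sets (law \<nu>)" by (simp add: sm sets_law)
  fix C assume "C \<in> sets m"
  then have C: "C \<in> sets EB" by (simp add: sm)
  then have CS: "C \<in> sets (sigma_finite_algebra X)" by (simp add: sets_EB)
  let ?C = "of_prob -` C \<inter> space (prob_algebra X)"
  have C': "?C \<in> sets (prob_algebra X)" by (rule measurable_sets[OF measurable_of_prob CS])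
  let ?L = "limit_kernel -` ?C \<inter> space X"
  have L [measurable]: "?L \<in> sets X" by (rule measurable_sets[OF measurable_limit_kernel_X C'])
  have LC: "kern -` C \<inter> space X = ?L" by (auto simp: kern_def limit_kernel_prob(1))
  have P: "emeasure (to_prob \<eta>) ?L = (\<integral>\<^sup>+x. ennreal (f x) * indicator ?L x \<partial>\<eta>)" if "sets \<eta> = sets X" for \<eta>
    using nn_integral_to_prob[OF that, of "indicator ?L"] L that by simp
  have "emeasure (law \<nu>) C = emeasure (to_prob \<nu>) ?L"
    by (simp add: emeasure_law[OF \<nu> C] LC)
  also have "\<dots> = (\<integral>\<^sup>+\<eta>. \<integral>\<^sup>+x. ennreal (f x) * indicator ?L x \<partial>\<eta> \<partial>m)"
    unfolding P[OF InvD(1)[OF \<nu>]] using is_decompositionD[OF \<nu> sm dec]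
    by (intro nn_integral_decomposition[OF InvD(1)[OF \<nu>] sm]) measurable
  also have "\<dots> = (\<integral>\<^sup>+\<eta>. indicator C \<eta> \<partial>m)"
  proof (rule nn_integral_cong)
    fix \<eta> assume "\<eta> \<in> space m"
    then have \<eta>: "\<eta> \<in> Erg" by (simp add: spm)
    have "(\<integral>\<^sup>+x. ennreal (f x) * indicator ?L x \<partial>\<eta>) = emeasure (to_prob \<eta>) ?L"
      using P ErgD[OF \<eta>] by simp
    also have "\<dots> = indicator ?C (to_prob \<eta>)"
      by (rule ergodic_laws_preimage[OF ErgD(2)[OF \<eta>] C'])
    also have "\<dots> = indicator C \<eta>"
      using stationaryD(1)[OF ErgD(3)[OF \<eta>]] by (simp add: indicator_def of_to_prob ErgD(1)[OF \<eta>])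
    finally show "(\<integral>\<^sup>+x. ennreal (f x) * indicator ?L x \<partial>\<eta>) = indicator C \<eta>" .
  qed
  also have "\<dots> = emeasure m C" using \<open>C \<in> sets m\<close> by simp
  finally show "emeasure m C = emeasure (law \<nu>) C" by simp
qed

lemma law_decomposition: "\<nu> \<in> Inv \<Longrightarrow> is_decomposition \<nu> (law \<nu>)"
  by (intro is_decompositionI InvD sets_law emeasure_eq_nn_integral_law)

section \<open>Barycentres and the Borel isomorphism\<close>

lemma nn_integral_bind_to_prob:
  assumes m: "m \<in> space (prob_algebra EB)" and h: "h \<in> borel_measurable X"
  shows "(\<integral>\<^sup>+x. h x \<partial>(m \<bind> to_prob)) = (\<integral>\<^sup>+\<eta>. \<integral>\<^sup>+x. h x \<partial>to_prob \<eta> \<partial>m)"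
  using measurable_prob_algebraD[OF to_prob_EB] prob_algebraD(1)[OF m]
  by (intro nn_integral_bind[OF h]) (simp cong: measurable_cong_sets)

text \<open>The equations that characterise stationarity are linear in the law, so they pass from
  the components to the mixture.\<close>

lemma bind_to_prob_stationary:
  assumes m: "m \<in> space (prob_algebra EB)" shows "m \<bind> to_prob \<in> stationary"
proof -
  note mD = prob_algebraD[OF m]
  interpret prob_space m by (rule mD)
  have k: "to_prob \<in> measurable m (prob_algebra X)"
    using to_prob_EB mD(1) by (simp cong: measurable_cong_sets)
  have P: "m \<bind> to_prob \<in> space (prob_algebra X)"
    using prob_space_bind[of to_prob X] sets_bind[of m to_prob X] not_empty
      measurable_prob_algebraD[OF k] prob_algebraD[OF measurable_space[OF k]]
    by (auto simp: space_prob_algebra)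
  have E: "emeasure (m \<bind> to_prob) E = (\<integral>\<^sup>+\<eta>. emeasure (to_prob \<eta>) E \<partial>m)" if "E \<in> sets X" for E
    by (rule emeasure_bind[OF not_empty measurable_prob_algebraD[OF k] that])
  show ?thesis
    unfolding stationary_iff_below[OF P]
  proof (intro allI)
    fix n q
    have "(\<integral>\<^sup>+x. emeasure (average n x) (below q) \<partial>(m \<bind> to_prob)) = (\<integral>\<^sup>+\<eta>. \<integral>\<^sup>+x. emeasure (average n x) (below q) \<partial>to_prob \<eta> \<partial>m)"
      by (intro nn_integral_bind_to_prob[OF m] measurable_emeasure_kernel) simp
    also have "\<dots> = (\<integral>\<^sup>+\<eta>. emeasure (to_prob \<eta>) (below q) \<partial>m)"
    proof (rule nn_integral_cong)
      fix \<eta> assume "\<eta> \<in> space m"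
      then have "to_prob \<eta> \<in> stationary" using mD(2) ErgD(3) by (simp add: space_EB)
      then show "(\<integral>\<^sup>+x. emeasure (average n x) (below q) \<partial>to_prob \<eta>) = emeasure (to_prob \<eta>) (below q)"
        using stationary_iff_below[OF stationaryD(1)] by blast
    qed
    also have "\<dots> = emeasure (m \<bind> to_prob) (below q)" by (rule E[symmetric]) simp
    finally show "(\<integral>\<^sup>+x. emeasure (average n x) (below q) \<partial>(m \<bind> to_prob)) = emeasure (m \<bind> to_prob) (below q)" .
  qed
qed

lemma barycentre_Inv: "m \<in> space (prob_algebra EB) \<Longrightarrow> barycentre m \<in> Inv"
  unfolding barycentre_def by (intro of_prob_Inv bind_to_prob_stationary)

lemma emeasure_barycentre:
  assumes m: "m \<in> space (prob_algebra EB)" and A [measurable]: "A \<in> sets X"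
  shows "emeasure (barycentre m) A = (\<integral>\<^sup>+\<eta>. emeasure \<eta> A \<partial>m)"
proof -
  have of: "emeasure (of_prob P) A = (\<integral>\<^sup>+x. ennreal (1 / f x) * indicator A x \<partial>P)" if "sets P = sets X" for P
    using nn_integral_of_prob[OF that, of "indicator A"] A that by simp
  have "emeasure (barycentre m) A = (\<integral>\<^sup>+x. ennreal (1 / f x) * indicator A x \<partial>(m \<bind> to_prob))"
    unfolding barycentre_def by (rule of[OF stationaryD(2)[OF bind_to_prob_stationary[OF m]]])
  also have "\<dots> = (\<integral>\<^sup>+\<eta>. \<integral>\<^sup>+x. ennreal (1 / f x) * indicator A x \<partial>to_prob \<eta> \<partial>m)"
    by (intro nn_integral_bind_to_prob[OF m]) measurable
  also have "\<dots> = (\<integral>\<^sup>+\<eta>. emeasure \<eta> A \<partial>m)"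
  proof (rule nn_integral_cong)
    fix \<eta> assume "\<eta> \<in> space m"
    then have "sets \<eta> = sets X" using prob_algebraD(2)[OF m] ErgD(1) by (simp add: space_EB)
    then show "(\<integral>\<^sup>+x. ennreal (1 / f x) * indicator A x \<partial>to_prob \<eta>) = emeasure \<eta> A"
      using of[of "to_prob \<eta>"] by (simp add: of_to_prob)
  qed
  finally show ?thesis .
qed

text \<open>\<open>m\<close> decomposes its own barycentre, and the decomposition is unique.\<close>

lemma law_barycentre:
  assumes m: "m \<in> space (prob_algebra EB)" shows "law (barycentre m) = m"
  using decomposition_unique[OF barycentre_Inv[OF m] m]
    is_decompositionI[OF InvD(1)[OF barycentre_Inv[OF m]] prob_algebraD(1)[OF m] emeasure_barycentre[OF m]]
  by simp

lemma inj_on_law: "inj_on law Inv"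
proof (rule inj_onI)
  fix \<nu> \<nu>' assume *: "\<nu> \<in> Inv" "\<nu>' \<in> Inv" "law \<nu> = law \<nu>'"
  show "\<nu> = \<nu>'"
    using * InvD(1)[OF *(1)] InvD(1)[OF *(2)] emeasure_eq_nn_integral_law[OF *(1)] emeasure_eq_nn_integral_law[OF *(2)]
    by (intro measure_eqI) simp_all
qed

lemma space_restrict_Inv: "space (restrict_space (sigma_finite_algebra X) Inv) = Inv"
  using sets.sets_into_space[OF Inv_in_sets] by (auto simp: space_restrict_space)

text \<open>Both directions are measurable by explicit formulas: \<open>law \<nu>\<close> gives
  \<open>C\<close> the mass of a fixed set under \<open>to_prob \<nu>\<close>, and the inverse,
  \<open>barycentre\<close>, gives \<open>A\<close> the integral of
  \<open>emeasure \<eta> A\<close>.\<close>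

lemma borel_isomorphism_law:
  "borel_isomorphism (restrict_space (sigma_finite_algebra X) Inv) (prob_algebra EB) law"
  unfolding borel_isomorphism_def space_restrict_Inv
proof (intro conjI)
  have img: "law ` Inv = space (prob_algebra EB)"
  proof (intro equalityI subsetI)
    fix m assume m: "m \<in> space (prob_algebra EB)"
    show "m \<in> law ` Inv" using law_barycentre[OF m] barycentre_Inv[OF m] by (metis imageI)
  next
    fix m assume "m \<in> law ` Inv"
    then show "m \<in> space (prob_algebra EB)" using law_prob by blast
  qed
  show "bij_betw law Inv (space (prob_algebra EB))"
    unfolding bij_betw_def using inj_on_law img by simp
  show "law \<in> measurable (restrict_space (sigma_finite_algebra X) Inv) (prob_algebra EB)"
  proof (rule measurable_prob_algebraI)
    show "prob_space (law \<nu>)" if "\<nu> \<in> space (restrict_space (sigma_finite_algebra X) Inv)" for \<nu>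
      using that law_prob prob_algebraD(3) unfolding space_restrict_Inv by blast
    show "law \<in> measurable (restrict_space (sigma_finite_algebra X) Inv) (subprob_algebra EB)"
    proof (rule measurable_subprob_algebra)
      fix C assume C: "C \<in> sets EB"
      have L: "kern -` C \<inter> space X \<in> sets X"
        using measurable_sets[OF measurable_kern] C by (simp add: sets_EB)
      have "to_prob \<in> measurable (restrict_space (sigma_finite_algebra X) Inv) (prob_algebra X)"
        by (rule measurable_restrict_mono[OF measurable_to_prob Inv_subset_normalised])
      from measurable_compose[OF this measurable_emeasure_prob_algebra[OF L]]
      show "(\<lambda>\<nu>. emeasure (law \<nu>) C) \<in> borel_measurable (restrict_space (sigma_finite_algebra X) Inv)"
        by (rule measurable_cong[THEN iffD1, rotated]) (simp add: space_restrict_Inv emeasure_law[OF _ C])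
    next
      fix \<nu> assume "\<nu> \<in> space (restrict_space (sigma_finite_algebra X) Inv)"
      then have "\<nu> \<in> Inv" unfolding space_restrict_Inv .
      from prob_algebraD[OF law_prob[OF this]]
      show "subprob_space (law \<nu>)" "sets (law \<nu>) = sets EB" by (simp_all add: prob_space_imp_subprob_space)
    qed
  qed
  have inv: "inv_into Inv law m = barycentre m" if m: "m \<in> space (prob_algebra EB)" for m
    by (rule inv_into_f_eq[OF inj_on_law barycentre_Inv[OF m] law_barycentre[OF m]])
  have "barycentre \<in> measurable (prob_algebra EB) (restrict_space (sigma_finite_algebra X) Inv)"
  proof (rule measurable_restrict_space2)
    show "barycentre \<in> space (prob_algebra EB) \<rightarrow> Inv" using barycentre_Inv by auto
    show "barycentre \<in> measurable (prob_algebra EB) (sigma_finite_algebra X)"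
    proof (rule measurable_sigma_finite_algebraI)
      show "barycentre m \<in> sigma_finite_measures X" if "m \<in> space (prob_algebra EB)" for m
        using barycentre_Inv[OF that] by (simp add: invariant_measures_def)
      fix A assume A: "A \<in> sets X"
      have "(\<lambda>m. \<integral>\<^sup>+\<eta>. emeasure \<eta> A \<partial>m) \<in> borel_measurable (prob_algebra EB)"
        using measurable_compose[OF measurable_prob_algebraD[OF measurable_ident_sets[OF refl]]
          nn_integral_measurable_subprob_algebra[OF measurable_EB[OF measurable_emeasure_sigma_finite[OF A]]]] .
      then show "(\<lambda>m. emeasure (barycentre m) A) \<in> borel_measurable (prob_algebra EB)"
        by (rule measurable_cong[THEN iffD1, rotated]) (simp add: emeasure_barycentre[OF _ A])
    qed
  qed
  then show "inv_into Inv law \<in> measurable (prob_algebra EB) (restrict_space (sigma_finite_algebra X) Inv)"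
    by (rule measurable_cong[THEN iffD1, rotated]) (simp add: inv)
qed

text \<open>Both components of a convex combination \<open>\<eta>\<close> are absolutely continuous with respect to \<open>\<eta>\<close>, so
  their limit kernels are almost surely the law of \<open>\<eta>\<close>, and each is the integral of its own limit kernel.\<close>

lemma ergodic_indecomposable:
  assumes \<eta>: "\<eta> \<in> Erg" shows "indecomposable_in Inv \<eta>"
proof -
  \<comment> \<open>Absolute continuity with respect to an ergodic measure already forces equality
    inside \<open>Inv\<close>; the convex combination only supplies the null sets.\<close>
  have eq: "\<eta> = \<eta>'" if \<eta>': "\<eta>' \<in> Inv" and ac: "\<And>A. A \<in> sets X \<Longrightarrow> emeasure \<eta> A = 0 \<Longrightarrow> emeasure \<eta>' A = 0" for \<eta>'
  proof -
    note S = ErgD[OF \<eta>] and S' = InvD[OF \<eta>']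
    interpret P': prob_space "to_prob \<eta>'" by (rule stationaryD[OF S'(2)])
    have "AE y in to_prob \<eta>. limit_kernel y = to_prob \<eta>"
      using S(2) by (simp add: ergodic_laws_def)
    then obtain N where N: "N \<in> null_sets (to_prob \<eta>)" "{y\<in>space (to_prob \<eta>). limit_kernel y \<noteq> to_prob \<eta>} \<subseteq> N"
      by (auto elim!: AE_E simp: null_sets_def)
    have "N \<in> null_sets (to_prob \<eta>')"
      using N(1) ac S S' emeasure_to_prob_eq_0_iff[OF S(1)] emeasure_to_prob_eq_0_iff[OF S'(1)]
      by (auto simp: null_sets_def)
    moreover have "space (to_prob \<eta>) = space (to_prob \<eta>')"
      using sets_eq_imp_space_eq[OF S(1)] sets_eq_imp_space_eq[OF S'(1)] by simp
    ultimately have ae: "AE y in to_prob \<eta>'. limit_kernel y = to_prob \<eta>"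
      using N(2) by (intro AE_I'[of N]) auto
    have "to_prob \<eta>' = to_prob \<eta>"
    proof (rule prob_eqI_below)
      fix q
      have "emeasure (to_prob \<eta>') (below q) = (\<integral>\<^sup>+x. indicator (space X) x * indicator (below q) x \<partial>to_prob \<eta>')"
      proof -
        have "space X \<inter> below q = below q" by (auto simp: below_def)
        then show ?thesis using S' by (simp flip: indicator_inter_arith)
      qed
      also have "\<dots> = (\<integral>\<^sup>+x. indicator (space X) x * (\<integral>\<^sup>+y. indicator (below q) y \<partial>limit_kernel x) \<partial>to_prob \<eta>')"
        using sets.top[of tail] by (intro nn_integral_limit_kernel[OF S'(2), symmetric]) (simp_all add: space_tail)
      also have "\<dots> = (\<integral>\<^sup>+x. emeasure (to_prob \<eta>) (below q) \<partial>to_prob \<eta>')"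
      proof (rule nn_integral_cong_AE)
        show "AE x in to_prob \<eta>'. indicator (space X) x * (\<integral>\<^sup>+y. indicator (below q) y \<partial>limit_kernel x) = emeasure (to_prob \<eta>) (below q)"
          using ae AE_space
          by eventually_elim (simp add: S sets_eq_imp_space_eq[OF S'(1)])
      qed
      also have "\<dots> = emeasure (to_prob \<eta>) (below q)"
        using P'.emeasure_space_1 by simp
      finally show "emeasure (to_prob \<eta>') (below q) = emeasure (to_prob \<eta>) (below q)" .
    qed (rule stationaryD(1)[OF S'(2)], rule stationaryD(1)[OF S(3)])
    then show ?thesis using of_to_prob[OF S(1)] of_to_prob[OF S'(1)] by metis
  qed
  show ?thesis
    unfolding indecomposable_in_def
  proof (intro conjI ballI impI)
    show "\<eta> \<in> Inv" using \<eta> Erg_subset_Inv by blast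
    fix \<eta>1 \<eta>2 and \<alpha> :: real
    assume 1: "\<eta>1 \<in> Inv" and 2: "\<eta>2 \<in> Inv" and \<alpha>: "\<alpha> \<in> {0<..<1}"
      and comb: "\<forall>A\<in>sets \<eta>. emeasure \<eta> A = ennreal \<alpha> * emeasure \<eta>1 A + ennreal (1 - \<alpha>) * emeasure \<eta>2 A"
    \<comment> \<open>Both coefficients are positive, so a vanishing combination has vanishing
      terms.\<close>
    have "emeasure \<eta>1 A = 0 \<and> emeasure \<eta>2 A = 0" if "A \<in> sets X" "emeasure \<eta> A = 0" for A
      using comb that \<alpha> ErgD(1)[OF \<eta>] by (auto simp: ennreal_eq_0_iff)
    then have null: "\<And>A. A \<in> sets X \<Longrightarrow> emeasure \<eta> A = 0 \<Longrightarrow> emeasure \<eta>1 A = 0"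
      "\<And>A. A \<in> sets X \<Longrightarrow> emeasure \<eta> A = 0 \<Longrightarrow> emeasure \<eta>2 A = 0" by blast+
    show "\<eta> = \<eta>1" by (rule eq[OF 1 null(1)])
    show "\<eta> = \<eta>2" by (rule eq[OF 2 null(2)])
  qed
qed

end

theorem corollary1:
  fixes G :: "('g, 'm) monoid_scheme"
    and K :: "nat \<Rightarrow> 'g topology"
    and X :: "'a measure"
    and T :: "'g \<Rightarrow> 'a \<Rightarrow> 'a"
    and f :: "'a \<Rightarrow> real"
  assumes "inductively_compact_group G K"
    and "standard_borel_space X"
    and "measurable_action G K X T"
    and "f \<in> borel_measurable X"
    and "\<forall>x\<in>space X. 0 < f x"
    and "fibrewise_continuous K X T f"
  shows "invariant_measures G X T f \<in> sets (sigma_finite_algebra X) \<and>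
    ergodic_measures G X T f \<in> sets (sigma_finite_algebra X) \<and>
    (\<forall>\<eta>\<in>ergodic_measures G X T f. indecomposable_in (invariant_measures G X T f) \<eta>) \<and>
    (\<forall>\<nu>\<in>invariant_measures G X T f.
       \<exists>!m. m \<in> space (prob_algebra (ergodic_borel_space G X T f)) \<and> is_decomposition \<nu> m) \<and>
    borel_isomorphism
      (restrict_space (sigma_finite_algebra X) (invariant_measures G X T f))
      (prob_algebra (ergodic_borel_space G X T f))
      (\<lambda>\<nu>. THE m. m \<in> space (prob_algebra (ergodic_borel_space G X T f)) \<and> is_decomposition \<nu> m)"
proof -
  interpret inductively_compact_group G K by fact
  obtain code where "borel_isomorphism X (restrict_space borel {0..1::real}) code"
    using assms(2) unfolding standard_borel_space_def by blast
  then interpret compact_averages G K X code T f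
    using assms by unfold_locales auto
  let ?Phi = "\<lambda>\<nu>. THE m. m \<in> space (prob_algebra EB) \<and> is_decomposition \<nu> m"
  \<comment> \<open>The description is identified only on \<open>Inv\<close>, where existence and
    uniqueness are known; the facts that follow compare the two maps on this set alone.\<close>
  have Phi: "?Phi \<nu> = law \<nu>" if "\<nu> \<in> Inv" for \<nu>
    using law_prob[OF that] law_decomposition[OF that] decomposition_unique[OF that] by blast
  have bij: "bij_betw ?Phi Inv (space (prob_algebra EB)) \<longleftrightarrow> bij_betw law Inv (space (prob_algebra EB))"
    by (rule bij_betw_cong) (rule Phi)
  have meas: "?Phi \<in> measurable (restrict_space (sigma_finite_algebra X) Inv) (prob_algebra EB) \<longleftrightarrow>
      law \<in> measurable (restrict_space (sigma_finite_algebra X) Inv) (prob_algebra EB)"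
    by (rule measurable_cong) (simp only: space_restrict_Inv Phi)
  have inv: "inv_into Inv ?Phi = inv_into Inv law"
    unfolding inv_into_def using Phi by (intro ext arg_cong[where f = Eps]) auto
  have "borel_isomorphism (restrict_space (sigma_finite_algebra X) Inv) (prob_algebra EB) ?Phi"
    using borel_isomorphism_law unfolding borel_isomorphism_def space_restrict_Inv bij meas inv .
  moreover have "\<exists>!m. m \<in> space (prob_algebra EB) \<and> is_decomposition \<nu> m" if "\<nu> \<in> Inv" for \<nu>
    using law_prob[OF that] law_decomposition[OF that] decomposition_unique[OF that] by blast
  ultimately show ?thesis
    using Inv_in_sets Erg_in_sets ergodic_indecomposable by blast
qed

end
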